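(* Let $k\ge0$ and $k+1=\sum_{i=0}^u a_ip^i$ with $0\le a_i<p$. If every $a_i\ne0,p-1$, then the simple composition factors of $H^0_{SL(2)}(k)$ are exactly the modules $L_{SL(2)}(\ell_k(w))$ with $w\in W^u$ and $\ell_k(w)\ge0$. In general, the list of highest weights of the simple composition factors of $H^0_{SL(2)}(k)$ is obtained from the list of all $\ell_k(w)$, with $w\in W^u$ and $\ell_k(w)\ge0$, as follows: for each $i$ with $a_i=p-1$, the weights $\ell_k(w)$ corresponding to $w$ such that $w_i$ is $>$ are removed from the list; for each $i$ with $a_i=0$, the weights $\ell_k(w)$ corresponding to $w$ such that $w_i$ is $<$ are removed from the list; finally, duplicate listings of the remaining weights are removed.
   Context: $K$ is a field of characteristic $p>0$. $H^0_{SL(2)}(k)$ is the induced $SL(2)$-module of highest weight $k$ (dimension $k+1$, character $\sum_{i=0}^kx^{k-2i}$), and $L_{SL(2)}(k)$ is its simple socle, the simple module of highest weight $k$. Words. A word is a sequence $w=w_0w_1w_2\ldots$ in the symbols $<,\le,\ge,>$. Let $W_{-1}=\{<\le\le\le\cdots\}$ and $W_0=\{\ge<\le\le\cdots\}$. For $s\ge1$, $W_s$ consists of (i) the words obtained from each $w\in W_{s-1}$ by replacing $w_s$ (which is $<$) by $\ge$ and $w_{s+1}$ (which is $\le$) by $<$; (ii) the words obtained from each $w\in W_{-1}\cup\dots\cup W_{s-2}$ by replacing $w_s$ (which is $\le$) by $>$ and $w_{s+1}$ (which is $\le$) by $<$. Put $W^u=\bigcup_{j=-1}^{u-1}W_j$;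 for $w\in W^u$ all symbols $w_i$ with $i>u$ are $\le$ and play no role. For $w\in W^u$, $\ell_k(w)=k-\sum_{i:\,w_i\text{ is }\ge}2a_ip^i-\sum_{i:\,w_i\text{ is }>}2(a_i+1)p^i$. Removals are removals of entries indexed by words: the same integer may remain on the list because of another word. *)

theory Defs
  imports
    "HOL-Analysis.Determinants"
    "HOL-Algebra.Algebraic_Closure_Type"
    "HOL-Library.Function_Algebras"
begin

section \<open>The algebraic group SL(2) over a field\<close>

typedef (overloaded) 'a :: comm_ring_1 sl2 = "{A :: 'a^2^2. det A = 1}"
  by (rule exI[of _ "mat 1"]) simp

setup_lifting type_definition_sl2

instantiation sl2 :: (comm_ring_1) times
begin
lift_definition times_sl2 :: "'a sl2 \<Rightarrow> 'a sl2 \<Rightarrow> 'a sl2" is "(**)"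
  by (simp add: det_mul)
instance ..
end

text \<open>
  The group SL(2) over an arbitrary field \<open>K\<close> is treated in the classical way, as the group of
  points over the algebraic closure of \<open>K\<close> together with its \<open>K\<close>-structure, the coordinate ring
  \<open>K[SL(2)]\<close>.  As SL(2) is smooth, the functions on these points
  that are polynomials over \<open>K\<close> in the matrix entries form a ring isomorphic to
  \<open>K[x11, x12, x21, x22] / (det - 1)\<close>, and likewise for \<open>K[SL(2)] \<otimes> K[SL(2)]\<close> and functions on
  pairs of points.  So nothing is lost when \<open>K\<close> is finite: modules
  below are comodules over \<open>K[SL(2)]\<close>, not modules for the abstract group of \<open>K\<close>-points.
\<close>

type_synonym 'k regfun = "'k alg_closure sl2 \<Rightarrow> 'k alg_closure"
type_synonym 'k regfun2 = "'k alg_closure sl2 \<times> 'k alg_closure sl2 \<Rightarrow> 'k alg_closure"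

definition kscale :: "'k::field \<Rightarrow> ('x \<Rightarrow> 'k alg_closure) \<Rightarrow> ('x \<Rightarrow> 'k alg_closure)" where
  "kscale c f = (\<lambda>x. to_ac c * f x)"

interpretation K: vector_space "kscale :: 'k::field \<Rightarrow> ('x \<Rightarrow> 'k alg_closure) \<Rightarrow> _"
  by unfold_locales (simp_all add: kscale_def fun_eq_iff algebra_simps)

inductive_set coord_ring :: "('k::field) regfun set" where
  const: "(\<lambda>_. to_ac c) \<in> coord_ring"
| entry: "(\<lambda>g. Rep_sl2 g $ i $ j) \<in> coord_ring"
| add: "f \<in> coord_ring \<Longrightarrow> f' \<in> coord_ring \<Longrightarrow> (\<lambda>g. f g + f' g) \<in> coord_ring"
| mult: "f \<in> coord_ring \<Longrightarrow> f' \<in> coord_ring \<Longrightarrow> (\<lambda>g. f g * f' g) \<in> coord_ring"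


section \<open>Rational modules inside the regular module\<close>

definition comult :: "('k::field) regfun \<Rightarrow> 'k regfun2" where
  "comult f = (\<lambda>(g, h). f (g * h))"

definition tens :: "('k::field) regfun \<Rightarrow> 'k regfun \<Rightarrow> 'k regfun2" where
  "tens f c = (\<lambda>(g, h). f g * c h)"

text \<open>
  SL(2) acts on \<open>K[SL(2)]\<close> by right translation, \<open>(h f)(g) = f (g h)\<close>; the corresponding structure
  map \<open>f \<mapsto> \<Sum> f\<^sub>i \<otimes> c\<^sub>i\<close>, where \<open>h f = \<Sum> c\<^sub>i(h) f\<^sub>i\<close>, is \<open>comult\<close>.  A submodule \<open>V\<close> is a \<open>K\<close>-subspace
  mapped into \<open>V \<otimes> K[SL(2)]\<close>.
\<close>

definition sl2_submodule :: "('k::field) regfun set \<Rightarrow> bool" where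
  "sl2_submodule V \<longleftrightarrow> K.subspace V \<and> V \<subseteq> coord_ring \<and>
     (\<forall>f\<in>V. comult f \<in> K.span {tens v c |v c. v \<in> V \<and> c \<in> coord_ring})"

definition sl2_simple :: "('k::field) regfun set \<Rightarrow> bool" where
  "sl2_simple S \<longleftrightarrow> sl2_submodule S \<and> S \<noteq> {0} \<and> (\<forall>U. sl2_submodule U \<and> U \<subseteq> S \<longrightarrow> U = {0} \<or> U = S)"

definition socle :: "('k::field) regfun set \<Rightarrow> 'k regfun set" where
  "socle M = K.span (\<Union>{S. sl2_simple S \<and> S \<subseteq> M})"

definition coset :: "('k::field) regfun set \<Rightarrow> 'k regfun \<Rightarrow> 'k regfun set" where
  "coset W f = {f + w |w. w \<in> W}"

text \<open>
  \<open>V/W \<cong> L\<close> as modules.  The structure map of \<open>V/W\<close> sends the coset of \<open>f\<close> to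
  \<open>\<Sum> (v\<^sub>i + W) \<otimes> c\<^sub>i\<close> whenever that of \<open>V\<close> sends \<open>f\<close> to \<open>\<Sum> v\<^sub>i \<otimes> c\<^sub>i\<close>; the last conjunct says that
  \<open>\<psi>\<close> commutes with the structure maps.
\<close>

definition quotient_iso :: "('k::field) regfun set \<Rightarrow> 'k regfun set \<Rightarrow> 'k regfun set \<Rightarrow> bool" where
  "quotient_iso V W L \<longleftrightarrow> (\<exists>\<psi>. bij_betw \<psi> (coset W ` V) L \<and>
     (\<forall>f\<in>V. \<forall>g\<in>V. \<psi> (coset W (f + g)) = \<psi> (coset W f) + \<psi> (coset W g)) \<and>
     (\<forall>c. \<forall>f\<in>V. \<psi> (coset W (kscale c f)) = kscale c (\<psi> (coset W f))) \<and>
     (\<forall>f\<in>V. \<forall>ts. set ts \<subseteq> V \<times> coord_ring \<and> comult f = (\<Sum>(v, c)\<leftarrow>ts. tens v c) \<longrightarrow>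
        comult (\<psi> (coset W f)) = (\<Sum>(v, c)\<leftarrow>ts. tens (\<psi> (coset W v)) c)))"

definition composition_series :: "('k::field) regfun set \<Rightarrow> 'k regfun set list \<Rightarrow> bool" where
  "composition_series M Vs \<longleftrightarrow> Vs \<noteq> [] \<and> hd Vs = {0} \<and> last Vs = M \<and>
     (\<forall>V\<in>set Vs. sl2_submodule V) \<and>
     (\<forall>i. Suc i < length Vs \<longrightarrow> Vs ! i \<subset> Vs ! Suc i \<and>
        (\<forall>U. sl2_submodule U \<and> Vs ! i \<subseteq> U \<and> U \<subseteq> Vs ! Suc i \<longrightarrow> U = Vs ! i \<or> U = Vs ! Suc i))"


section \<open>Induced and simple modules\<close>

text \<open>
  \<open>H\<^sup>0(k)\<close> is induced from the Borel subgroup of lower triangular matrices \<open>b\<close>, on which the weight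
  \<open>k\<close> is the character \<open>b \<mapsto> b11 ^ k\<close>.
\<close>

definition H0 :: "nat \<Rightarrow> ('k::field) regfun set" where
  "H0 k = {f \<in> coord_ring. \<forall>b g. Rep_sl2 b $ 1 $ 2 = 0 \<longrightarrow> f (b * g) = (Rep_sl2 b $ 1 $ 1) ^ k * f g}"

definition Lsimple :: "nat \<Rightarrow> ('k::field) regfun set" where
  "Lsimple k = socle (H0 k)"

definition factor_weights :: "('k::field) regfun set list \<Rightarrow> nat list \<Rightarrow> bool" where
  "factor_weights Vs ls \<longleftrightarrow> length Vs = Suc (length ls) \<and>
     (\<forall>i<length ls. quotient_iso (Vs ! Suc i) (Vs ! i) (Lsimple (ls ! i)))"


section \<open>Words\<close>

datatype wsym = LT | LE | GE | GT

type_synonym word = "nat \<Rightarrow> wsym"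

inductive in_W :: "int \<Rightarrow> word \<Rightarrow> bool" where
  minus1: "in_W (-1) ((\<lambda>_. LE)(0 := LT))"
| zero: "in_W 0 ((\<lambda>_. LE)(0 := GE, 1 := LT))"
| ge: "s \<ge> 1 \<Longrightarrow> in_W (int s - 1) w \<Longrightarrow> in_W (int s) (w(s := GE, s + 1 := LT))"
| gt: "s \<ge> 1 \<Longrightarrow> -1 \<le> j \<Longrightarrow> j \<le> int s - 2 \<Longrightarrow> in_W j w \<Longrightarrow>
        in_W (int s) (w(s := GT, s + 1 := LT))"

definition Wu :: "nat \<Rightarrow> word set" where
  "Wu u = (\<Union>j\<in>{-1..int u - 1}. {w. in_W j w})"

text \<open>Words in \<open>Wu u\<close> have only finitely many symbols other than \<open>LE\<close>, so the sums below are finite.\<close>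

definition ell :: "nat \<Rightarrow> (nat \<Rightarrow> nat) \<Rightarrow> nat \<Rightarrow> word \<Rightarrow> int" where
  "ell p a k w = int k - (\<Sum>i | w i = GE. 2 * int (a i) * int p ^ i)
                       - (\<Sum>i | w i = GT. 2 * (int (a i) + 1) * int p ^ i)"

end

(*
  Under the right regular action H0(k) is the space of binary forms of degree k in the first row
  (x, y) of a matrix.  A torus argument shows that its submodules are spanned by monomials, so they
  correspond to the sets of exponents i (of x) closed under i -> j whenever p does not divide
  (i choose j), resp. (k-i choose j-i): these are the coefficients of the action of lower, resp.
  upper, unitriangular matrices, and together with the torus these generate SL(2).

  By Lucas' theorem (base p digits), the carries in the addition i + (k-i) + 1 = k + 1 can only
  decrease along these steps, and exponents with the same carries are connected.  So the layers of
  any composition series are the classes of exponents with given carries.  If t is the greatest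
  exponent of such a class, then taking the coefficient of x^t y^(k-t) defines, by Frobenius
  reciprocity, an isomorphism of the layer with the socle of H0(2t - k).  Finally a word is the same
  thing as a sequence of carries, the symbol at position n recording the carries into and out of
  position n; the words that are removed are the ones that do not occur as carries, and
  ell k w = 2t - k for the remaining ones.
*)
theory Submission
  imports Defs
begin

section \<open>Base \<open>p\<close> digits and carries\<close>

text \<open>The summand 1 in the addition does not change the classes: with and without it, the
  carries into position n differ only when p^n divides k + 1, and then neither of them depends on
  the exponent. It is there to make the sum k + 1, whose digits a_i occur in \<open>ell\<close>, and
  it is the carry that enters position 0 of every word. On the geometric side the obstacle is that K
  need not be closed, or even infinite. A submodule is only a K-subspace: points over the closure do
  not preserve it, and points over K may be too few. The comodule condition is therefore exploited
  along curves \<gamma> defined over K, where the coefficients in t of f(g \<gamma>(t)) lie again in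
  the submodule. Stability under all points is used only for spans over the closure, where
  generators of the group suffice. The list of weights refers to arbitrary isomorphisms of the
  layers with simple modules. Besides constructing one isomorphism for each layer, the proof
  therefore has to read off the highest weight from any given one; this is done with the weights of
  the torus.\<close>

lemma of_nat_binomial_lucas:
  assumes "prime (CHAR('a::idom))"
  defines "p \<equiv> CHAR('a)"
  shows "(of_nat (n choose m) :: 'a) = of_nat (n div p choose m div p) * of_nat (n mod p choose m mod p)"
proof -
  let ?X = "[:1, 1:] :: 'a poly"
  have p: "prime p" using assms by simp
  have pch: "p = CHAR('a poly)" by (simp add: p_def)
  have coeff_X: "coeff (?X ^ l) i = of_nat (l choose i)" for l i
  proof (cases "i \<le> l")
    case False
    have "degree (?X ^ l) \<le> degree ?X * l" by (rule degree_power_le)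
    with False show ?thesis by (simp add: coeff_eq_0 binomial_eq_0)
  qed (simp add: coeff_linear_poly_power)
  have "?X = 1 + monom 1 1" by (simp add: monom_altdef one_pCons)
  also have "\<dots> ^ p = 1 ^ p + monom 1 1 ^ p"
    using p by (intro freshmans_dream) (simp_all add: pch)
  finally have Xp: "?X ^ p = 1 + monom 1 p" by (simp add: monom_power)
  define q r where "q = n div p" and "r = n mod p"
  have "n = p * q + r" by (simp add: q_def r_def)
  \<comment> \<open>Coefficients of (1 + X)^n = (1 + X^p)^q (1 + X)^r are compared. As r < p, the
    power X^m arises only from X^(pj) with j = m div p.\<close>
  then have "?X ^ n = (?X ^ p) ^ q * ?X ^ r" by (metis power_add power_mult)
  also have "\<dots> = (\<Sum>j\<le>q. smult (of_nat (q choose j)) (monom 1 (p * j) * ?X ^ r))"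
    unfolding Xp add.commute[of 1] binomial_ring
    by (simp add: sum_distrib_right monom_power of_nat_poly)
  finally have "coeff (?X ^ n) m =
      (\<Sum>j\<le>q. of_nat (q choose j) * (if p * j \<le> m then of_nat (r choose (m - p * j)) else 0))"
    by (auto simp: coeff_sum coeff_monom_mult coeff_X intro!: sum.cong)
  also have "\<dots> = (\<Sum>j\<le>q. if j = m div p then of_nat (q choose j) * of_nat (r choose (m mod p)) else 0)"
  proof (intro sum.cong refl)
    fix j
    have "m - p * j \<ge> p" if "p * j \<le> m" "j \<noteq> m div p"
    proof -
      have "j < m div p" using that p
        by (metis div_le_mono le_neq_implies_less nonzero_mult_div_cancel_left not_prime_0)
      then have "p * Suc j \<le> p * (m div p)" by (intro mult_le_mono2) simp
      also have "\<dots> \<le> m" by simp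
      finally show ?thesis by (simp add: algebra_simps)
    qed
    moreover have "r < p" using p by (simp add: r_def prime_gt_0_nat)
    ultimately have "r choose (m - p * j) = 0" if "p * j \<le> m" "j \<noteq> m div p"
      using that by (intro binomial_eq_0) fastforce
    then show "of_nat (q choose j) * (if p * j \<le> m then of_nat (r choose (m - p * j)) else 0) =
      (if j = m div p then of_nat (q choose j) * of_nat (r choose (m mod p)) else (0::'a))"
      by (cases "j = m div p"; cases "p * j \<le> m") (simp_all add: minus_mult_div_eq_mod binomial_eq_0)
  qed
  also have "\<dots> = of_nat (q choose (m div p)) * of_nat (r choose (m mod p))"
    by (simp add: binomial_eq_0)
  finally show ?thesis by (simp add: coeff_X q_def r_def)
qed

definition digit :: "nat \<Rightarrow> nat \<Rightarrow> nat \<Rightarrow> nat" where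
  "digit p m n = m div p ^ n mod p"

lemma digit_less: "0 < p \<Longrightarrow> digit p m n < p"
  by (simp add: digit_def)

lemma digit_0: "digit p m 0 = m mod p"
  by (simp add: digit_def)

lemma digit_Suc: "digit p m (Suc n) = digit p (m div p) n"
  by (simp add: digit_def div_mult2_eq)

lemma mod_power_Suc: "m mod p ^ Suc n = m mod p ^ n + digit p m n * p ^ n" for m p n :: nat
proof -
  have "m mod p ^ Suc n = m mod (p ^ n * p)" by (simp add: mult.commute)
  then show ?thesis by (simp add: mod_mult2_eq digit_def)
qed

lemma mod_power_eq_sum_digits: "m mod p ^ n = (\<Sum>l<n. digit p m l * p ^ l)"
  by (induction n) (simp_all only: mod_power_Suc sum.lessThan_Suc, simp)

lemma sum_digits_less:
  fixes d :: "nat \<Rightarrow> nat"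
  assumes "\<And>l. l < n \<Longrightarrow> d l < p"
  shows "(\<Sum>l<n. d l * p ^ l) < p ^ n"
  using assms
proof (induction n)
  case (Suc n)
  have "(\<Sum>l<Suc n. d l * p ^ l) < p ^ n + d n * p ^ n"
    using Suc by simp
  also have "\<dots> = (d n + 1) * p ^ n" by simp
  also have "\<dots> \<le> p * p ^ n" using Suc.prems[of n] by (intro mult_le_mono1) simp
  finally show ?case by simp
qed simp

lemma sum_digits_mod:
  fixes d :: "nat \<Rightarrow> nat"
  assumes "\<And>l. l < N \<Longrightarrow> d l < p" "n \<le> N"
  shows "(\<Sum>l<N. d l * p ^ l) mod p ^ n = (\<Sum>l<n. d l * p ^ l)"
proof -
  have "(\<Sum>l<N. d l * p ^ l) = (\<Sum>l<n. d l * p ^ l) + (\<Sum>l=n..<N. d l * p ^ l)"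
    using assms(2) by (metis atLeast0LessThan le0 sum.atLeastLessThan_concat)
  moreover have "p ^ n dvd (\<Sum>l=n..<N. d l * p ^ l)"
    by (intro dvd_sum dvd_mult le_imp_power_dvd) simp
  moreover have "(\<Sum>l<n. d l * p ^ l) < p ^ n"
    using assms by (intro sum_digits_less) auto
  ultimately show ?thesis by (auto elim!: dvdE)
qed

lemma digit_sum_digits:
  fixes d :: "nat \<Rightarrow> nat"
  assumes "\<And>l. l < N \<Longrightarrow> d l < p" "n < N"
  shows "digit p (\<Sum>l<N. d l * p ^ l) n = d n"
proof -
  let ?m = "\<Sum>l<N. d l * p ^ l"
  have "?m mod p ^ Suc n = ?m mod p ^ n + d n * p ^ n"
    using assms by (subst (1 2) sum_digits_mod) auto
  moreover have "p > 0" using assms by fastforce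
  ultimately show ?thesis unfolding mod_power_Suc by simp
qed

lemma digit_eq_0:
  assumes "m < p ^ N" "N \<le> n" "p > 0"
  shows "digit p m n = 0"
proof -
  have "p ^ N \<le> p ^ n" using assms by (intro power_increasing) auto
  then show ?thesis using assms(1) by (simp add: digit_def)
qed

text \<open>Lucas' theorem splits off one digit at a time. For a single digit, a nonzero binomial
  coefficient divides the factorial of a number below p and so is prime to p.\<close>

lemma not_dvd_choose_iff_digits:
  assumes "prime (CHAR('a::idom))"
  defines "p \<equiv> CHAR('a)"
  shows "\<not> p dvd (n choose m) \<longleftrightarrow> (\<forall>l. digit p m l \<le> digit p n l)"
proof -
  have p: "prime p" using assms by simp
  show ?thesis
  proof (induction n arbitrary: m rule: less_induct)
    case (less n)
    show ?case
    proof (cases "n = 0")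
      case True
      \<comment> \<open>Since \<open>m < p ^ m\<close>, reduction modulo \<open>p ^ m\<close> keeps
        \<open>m\<close>, so if all digits were zero, \<open>m\<close> would be zero.\<close>
      have "\<exists>l. digit p m l > 0" if "m > 0"
      proof (rule ccontr)
        assume "\<not> ?thesis"
        then have "m mod p ^ m = 0" by (simp add: mod_power_eq_sum_digits)
        moreover have "m < p ^ m" by (rule power_gt_expt) (use p prime_gt_1_nat in auto)
        ultimately show False using that by simp
      qed
      moreover have "digit p 0 l = 0" for l by (simp add: digit_def)
      ultimately show ?thesis using True p
        by (cases "m = 0") (auto simp: binomial_eq_0 not_le prime_nat_iff)
    next
      case False
      have *: "\<not> p dvd (n mod p choose m mod p) \<longleftrightarrow> m mod p \<le> n mod p"
      proof
        assume "m mod p \<le> n mod p"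
        then have "(n mod p choose m mod p) dvd fact (n mod p)"
          by (metis binomial_fact_lemma dvd_triv_right)
        moreover have "\<not> p dvd fact (n mod p)"
          using p by (simp add: prime_dvd_fact_iff prime_gt_0_nat not_le)
        ultimately show "\<not> p dvd (n mod p choose m mod p)" using dvd_trans by blast
      qed (auto intro: ccontr simp: binomial_eq_0 not_le)
      have "p dvd (n choose m) \<longleftrightarrow> (of_nat (n choose m) :: 'a) = 0"
        by (simp add: p_def of_nat_eq_0_iff_char_dvd)
      also have "\<dots> \<longleftrightarrow> p dvd (n div p choose m div p) \<or> p dvd (n mod p choose m mod p)"
        by (subst of_nat_binomial_lucas)
          (use assms in \<open>auto simp: of_nat_eq_0_iff_char_dvd\<close>)
      finally have "\<not> p dvd (n choose m) \<longleftrightarrow>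
          (\<forall>l. digit p (m div p) l \<le> digit p (n div p) l) \<and> m mod p \<le> n mod p"
        using less.IH[of "n div p" "m div p"] False prime_gt_1_nat[OF p] * by simp
      also have "\<dots> \<longleftrightarrow> (\<forall>l. digit p m l \<le> digit p n l)"
        by (metis digit_0 digit_Suc not0_implies_Suc)
      finally show ?thesis .
    qed
  qed
qed

text \<open>
  \<open>carry p k i n\<close> is the carry into position \<open>n\<close> in the addition \<open>i + (k - i) + 1 = k + 1\<close>;
  the initial carry is the summand \<open>1\<close>.
\<close>

definition carry :: "nat \<Rightarrow> nat \<Rightarrow> nat \<Rightarrow> nat \<Rightarrow> bool" where
  "carry p k i n \<longleftrightarrow> (k + 1) mod p ^ n \<le> i mod p ^ n"

lemma carry_0: "carry p k i 0"
  by (simp add: carry_def)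

text \<open>This justifies the definition of \<open>carry\<close>, which compares with
  \<open>i\<close> alone. The truncated sum s is congruent to k + 1 and below 2 p^n. Without
  overflow its residue is s, which exceeds i mod p^n; with overflow it is s - p^n, which is at most
  i mod p^n because (k - i) mod p^n + 1 is at most p^n.\<close>

lemma carry_mod_eq:
  assumes "p > 0" "i \<le> k"
  shows "i mod p ^ n + (k - i) mod p ^ n + 1 = (k + 1) mod p ^ n + of_bool (carry p k i n) * p ^ n"
proof -
  let ?q = "p ^ n"
  have q: "?q > 0" using assms by simp
  define s where "s = i mod ?q + (k - i) mod ?q + 1"
  have s: "s mod ?q = (k + 1) mod ?q"
  proof -
    have "s mod ?q = (i + (k - i) + 1) mod ?q" unfolding s_def by (metis mod_add_eq mod_add_left_eq)
    then show ?thesis using assms(2) by simp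
  qed
  have bds: "i mod ?q < ?q" "(k - i) mod ?q < ?q" "(k + 1) mod ?q < ?q" using q by auto
  have "s < 2 * ?q" using bds unfolding s_def by linarith
  show ?thesis
  proof (cases "s < ?q")
    case True
    then have *: "s = (k + 1) mod ?q" using s by simp
    then have "\<not> carry p k i n" by (simp add: carry_def s_def)
    then show ?thesis using * by (simp add: s_def)
  next
    case False
    then have "s mod ?q = s - ?q" using \<open>s < 2 * ?q\<close> by (simp add: mod_if)
    then have *: "s = (k + 1) mod ?q + ?q" using s False by simp
    then have "carry p k i n" using bds unfolding carry_def s_def by linarith
    then show ?thesis using * by (simp add: s_def)
  qed
qed

lemma carry_iff_sum:
  assumes "p > 0" "i \<le> k"
  shows "carry p k i n \<longleftrightarrow> (k + 1) mod p ^ n < i mod p ^ n + (k - i) mod p ^ n + 1"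
  using carry_mod_eq[OF assms, of n] assms(1)
  by (cases "carry p k i n") (auto simp del: neq0_conv)

lemma carry_sym:
  assumes "p > 0" "i \<le> k"
  shows "carry p k (k - i) n = carry p k i n"
  using assms by (simp add: carry_iff_sum add.commute)

text \<open>The rule of written addition in position n: the identities for n and for n + 1 truncated
  digits are subtracted and p^n is cancelled.\<close>

lemma digit_carry:
  assumes "p > 0" "i \<le> k"
  shows "digit p i n + digit p (k - i) n + of_bool (carry p k i n)
    = digit p (k + 1) n + p * of_bool (carry p k i (Suc n))"
proof -
  have "(digit p i n + digit p (k - i) n + of_bool (carry p k i n)) * p ^ n
    = (digit p (k + 1) n + p * of_bool (carry p k i (Suc n))) * p ^ n"
    using carry_mod_eq[OF assms, of n] carry_mod_eq[OF assms, of "Suc n"]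
    unfolding mod_power_Suc by (simp add: algebra_simps)
  then show ?thesis using assms by simp
qed

text \<open>For fixed k, a carry into n asks that i mod p^n be large enough, and truncations grow
  with the digits.\<close>

lemma carry_mono:
  assumes "\<And>l. digit p m l \<le> digit p i l" "carry p k m n"
  shows "carry p k i n"
proof -
  have "m mod p ^ n \<le> i mod p ^ n"
    unfolding mod_power_eq_sum_digits using assms(1) by (intro sum_mono mult_le_mono1)
  then show ?thesis using assms(2) unfolding carry_def by linarith
qed

lemma not_carry:
  assumes "k + 1 < p ^ N" "i \<le> k" "N \<le> n" "p > 0"
  shows "\<not> carry p k i n"
proof -
  have "p ^ N \<le> p ^ n" using assms by (intro power_increasing) auto
  then show ?thesis using assms unfolding carry_def by (auto simp: not_le)
qed

lemma eq_sum_digits: "m < p ^ N \<Longrightarrow> m = (\<Sum>l<N. digit p m l * p ^ l)"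
  by (metis mod_less mod_power_eq_sum_digits)

text \<open>Equal carries force equal digit sums in each position of i and k - i and of j and k - j.
  So the number m formed from the smaller digits of i and j and the number m' formed from the larger
  complementary digits again add up to k. Then m is reached from i by a lower step, and j from m by
  an upper step.\<close>

lemma same_carry_connected:
  assumes "p > 1" "i \<le> k" "j \<le> k" and same: "\<And>n. carry p k i n = carry p k j n"
  obtains m where "m \<le> i" "m \<le> j" "\<And>l. digit p m l = min (digit p i l) (digit p j l)"
    "\<And>l. digit p (k - j) l \<le> digit p (k - m) l"
proof -
  obtain N where N: "k + 1 < p ^ N" 
    using power_gt_expt[of p "k + 1"] assms(1) by (metis One_nat_def)
  define d d' where "d l = min (digit p i l) (digit p j l)"
    and "d' l = max (digit p (k - i) l) (digit p (k - j) l)" for l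
  define m m' where "m = (\<Sum>l<N. d l * p ^ l)" and "m' = (\<Sum>l<N. d' l * p ^ l)"
  have eq: "digit p i l + digit p (k - i) l = digit p j l + digit p (k - j) l" for l
    using digit_carry[of p i k l] digit_carry[of p j k l] same assms by simp
  have i: "i = (\<Sum>l<N. digit p i l * p ^ l)" and j: "j = (\<Sum>l<N. digit p j l * p ^ l)"
    and i': "k - i = (\<Sum>l<N. digit p (k - i) l * p ^ l)"
    using N assms by (intro eq_sum_digits; simp)+
  \<comment> \<open>If i has the smaller digit, then k - i has the larger complementary digit, and
    likewise for j; so minimum and maximum belong to the same number.\<close>
  have "d l + d' l = digit p i l + digit p (k - i) l" for l
    using eq[of l] by (auto simp: d_def d'_def min_def max_def)
  then have "m + m' = i + (k - i)"
    by (subst i, subst i') (simp add: m_def m'_def flip: sum.distrib add_mult_distrib)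
  then have m': "k - m = m'" using assms by simp
  have less: "d l < p" "d' l < p" for l
    using digit_less[of p] assms by (auto simp: d_def d'_def min_def max_def)
  have m_digit: "digit p m l = d l" for l
  proof (cases "l < N")
    case True
    then show ?thesis unfolding m_def using less by (intro digit_sum_digits) auto
  next
    case False
    have "m < p ^ N" unfolding m_def using less by (intro sum_digits_less)
    then have "digit p m l = 0" using False assms by (intro digit_eq_0[of _ _ N]) auto
    moreover have "digit p i l = 0" using False N assms by (intro digit_eq_0[of _ _ N]) auto
    ultimately show ?thesis by (simp add: d_def)
  qed
  have m'_digit: "digit p (k - j) l \<le> digit p (k - m) l" for l
  proof (cases "l < N")
    case True
    then have "digit p m' l = d' l" unfolding m'_def using less by (intro digit_sum_digits) auto
    then show ?thesis by (simp add: m' d'_def)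
  next
    case False
    then have "digit p (k - j) l = 0" using N assms by (intro digit_eq_0[of _ _ N]) auto
    then show ?thesis by simp
  qed
  have "m \<le> i" by (subst i, unfold m_def, intro sum_mono mult_le_mono1) (simp add: d_def)
  moreover have "m \<le> j" by (subst j, unfold m_def, intro sum_mono mult_le_mono1) (simp add: d_def)
  ultimately show thesis using that m_digit m'_digit by (simp add: d_def)
qed

text \<open>Converse of \<open>digit_carry\<close>: digits that obey the rule of written addition
  with carries B come from a number and its complement in k. No carry leaves the last position, so
  the total is k + 1 itself and not only congruent to it.\<close>

lemma ex_carries:
  fixes d d' :: "nat \<Rightarrow> nat"
  assumes "p > 1" "k + 1 < p ^ N" "\<And>l. l < N \<Longrightarrow> d l < p" "\<And>l. l < N \<Longrightarrow> d' l < p" "B 0" "\<And>n. n \<ge> N \<Longrightarrow> \<not> B n"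
    and eq: "\<And>l. l < N \<Longrightarrow> d l + d' l + of_bool (B l) = digit p (k + 1) l + p * of_bool (B (Suc l))"
  shows "(\<Sum>l<N. d l * p ^ l) + (\<Sum>l<N. d' l * p ^ l) = k"
    and "carry p k (\<Sum>l<N. d l * p ^ l) n = B n"
proof -
  define t t' where "t = (\<Sum>l<N. d l * p ^ l)" and "t' = (\<Sum>l<N. d' l * p ^ l)"
  have part: "(\<Sum>l<n. d l * p ^ l) + (\<Sum>l<n. d' l * p ^ l) + 1 =
      (k + 1) mod p ^ n + of_bool (B n) * p ^ n" if "n \<le> N" for n
    using that
  proof (induction n)
    case (Suc n)
    have "(\<Sum>l<Suc n. d l * p ^ l) + (\<Sum>l<Suc n. d' l * p ^ l) + 1
      = (k + 1) mod p ^ n + (d n + d' n + of_bool (B n)) * p ^ n"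
      using Suc by (simp add: algebra_simps)
    also have "\<dots> = (k + 1) mod p ^ Suc n + of_bool (B (Suc n)) * p ^ Suc n"
      using Suc.prems unfolding mod_power_Suc by (subst eq) (auto simp: algebra_simps)
    finally show ?case .
  qed (use assms(5) in simp)
  from part[of N] have tt': "t + t' = k"
    using assms(2) assms(6)[of N] by (simp add: t_def t'_def)
  then show "(\<Sum>l<N. d l * p ^ l) + (\<Sum>l<N. d' l * p ^ l) = k" by (simp add: t_def t'_def)
  have "t \<le> k" and k_t: "k - t = t'" using tt' by auto
  have "carry p k t n = B n"
  proof (cases "n \<le> N")
    case True
    have "t mod p ^ n = (\<Sum>l<n. d l * p ^ l)" "t' mod p ^ n = (\<Sum>l<n. d' l * p ^ l)"
      unfolding t_def t'_def using assms True by (intro sum_digits_mod; simp)+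
    then show ?thesis using part[OF True] assms(1)
      by (subst carry_iff_sum) (use \<open>t \<le> k\<close> k_t in \<open>auto simp del: neq0_conv\<close>)
  next
    case False
    then show ?thesis using not_carry[OF assms(2) \<open>t \<le> k\<close>] assms by simp
  qed
  then show "carry p k (\<Sum>l<N. d l * p ^ l) n = B n" by (simp add: t_def)
qed

definition carry_class :: "nat \<Rightarrow> nat \<Rightarrow> nat \<Rightarrow> nat set" where
  "carry_class p k i = {j. j \<le> k \<and> (\<forall>n. carry p k j n = carry p k i n)}"

lemma finite_carry_class: "finite (carry_class p k i)"
  by (rule finite_subset[of _ "{..k}"]) (auto simp: carry_class_def)

section \<open>Words\<close>

definition word_of :: "(nat \<Rightarrow> bool) \<Rightarrow> word" where
  "word_of B n = (if B (Suc n) then (if B n then GE else GT) else (if B n then LT else LE))"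

text \<open>Both recursive rules for words add a carry into position s + 1: rule (i) when a carry
  enters s, rule (ii) when none does.\<close>

lemma word_of_upd: "word_of (B(Suc s := True)) =
    (word_of B)(s := (if B s then GE else GT), Suc s := (if B (Suc (Suc s)) then GE else LT))"
  by (rule ext) (auto simp: word_of_def)

text \<open>A rule with index s acts on the symbol at s, and the carry that it creates enters s + 1;
  hence the shift between the index j and the position of the last carry.\<close>

lemma in_W_imp_word_of:
  assumes "in_W j w"
  shows "-1 \<le> j \<and> (\<exists>B. w = word_of B \<and> B 0 \<and> B (nat (j + 1)) \<and> (\<forall>n. int n > j + 1 \<longrightarrow> \<not> B n))"
  using assms
proof induction
  case minus1
  show ?case by (intro conjI exI[of _ "\<lambda>n. n = 0"]) (auto simp: word_of_def)
next
  case zero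
  show ?case by (intro conjI exI[of _ "\<lambda>n. n \<le> 1"]) (auto simp: word_of_def)
next
  case (ge s w)
  then obtain B where B: "w = word_of B" "B 0" "B s" "\<And>n. n > s \<Longrightarrow> \<not> B n" by auto
  show ?case
    by (intro conjI exI[of _ "B(Suc s := True)"])
       (use B in \<open>simp_all add: word_of_upd nat_add_distrib del: fun_upd_apply\<close>, simp_all)
next
  case (gt s j w)
  then obtain B where B: "w = word_of B" "B 0" "\<And>n. int n > j + 1 \<Longrightarrow> \<not> B n" by auto
  have "\<not> B s" "\<not> B (Suc s)" "\<not> B (Suc (Suc s))" using B(3) gt by auto
  show ?case
    by (intro conjI exI[of _ "B(Suc s := True)"])
       (use B gt \<open>\<not> B s\<close> \<open>\<not> B (Suc (Suc s))\<close> in \<open>simp_all add: word_of_upd nat_add_distrib del: fun_upd_apply\<close>, simp_all)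
qed

text \<open>Induction on the position of the last carry. Removing that carry leaves a word to which
  rule (i) or (ii) applies, according to whether a carry enters the preceding position.\<close>

lemma word_of_in_W:
  assumes "B 0" "B s" "\<And>n. n > s \<Longrightarrow> \<not> B n"
  shows "in_W (int s - 1) (word_of B)"
  using assms
proof (induction s arbitrary: B rule: less_induct)
  case (less s)
  show ?case
  proof (cases "s \<le> 1")
    case True
    show ?thesis
    proof (cases "s = 0")
      case True
      then have "word_of B = (\<lambda>_. LE)(0 := LT)" using less.prems by (auto simp: word_of_def)
      then show ?thesis using True in_W.minus1 by (simp del: fun_upd_apply)
    next
      case False
      then have "s = 1" using True by simp
      then have "word_of B = (\<lambda>_. LE)(0 := GE, 1 := LT)" using less.prems
        by (auto simp: word_of_def)
      then show ?thesis using \<open>s = 1\<close> in_W.zero by (simp del: fun_upd_apply)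
    qed
  next
    case False
    then obtain r where r: "s = Suc r" "r \<ge> 1" by (cases s) auto
    define B' where "B' = B(s := False)"
    have "B = B'(Suc r := True)" using less.prems r by (intro ext) (auto simp: B'_def)
    then have wB: "word_of B = (word_of B')(r := (if B' r then GE else GT), r + 1 := LT)"
      using less.prems(3)[of "Suc (Suc r)"] r word_of_upd[of B' r] by (simp add: B'_def)
    have B'0: "B' 0" using less.prems r by (simp add: B'_def)
    show ?thesis
    proof (cases "B r")
      case True
      have "in_W (int r - 1) (word_of B')"
        using less.prems(3) True r B'0 by (intro less.IH) (auto simp: B'_def not_less_eq)
      then show ?thesis using in_W.ge[OF r(2)] wB True r by (simp add: B'_def del: fun_upd_apply) (simp add: fun_upd_apply)
    next
      case False
      \<comment> \<open>The last carry that is left when the one into s = r + 1 is removed. It lies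
        below r, so the index t - 1 is at most r - 2, as rule (ii) requires.\<close>
      define t where "t = Max {n. B' n}"
      have fin: "finite {n. B' n}"
        by (rule finite_subset[of _ "{..s}"]) (use less.prems(3) in \<open>auto simp: B'_def not_less[symmetric]\<close>)
      have t: "B' t" using Max_in[OF fin] B'0 unfolding t_def by blast
      then have "t < r"
        using False less.prems(3)[of t] r unfolding B'_def by (cases t r rule: linorder_cases) (auto split: if_splits)
      moreover have "\<not> B' n" if "n > t" for n using Max_ge[OF fin, of n] that by (auto simp: t_def)
      ultimately have "in_W (int t - 1) (word_of B')"
        using t B'0 r by (intro less.IH) auto
      then show ?thesis using in_W.gt[OF r(2), of "int t - 1"] \<open>t < r\<close> wB False r
        by (simp add: B'_def del: fun_upd_apply) (simp add: fun_upd_apply)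
    qed
  qed
qed

lemma Wu_eq: "Wu u = {word_of B |B. B 0 \<and> (\<forall>n>u. \<not> B n)}"
proof (intro equalityI subsetI)
  fix w assume "w \<in> Wu u"
  then obtain j where "j \<le> int u - 1" "in_W j w" by (auto simp: Wu_def)
  with in_W_imp_word_of[of j w] show "w \<in> {word_of B |B. B 0 \<and> (\<forall>n>u. \<not> B n)}" by fastforce
next
  fix w assume "w \<in> {word_of B |B. B 0 \<and> (\<forall>n>u. \<not> B n)}"
  then obtain B where B: "w = word_of B" "B 0" "\<forall>n>u. \<not> B n" by auto
  define t where "t = Max {n. B n}"
  have fin: "finite {n. B n}"
    by (rule finite_subset[of _ "{..u}"]) (use B in \<open>auto simp: not_less[symmetric]\<close>)
  have t: "B t" using Max_in[OF fin] B unfolding t_def by blast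
  have "\<not> B n" if "n > t" for n using Max_ge[OF fin, of n] that by (auto simp: t_def)
  then have "in_W (int t - 1) w" using word_of_in_W[of B t] t B by auto
  moreover have "t \<le> u" using t B(3) not_less by blast
  ultimately show "w \<in> Wu u" by (auto simp: Wu_def intro!: bexI[of _ "int t - 1"])
qed

text \<open>\<open>GE\<close> and \<open>GT\<close> are the symbols with an outgoing carry. They
  subtract a_n and a_n + 1, that is, a_n + 1 minus the incoming carry, which will be the digit of k
  - t for the greatest exponent t.\<close>

lemma ell_word_of:
  assumes "\<And>n. n > u \<Longrightarrow> \<not> B n"
  shows "ell p a k (word_of B) =
    int k - 2 * (\<Sum>n\<le>u. of_bool (B (Suc n)) * (int (a n) + 1 - of_bool (B n)) * int p ^ n)"
proof -
  have B: "B (Suc n) \<Longrightarrow> n \<le> u" for n using assms[of "Suc n"] by (cases "n \<le> u") auto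
  have 1: "{n. word_of B n = GE} = {n\<in>{..u}. B n \<and> B (Suc n)}"
    and 2: "{n. word_of B n = GT} = {n\<in>{..u}. \<not> B n \<and> B (Suc n)}"
    using B by (auto simp: word_of_def)
  have "(\<Sum>n | word_of B n = GE. 2 * int (a n) * int p ^ n) +
      (\<Sum>n | word_of B n = GT. 2 * (int (a n) + 1) * int p ^ n) =
    (\<Sum>n\<le>u. 2 * (of_bool (B (Suc n)) * (int (a n) + 1 - of_bool (B n)) * int p ^ n))"
    unfolding 1 2 sum.inter_filter[OF finite_atMost] sum.distrib[symmetric]
    by (intro sum.cong) auto
  then show ?thesis by (simp add: ell_def sum_distrib_left)
qed

lemma digit_expansion:
  assumes "m = (\<Sum>i\<le>u. a i * p ^ i)" "\<forall>i\<le>u. a i < p" "n \<le> u"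
  shows "digit p m n = a n"
  unfolding assms(1) lessThan_Suc_atMost[symmetric] using assms(2,3) by (intro digit_sum_digits) auto

lemma expansion_less:
  fixes a :: "nat \<Rightarrow> nat"
  assumes "m = (\<Sum>i\<le>u. a i * p ^ i)" "\<forall>i\<le>u. a i < p"
  shows "m < p ^ Suc u"
  unfolding assms(1) lessThan_Suc_atMost[symmetric]
  by (rule sum_digits_less) (use assms(2) in auto)

text \<open>
  The greatest summand with prescribed carries: in each position its digit is as large as the
  carries allow, and the complementary digits are those subtracted in \<open>ell\<close>.
\<close>

lemma greatest_with_carries:
  assumes p: "p > 1" and k: "k + 1 = (\<Sum>i\<le>u. a i * p ^ i)" and a: "\<forall>i\<le>u. a i < p"
    and B: "B 0" "\<And>n. n > u \<Longrightarrow> \<not> B n"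
    and GT: "\<And>n. n \<le> u \<Longrightarrow> a n = p - 1 \<Longrightarrow> B (Suc n) \<Longrightarrow> B n"
    and LT: "\<And>n. n \<le> u \<Longrightarrow> a n = 0 \<Longrightarrow> B n \<Longrightarrow> B (Suc n)"
  obtains t where "t \<le> k" "\<And>n. carry p k t n = B n"
    "ell p a k (word_of B) = 2 * int t - int k" "k \<le> 2 * t"
    "\<And>j l. j \<in> carry_class p k t \<Longrightarrow> digit p j l \<le> digit p t l"
proof -
  \<comment> \<open>If a carry leaves, the largest digit p - 1 is possible. If not, the whole digit
    sum goes to d and the complement gets 0.\<close>
  define d where "d n = (if B (Suc n) then p - 1 else a n - of_bool (B n))" for n
  define d' where "d' n = (if B (Suc n) then a n + 1 - of_bool (B n) else 0)" for n
  have k_less: "k + 1 < p ^ Suc u" using expansion_less[OF k a] .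
  have dig: "digit p (k + 1) n = a n" if "n \<le> u" for n using digit_expansion[OF k a that] .
  have d_less: "d n < p" if "n < Suc u" for n using p a that
    by (auto simp: d_def less_Suc_eq_le intro: le_less_trans[OF diff_le_self])
  \<comment> \<open>The formula for d' reaches p only for a_n = p - 1 with a carry leaving and none
    entering, which is excluded by \<open>GT\<close>.\<close>
  have d'_less: "d' n < p" if "n < Suc u" for n
  proof -
    have "a n < p" using a that by auto
    then show ?thesis using GT[of n] that by (cases "a n = p - 1") (auto simp: d'_def)
  qed
  \<comment> \<open>\<open>LT\<close> excludes a_n = 0 with a carry entering and none leaving, where
    the subtraction in d would be truncated.\<close>
  have sum: "d n + d' n + of_bool (B n) = digit p (k + 1) n + p * of_bool (B (Suc n))" if "n < Suc u" for n
    using dig[of n] LT[of n] that p by (cases "a n = 0") (auto simp: d_def d'_def)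
  define t t' where "t = (\<Sum>l<Suc u. d l * p ^ l)" and "t' = (\<Sum>l<Suc u. d' l * p ^ l)"
  have Bge: "\<not> B n" if "Suc u \<le> n" for n using B(2) that by simp
  have tt': "t + t' = k" and carry_t: "carry p k t n = B n" for n
    unfolding t_def t'_def by (rule ex_carries[OF p k_less d_less d'_less B(1) Bge sum]; assumption)+
  \<comment> \<open>The inequality holds digit by digit; it makes 2t - k nonnegative.\<close>
  have "t' \<le> t" unfolding t_def t'_def
  proof (intro sum_mono mult_le_mono1)
    fix n assume "n \<in> {..<Suc u}"
    then have "d' n < p" using d'_less by simp
    then show "d' n \<le> d n" by (auto simp: d_def d'_def)
  qed
  have "int t' = (\<Sum>n\<le>u. of_bool (B (Suc n)) * (int (a n) + 1 - of_bool (B n)) * int p ^ n)"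
    unfolding t'_def lessThan_Suc_atMost of_nat_sum by (intro sum.cong) (auto simp: d'_def)
  then have "ell p a k (word_of B) = 2 * int t - int k"
    using tt' by (subst ell_word_of[where u = u]) (use B(2) in auto)
  moreover have "digit p j l \<le> digit p t l" if j: "j \<in> carry_class p k t" for j l
  proof (cases "l \<le> u")
    case True
    have "digit p t l = d l" unfolding t_def using d_less True by (intro digit_sum_digits) auto
    moreover have "digit p j l + digit p (k - j) l + of_bool (B l) = a l + p * of_bool (B (Suc l))"
      using digit_carry[of p j k l] dig[OF True] j p by (simp add: carry_class_def carry_t)
    moreover have "digit p j l < p" using p by (simp add: digit_less)
    ultimately show ?thesis by (auto simp: d_def)
  next
    case False
    have "j < p ^ Suc u" using j k_less by (auto simp: carry_class_def)
    then show ?thesis using False p digit_eq_0[of j p "Suc u" l] by simp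
  qed
  ultimately show thesis using that[of t] tt' \<open>t' \<le> t\<close> carry_t by auto
qed

text \<open>Two digits add up to at most 2p - 2. With digit p - 1 of k + 1, an outgoing carry takes
  the sum 2p - 1, so a carry must enter. With digit 0, an entering carry makes the sum positive and
  divisible by p, so a carry must leave.\<close>

lemma carry_admissible:
  assumes p: "p > 1" and k: "k + 1 = (\<Sum>i\<le>u. a i * p ^ i)" and a: "\<forall>i\<le>u. a i < p" and "i \<le> k"
  shows "\<And>n. n > u \<Longrightarrow> \<not> carry p k i n"
    and "\<And>n. n \<le> u \<Longrightarrow> a n = p - 1 \<Longrightarrow> carry p k i (Suc n) \<Longrightarrow> carry p k i n"
    and "\<And>n. n \<le> u \<Longrightarrow> a n = 0 \<Longrightarrow> carry p k i n \<Longrightarrow> carry p k i (Suc n)"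
proof -
  show "\<not> carry p k i n" if "n > u" for n
    using expansion_less[OF k a] by (rule not_carry) (use assms that in auto)
  fix n assume n: "n \<le> u"
  have eq: "digit p i n + digit p (k - i) n + of_bool (carry p k i n) = a n + p * of_bool (carry p k i (Suc n))"
    using digit_carry[of p i k n] digit_expansion[OF k a n] assms by simp
  have less: "digit p i n < p" "digit p (k - i) n < p" using p by (simp_all add: digit_less)
  show "carry p k i n" if "a n = p - 1" "carry p k i (Suc n)"
    using eq less that by (cases "carry p k i n") auto
  show "carry p k i (Suc n)" if "a n = 0" "carry p k i n"
    using eq less that by (cases "carry p k i (Suc n)") auto
qed

lemma le_if_digits_le:
  assumes "p > 1" "\<And>l. digit p j l \<le> digit p t l"
  shows "j \<le> t"
proof -
  have "j < p ^ (j + t)" "t < p ^ (j + t)"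
    using power_gt_expt[of p "j + t"] assms(1) by simp_all
  then show ?thesis
    using eq_sum_digits[of j p "j + t"] eq_sum_digits[of t p "j + t"] assms(2)
    by (metis (no_types, lifting) mult_le_mono1 sum_mono)
qed

lemma Max_carry_class:
  assumes "p > 1" "t \<le> k" "\<And>j l. j \<in> carry_class p k t \<Longrightarrow> digit p j l \<le> digit p t l"
  shows "Max (carry_class p k t) = t"
  using assms finite_carry_class le_if_digits_le
  by (intro Max_eqI) (auto simp: carry_class_def)

text \<open>The construction from the carries yields an element of the class that dominates the
  others in every digit, and this identifies it with the maximum. By Lucas' theorem all (t choose j)
  with j in the class are then prime to p.\<close>

lemma Max_carry_class_greatest:
  assumes p: "p > 1" and "i \<le> k"
  defines "t \<equiv> Max (carry_class p k i)"
  shows "t \<in> carry_class p k i" "k \<le> 2 * t"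
    "\<And>j l. j \<in> carry_class p k i \<Longrightarrow> digit p j l \<le> digit p t l"
proof -
  obtain u where u: "k + 1 < p ^ Suc u"
    by (metis One_nat_def Suc_lessD lessI less_trans_Suc p power_gt_expt power_strict_increasing_iff)
  define a where "a = digit p (k + 1)"
  have k: "k + 1 = (\<Sum>i\<le>u. a i * p ^ i)"
    using eq_sum_digits[OF u] by (simp add: a_def lessThan_Suc_atMost)
  have a: "\<forall>i\<le>u. a i < p" using p by (simp add: a_def digit_less)
  obtain s where s: "s \<le> k" "\<And>n. carry p k s n = carry p k i n" "k \<le> 2 * s"
    "\<And>j l. j \<in> carry_class p k s \<Longrightarrow> digit p j l \<le> digit p s l"
    by (rule greatest_with_carries[OF p k a carry_0 carry_admissible[OF p k a \<open>i \<le> k\<close>]]) blast+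
  have "carry_class p k s = carry_class p k i" using s(2) by (simp add: carry_class_def)
  moreover have "t = s" using Max_carry_class[OF p s(1,4)] by (simp add: t_def calculation)
  ultimately show "t \<in> carry_class p k i" "k \<le> 2 * t"
    "\<And>j l. j \<in> carry_class p k i \<Longrightarrow> digit p j l \<le> digit p t l"
    using s by (auto simp: carry_class_def)
qed

text \<open>Surviving words and carry classes are matched through carry sequences. The two filters
  are the two admissibility conditions on carries, and \<open>k \<le> 2 * t\<close> supplies the
  condition that \<open>ell\<close> be nonnegative.\<close>

lemma admissible_ell_eq:
  assumes p: "p > 1" and k: "k + 1 = (\<Sum>i\<le>u. a i * p ^ i)" and a: "\<forall>i\<le>u. a i < p"
  shows "{ell p a k w |w. w \<in> Wu u \<and> ell p a k w \<ge> 0 \<and>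
          (\<forall>i\<le>u. a i = p - 1 \<longrightarrow> w i \<noteq> GT) \<and> (\<forall>i\<le>u. a i = 0 \<longrightarrow> w i \<noteq> LT)} =
    (\<lambda>i. 2 * int (Max (carry_class p k i)) - int k) ` {..k}" (is "?L = ?R")
proof (intro equalityI subsetI)
  fix x assume "x \<in> ?L"
  then obtain B where x: "x = ell p a k (word_of B)" and B: "B 0" "\<And>n. n > u \<Longrightarrow> \<not> B n"
    and w: "\<forall>i\<le>u. a i = p - 1 \<longrightarrow> word_of B i \<noteq> GT" "\<forall>i\<le>u. a i = 0 \<longrightarrow> word_of B i \<noteq> LT"
    unfolding Wu_eq by auto
  have adm: "a n = p - 1 \<Longrightarrow> B (Suc n) \<Longrightarrow> B n" "a n = 0 \<Longrightarrow> B n \<Longrightarrow> B (Suc n)" if "n \<le> u" for n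
    using w that by (auto simp: word_of_def split: if_splits)
  obtain t where t: "t \<le> k" "x = 2 * int t - int k"
    "\<And>j l. j \<in> carry_class p k t \<Longrightarrow> digit p j l \<le> digit p t l"
    unfolding x by (rule greatest_with_carries[OF p k a B adm]) blast+
  then show "x \<in> ?R" using Max_carry_class[OF p t(1,3)] by (intro image_eqI[of _ _ t]) auto
next
  fix x assume "x \<in> ?R"
  then obtain i where i: "i \<le> k" and x: "x = 2 * int (Max (carry_class p k i)) - int k" by auto
  define B where "B = carry p k i"
  have B: "B 0" "\<And>n. n > u \<Longrightarrow> \<not> B n"
    "\<And>n. n \<le> u \<Longrightarrow> a n = p - 1 \<Longrightarrow> B (Suc n) \<Longrightarrow> B n"
    "\<And>n. n \<le> u \<Longrightarrow> a n = 0 \<Longrightarrow> B n \<Longrightarrow> B (Suc n)"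
    unfolding B_def using carry_admissible[OF p k a i] carry_0 by blast+
  obtain t where t: "t \<le> k" "\<And>n. carry p k t n = B n"
    "ell p a k (word_of B) = 2 * int t - int k" "k \<le> 2 * t"
    "\<And>j l. j \<in> carry_class p k t \<Longrightarrow> digit p j l \<le> digit p t l"
    by (rule greatest_with_carries[OF p k a B]) blast+
  have "carry_class p k t = carry_class p k i" using t(2) by (simp add: carry_class_def B_def)
  then have "x = ell p a k (word_of B)" using Max_carry_class[OF p t(1,5)] x t(3) by simp
  moreover have "word_of B \<in> Wu u" unfolding Wu_eq using B by blast
  moreover have "word_of B n = GT \<Longrightarrow> a n \<noteq> p - 1" "word_of B n = LT \<Longrightarrow> a n \<noteq> 0" if "n \<le> u" for n
    using B(3,4)[OF that] by (auto simp: word_of_def split: if_splits)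
  moreover have "ell p a k (word_of B) \<ge> 0" using t(3,4) by simp
  ultimately show "x \<in> ?L" by blast
qed

section \<open>Polynomials over an infinite field\<close>

text \<open>Over a finite field, the product of all X - x, plus 1, would be a nonconstant polynomial
  without a root.\<close>

lemma infinite_UNIV_alg_closed: "infinite (UNIV :: 'a::alg_closed_field set)"
proof
  assume fin: "finite (UNIV :: 'a set)"
  define P where "P = (\<Prod>x\<in>UNIV. [:- x, 1:]) + (1 :: 'a poly)"
  have "degree (\<Prod>x\<in>UNIV. [:- x, 1 :: 'a:]) = card (UNIV :: 'a set)"
    by (subst degree_prod_eq_sum_degree) auto
  moreover have "card (UNIV :: 'a set) > 0" using fin by (simp add: card_gt_0_iff)
  ultimately have "degree P > 0" by (simp add: P_def degree_add_eq_left)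
  then obtain x where "poly P x = 0" using alg_closed_imp_poly_has_root by blast
  moreover have "poly (\<Prod>x\<in>UNIV. [:- x, 1 :: 'a:]) x = 0"
    using fin by (auto simp: poly_prod intro!: prod_zero bexI[of _ x])
  ultimately show False by (simp add: P_def)
qed

text \<open>The field is infinite, so values at nonzero points determine a polynomial. Zero is left
  out because the torus has parameters t \<noteq> 0.\<close>

lemma poly_eq_if_eq_off_0:
  fixes P Q :: "'a::alg_closed_field poly"
  assumes "\<And>t. t \<noteq> 0 \<Longrightarrow> poly P t = poly Q t"
  shows "P = Q"
proof (rule ccontr)
  assume "P \<noteq> Q"
  then have "finite {t. poly (P - Q) t = 0}" by (intro poly_roots_finite) simp
  moreover have "UNIV - {0} \<subseteq> {t. poly (P - Q) t = 0}" using assms by auto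
  ultimately have "finite (UNIV - {0 :: 'a})" using finite_subset by blast
  then show False using infinite_UNIV_alg_closed[where ?'a = 'a] by simp
qed

lemma poly_sum_monom: "poly (\<Sum>n\<in>A. monom (c n) n) t = (\<Sum>n\<in>A. c n * t ^ n :: 'a::comm_semiring_1)"
  by (simp add: poly_sum poly_monom)

lemma coeff_sum_monom: "finite A \<Longrightarrow> coeff (\<Sum>n\<in>A. monom (c n) n) m = (if m \<in> A then c m else 0)"
  by (simp add: coeff_sum)

text \<open>Polynomials over K among those over the closure. A K-subspace is closed under
  multiplication by their coefficients.\<close>

definition rational_poly :: "('k::field) alg_closure poly \<Rightarrow> bool" where
  "rational_poly P \<longleftrightarrow> (\<forall>n. coeff P n \<in> range to_ac)"

lemma range_to_ac_0: "0 \<in> range to_ac" and range_to_ac_1: "1 \<in> range to_ac"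
  by (metis rangeI to_ac_0) (metis rangeI to_ac_1)

lemma range_to_ac_add: "x \<in> range to_ac \<Longrightarrow> y \<in> range to_ac \<Longrightarrow> x + y \<in> range to_ac"
  and range_to_ac_mult: "x \<in> range to_ac \<Longrightarrow> y \<in> range to_ac \<Longrightarrow> x * y \<in> range to_ac"
  by (auto simp flip: to_ac_add to_ac_mult)

lemma range_to_ac_sum: "(\<And>i. i \<in> A \<Longrightarrow> f i \<in> range to_ac) \<Longrightarrow> sum f A \<in> range to_ac"
  by (induction A rule: infinite_finite_induct) (auto simp: range_to_ac_0 intro!: range_to_ac_add)

lemma rational_poly_add: "rational_poly P \<Longrightarrow> rational_poly Q \<Longrightarrow> rational_poly (P + Q)"
  by (simp add: rational_poly_def range_to_ac_add)

lemma rational_poly_mult: "rational_poly P \<Longrightarrow> rational_poly Q \<Longrightarrow> rational_poly (P * Q)"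
  by (auto simp: rational_poly_def coeff_mult intro!: range_to_ac_sum range_to_ac_mult)

lemma rational_poly_monom: "x \<in> range to_ac \<Longrightarrow> rational_poly (monom x n)"
  by (auto simp: rational_poly_def range_to_ac_0)

lemma rational_poly_0: "rational_poly 0"
  by (simp add: rational_poly_def range_to_ac_0)

section \<open>Elements of SL(2)\<close>

abbreviation entry :: "'a::comm_ring_1 sl2 \<Rightarrow> 2 \<Rightarrow> 2 \<Rightarrow> 'a" where
  "entry g i j \<equiv> Rep_sl2 g $ i $ j"

definition sl2_of :: "'a \<Rightarrow> 'a \<Rightarrow> 'a \<Rightarrow> 'a \<Rightarrow> 'a::comm_ring_1 sl2" where
  "sl2_of a b c d = Abs_sl2 (\<chi> i j. if i = 1 then (if j = 1 then a else b) else (if j = 1 then c else d))"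

lemma entry_sl2_of:
  assumes "a * d - b * c = 1"
  shows "entry (sl2_of a b c d) 1 1 = a" "entry (sl2_of a b c d) 1 2 = b"
    "entry (sl2_of a b c d) 2 1 = c" "entry (sl2_of a b c d) 2 2 = d"
proof -
  let ?M = "\<chi> i j. if i = (1::2) then (if j = (1::2) then a else b) else (if j = 1 then c else d)"
  have "det ?M = 1" using assms by (simp add: det_2)
  then have "Rep_sl2 (sl2_of a b c d) = ?M"
    unfolding sl2_of_def by (intro Abs_sl2_inverse) simp
  then show "entry (sl2_of a b c d) 1 1 = a" "entry (sl2_of a b c d) 1 2 = b"
    "entry (sl2_of a b c d) 2 1 = c" "entry (sl2_of a b c d) 2 2 = d"
    by simp_all
qed

lemma entry_times: "entry (g * h) i j = entry g i 1 * entry h 1 j + entry g i 2 * entry h 2 j"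
  by (simp add: times_sl2.rep_eq matrix_matrix_mult_def sum_2)

lemma entry_det: "entry g 1 1 * entry g 2 2 - entry g 1 2 * entry g 2 1 = 1"
  using Rep_sl2[of g] by (simp add: det_2)

lemma sl2_eqI:
  assumes "entry g 1 1 = entry h 1 1" "entry g 1 2 = entry h 1 2"
    "entry g 2 1 = entry h 2 1" "entry g 2 2 = entry h 2 2"
  shows "g = h"
proof -
  have "Rep_sl2 g = Rep_sl2 h" using assms by (simp add: vec_eq_iff forall_2)
  then show ?thesis by (simp add: Rep_sl2_inject)
qed

lemma sl2_mult_assoc: "(g * h) * l = g * (h * l)" for g :: "'a::comm_ring_1 sl2"
  by (rule sl2_eqI) (simp_all add: entry_times algebra_simps)

definition upper :: "'a::comm_ring_1 \<Rightarrow> 'a sl2" where "upper t = sl2_of 1 t 0 1"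
definition lower :: "'a::comm_ring_1 \<Rightarrow> 'a sl2" where "lower t = sl2_of 1 0 t 1"
definition torus :: "'a::field \<Rightarrow> 'a sl2" where "torus t = sl2_of t 0 0 (1 / t)"

text \<open>\<open>cell t\<close> represents the coset of the Borel subgroup at the point \<open>(t : 1)\<close> of the projective line.\<close>

definition cell :: "'a::comm_ring_1 \<Rightarrow> 'a sl2" where "cell t = sl2_of t 1 (-1) 0"

lemma entry_upper [simp]: "entry (upper t) 1 1 = 1" "entry (upper t) 1 2 = t"
    "entry (upper t) 2 1 = 0" "entry (upper t) 2 2 = 1"
  and entry_lower [simp]: "entry (lower t) 1 1 = 1" "entry (lower t) 1 2 = 0"
    "entry (lower t) 2 1 = t" "entry (lower t) 2 2 = 1"
  and entry_cell [simp]: "entry (cell t) 1 1 = t" "entry (cell t) 1 2 = 1"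
    "entry (cell t) 2 1 = - 1" "entry (cell t) 2 2 = 0"
  unfolding upper_def lower_def cell_def by (subst entry_sl2_of; simp)+

lemma entry_torus [simp]:
  assumes "t \<noteq> 0"
  shows "entry (torus t) 1 1 = t" "entry (torus t) 1 2 = 0"
    "entry (torus t) 2 1 = 0" "entry (torus t) 2 2 = 1 / t"
  unfolding torus_def using assms by (subst entry_sl2_of; simp)+

text \<open>Where the upper left entry is nonzero, g is a product of a lower unitriangular, a torus
  and an upper unitriangular element. Otherwise the lower left entry is nonzero, and left
  multiplication by \<open>upper 1\<close> leads to the first case.\<close>

lemma sl2_generated:
  fixes g :: "'a::field sl2"
  assumes "\<And>t. P (upper t)" "\<And>t. P (lower t)" "\<And>t. t \<noteq> 0 \<Longrightarrow> P (torus t)"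
    and mult: "\<And>g h. P g \<Longrightarrow> P h \<Longrightarrow> P (g * h)"
  shows "P g"
proof -
  have big: "P g" if "entry g 1 1 \<noteq> 0" for g :: "'a sl2"
  proof -
    let ?a = "entry g 1 1" and ?b = "entry g 1 2" and ?c = "entry g 2 1"
    have "entry g 2 2 = (1 + ?b * ?c) / ?a" using entry_det[of g] that by (simp add: field_simps)
    then have "g = lower (?c / ?a) * (torus ?a * upper (?b / ?a))"
      using that by (intro sl2_eqI) (simp_all add: entry_times field_simps)
    then show ?thesis using assms that by metis
  qed
  show ?thesis
  proof (cases "entry g 1 1 = 0")
    case True
    then have "entry g 2 1 \<noteq> 0" using entry_det[of g] by auto
    then have "P (upper 1 * g)" using True by (intro big) (simp add: entry_times)
    then have "P (upper (-1) * (upper 1 * g))" using assms by blast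
    moreover have "upper (-1) * (upper 1 * g) = g"
      by (rule sl2_eqI) (simp_all add: entry_times)
    ultimately show ?thesis by simp
  qed (rule big)
qed

section \<open>The coordinate ring\<close>

lemma coord_ring_0: "(\<lambda>_. 0) \<in> coord_ring" and coord_ring_1: "(\<lambda>_. 1) \<in> coord_ring"
  using coord_ring.const[of 0] coord_ring.const[of 1] by simp_all

lemma coord_ring_of_nat: "(\<lambda>_. of_nat n) \<in> coord_ring"
  using coord_ring.const[of "of_nat n"] by simp

lemma coord_ring_power: "f \<in> coord_ring \<Longrightarrow> (\<lambda>g. f g ^ n) \<in> coord_ring"
  by (induction n) (auto simp: coord_ring_1 intro: coord_ring.mult)

lemma coord_ring_sum:
  "(\<And>i. i \<in> A \<Longrightarrow> f i \<in> coord_ring) \<Longrightarrow> (\<lambda>g. \<Sum>i\<in>A. f i g) \<in> coord_ring"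
  by (induction A rule: infinite_finite_induct) (auto simp: coord_ring_0 intro: coord_ring.add)

lemma kscale_coord_ring: "f \<in> coord_ring \<Longrightarrow> kscale c f \<in> coord_ring"
  unfolding kscale_def by (intro coord_ring.mult coord_ring.const)

text \<open>
  With \<open>e = 0\<close> and \<open>S = UNIV\<close> the curve \<open>\<gamma>\<close> is polynomial; \<open>e = 1\<close> and \<open>S = - {0}\<close> also covers
  the torus.
\<close>

lemma coord_ring_curve:
  fixes \<gamma> :: "'k::field alg_closure \<Rightarrow> 'k alg_closure sl2"
  assumes "f \<in> coord_ring"
    and entries: "\<And>i j. \<exists>P. rational_poly P \<and> (\<forall>t\<in>S. t ^ e * entry (\<gamma> t) i j = poly P t)"
  shows "\<exists>n P. rational_poly P \<and> (\<forall>t\<in>S. t ^ (e * n) * f (\<gamma> t) = poly P t)"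
  using assms(1)
proof induction
  case (const c)
  show ?case
    by (intro exI[of _ 0] exI[of _ "monom (to_ac c) 0"]) (auto simp: rational_poly_monom poly_monom)
next
  case (entry i j)
  from entries[of i j] obtain P where "rational_poly P" "\<forall>t\<in>S. t ^ e * entry (\<gamma> t) i j = poly P t" by blast
  then show ?case by (intro exI[of _ 1] exI[of _ P]) auto
next
  case (add f f')
  then obtain n P n' P' where "rational_poly P" "rational_poly P'"
    "\<forall>t\<in>S. t ^ (e * n) * f (\<gamma> t) = poly P t" "\<forall>t\<in>S. t ^ (e * n') * f' (\<gamma> t) = poly P' t" by blast
  then show ?case
    by (intro exI[of _ "n + n'"] exI[of _ "monom 1 (e * n') * P + monom 1 (e * n) * P'"])
       (auto simp: poly_monom power_add algebra_simps range_to_ac_1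
          intro!: rational_poly_add rational_poly_mult rational_poly_monom)
next
  case (mult f f')
  then obtain n P n' P' where "rational_poly P" "rational_poly P'"
    "\<forall>t\<in>S. t ^ (e * n) * f (\<gamma> t) = poly P t" "\<forall>t\<in>S. t ^ (e * n') * f' (\<gamma> t) = poly P' t" by blast
  then show ?case
    by (intro exI[of _ "n + n'"] exI[of _ "P * P'"])
       (auto simp: power_add algebra_simps intro!: rational_poly_mult simp flip: poly_mult)
qed

lemma rational_linear: "x \<in> range to_ac \<Longrightarrow> y \<in> range to_ac \<Longrightarrow> rational_poly [:x, y:]"
  by (auto simp: rational_poly_def coeff_pCons range_to_ac_0 split: nat.split)

lemma all_entries:
  "Q (1::2) (1::2) \<Longrightarrow> Q 1 2 \<Longrightarrow> Q 2 1 \<Longrightarrow> Q 2 2 \<Longrightarrow> Q i j"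
  using exhaust_2[of i] exhaust_2[of j] by auto

lemma range_to_ac_m1: "- 1 \<in> range to_ac"
  by (metis rangeI to_ac_1 to_ac_minus)

lemma rational_const: "x \<in> range to_ac \<Longrightarrow> rational_poly [:x:]"
  using rational_linear[of x 0] range_to_ac_0 by simp

lemmas rational_intros = rational_linear rational_const rational_poly_0 range_to_ac_0 range_to_ac_1 range_to_ac_m1

lemma rational_curve_upper:
  "\<exists>P. rational_poly P \<and> (\<forall>t\<in>S. t ^ e * entry (upper t) i j = poly P t)"
  and rational_curve_lower:
  "\<exists>P. rational_poly P \<and> (\<forall>t\<in>S. t ^ e * entry (lower t) i j = poly P t)"
  and rational_curve_cell:
  "\<exists>P. rational_poly P \<and> (\<forall>t\<in>S. t ^ e * entry (cell t) i j = poly P t)"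
proof -
  have *: "\<exists>P. rational_poly P \<and> (\<forall>t\<in>S. t ^ e * x t = poly P t)"
    if "rational_poly Q" "\<And>t. x t = poly Q t" for x Q
    using that by (intro exI[of _ "monom 1 e * Q"])
      (auto simp: poly_monom intro!: rational_poly_mult rational_poly_monom range_to_ac_1)
  show "\<exists>P. rational_poly P \<and> (\<forall>t\<in>S. t ^ e * entry (upper t) i j = poly P t)"
    by (rule all_entries; rule *[of "[:0, 1:]"] *[of "[:1:]"] *[of 0]; simp add: rational_intros)
  show "\<exists>P. rational_poly P \<and> (\<forall>t\<in>S. t ^ e * entry (lower t) i j = poly P t)"
    by (rule all_entries; rule *[of "[:0, 1:]"] *[of "[:1:]"] *[of 0]; simp add: rational_intros)
  show "\<exists>P. rational_poly P \<and> (\<forall>t\<in>S. t ^ e * entry (cell t) i j = poly P t)"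
    by (rule all_entries; rule *[of "[:0, 1:]"] *[of "[:1:]"] *[of "[:-1:]"] *[of 0]; simp add: rational_intros)
qed

lemma rational_curve_torus:
  "\<exists>P. rational_poly P \<and> (\<forall>t\<in>-{0}. t ^ 1 * entry (torus t) i j = poly P t)"
proof (rule all_entries)
  show "\<exists>P. rational_poly P \<and> (\<forall>t\<in>-{0}. t ^ 1 * entry (torus t) 1 1 = poly P t)"
    by (intro exI[of _ "monom 1 2"])
       (auto simp: poly_monom power2_eq_square rational_poly_monom range_to_ac_1)
  show "\<exists>P. rational_poly P \<and> (\<forall>t\<in>-{0}. t ^ 1 * entry (torus t) 2 2 = poly P t)"
    by (intro exI[of _ "[:1:]"]) (auto intro: rational_intros)
qed (auto intro!: exI[of _ 0] rational_intros)

lemma coord_ring_cell: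
  assumes "f \<in> coord_ring"
  shows "\<exists>P. rational_poly P \<and> (\<forall>t. f (cell t) = poly P t)"
  using coord_ring_curve[OF assms rational_curve_cell[of UNIV 0]] by simp

lemma coord_ring_upper:
  assumes "f \<in> coord_ring"
  shows "\<exists>P. rational_poly P \<and> (\<forall>t. f (upper t) = poly P t)"
  using coord_ring_curve[OF assms rational_curve_upper[of UNIV 0]] by simp

section \<open>The induced modules\<close>

definition xy :: "nat \<Rightarrow> nat \<Rightarrow> ('k::field) regfun" where
  "xy k i g = entry g 1 1 ^ i * entry g 1 2 ^ (k - i)"

lemma xy_cell [simp]: "xy k i (cell t) = t ^ i"
  by (simp add: xy_def)

lemma xy_coord_ring: "xy k i \<in> coord_ring"
  unfolding xy_def by (intro coord_ring.mult coord_ring_power coord_ring.entry)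

text \<open>Restriction to the curve \<open>cell\<close> turns the monomials into distinct powers of
  t. The coefficients may lie in the closure, so that translates by arbitrary points are
  covered.\<close>

lemma xy_independent:
  assumes "finite I" "\<And>g. (\<Sum>i\<in>I. c i * xy k i g) = 0" "i \<in> I"
  shows "c i = (0 :: 'k::field alg_closure)"
proof -
  have "(\<Sum>i\<in>I. monom (c i) i) = 0"
    by (rule poly_eq_if_eq_off_0) (use assms(2)[of "cell _"] in \<open>simp add: poly_sum_monom\<close>)
  then show ?thesis using coeff_sum_monom[OF assms(1), of c i] assms(3) by simp
qed

lemma xy_inj: "i \<noteq> j \<Longrightarrow> xy k i \<noteq> (xy k j :: 'k::field regfun)"
proof
  assume "i \<noteq> j" and eq: "xy k i = (xy k j :: 'k regfun)"
  have "monom 1 i = (monom 1 j :: 'k alg_closure poly)"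
    by (rule poly_eq_if_eq_off_0) (metis eq poly_monom mult_1 xy_cell)
  then show False using \<open>i \<noteq> j\<close> by (simp add: monom_eq_iff')
qed

lemma sum_fun_apply: "(\<Sum>i\<in>A. f i) x = (\<Sum>i\<in>A. f i x :: 'a::comm_monoid_add)"
  by (induction A rule: infinite_finite_induct) auto

lemma span_xy:
  assumes "finite I"
  shows "f \<in> K.span (xy k ` I) \<longleftrightarrow> (\<exists>q. f = (\<lambda>g. \<Sum>i\<in>I. to_ac (q i :: 'k::field) * xy k i g))"
proof -
  have *: "(\<Sum>i\<in>I. kscale (q i) (xy k i)) = (\<lambda>g. \<Sum>i\<in>I. to_ac (q i :: 'k) * xy k i g)" for q
    by (auto simp: fun_eq_iff kscale_def sum_fun_apply)
  show ?thesis
  proof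
    assume "f \<in> K.span (xy k ` I)"
    then obtain u where "f = (\<Sum>v\<in>xy k ` I. kscale (u v) v)"
      using K.span_finite[of "xy k ` I"] assms by auto
    also have "\<dots> = (\<Sum>i\<in>I. kscale (u (xy k i)) (xy k i))"
      by (subst sum.reindex) (auto intro!: inj_onI simp: xy_inj dest: xy_inj)
    finally show "\<exists>q. f = (\<lambda>g. \<Sum>i\<in>I. to_ac (q i) * xy k i g)"
      unfolding * by (intro exI[of _ "\<lambda>i. u (xy k i)"])
  next
    assume "\<exists>q. f = (\<lambda>g. \<Sum>i\<in>I. to_ac (q i) * xy k i g)"
    then obtain q where "f = (\<Sum>i\<in>I. kscale (q i) (xy k i))" unfolding *[symmetric] by blast
    then show "f \<in> K.span (xy k ` I)"
      by (simp, intro K.span_sum K.span_scale K.span_base imageI)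
  qed
qed

text \<open>The cosets of the Borel subgroup form a projective line with the charts
  \<open>upper\<close> and \<open>cell\<close>. On these, f is given by polynomials P and Q with
  Q(t) = t^k P(1/t) on the overlap; so Q has degree at most k, and its coefficients are those of
  f.\<close>

lemma H0_eq_span: "(H0 k :: 'k::field regfun set) = K.span (xy k ` {..k})"
proof (intro equalityI subsetI)
  fix f :: "'k regfun" assume "f \<in> K.span (xy k ` {..k})"
  then obtain q where f: "f = (\<lambda>g. \<Sum>i\<le>k. to_ac (q i) * xy k i g)" by (auto simp: span_xy)
  have "f \<in> coord_ring" unfolding f
    by (intro coord_ring_sum coord_ring.mult coord_ring.const xy_coord_ring)
  moreover have "f (b * g) = entry b 1 1 ^ k * f g" if "entry b 1 2 = 0" for b g
  proof -
    have "xy k i (b * g) = entry b 1 1 ^ k * xy k i g" if "i \<le> k" for i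
    proof -
      have "entry b 1 1 ^ k = entry b 1 1 ^ i * entry b 1 1 ^ (k - i)"
        using that by (simp flip: power_add)
      then show ?thesis using \<open>entry b 1 2 = 0\<close>
        by (simp add: xy_def entry_times power_mult_distrib)
    qed
    then show ?thesis by (simp add: f sum_distrib_left mult.left_commute)
  qed
  ultimately show "f \<in> H0 k" by (simp add: H0_def)
next
  fix f :: "'k regfun" assume f: "f \<in> H0 k"
  then have borel: "f (b * g) = entry b 1 1 ^ k * f g" if "entry b 1 2 = 0" for b g
    using that by (simp add: H0_def)
  from f have cr: "f \<in> coord_ring" by (simp add: H0_def)
  obtain P where P: "\<And>t. f (upper t) = poly P t" using coord_ring_upper[OF cr] by blast
  obtain Q where Q: "rational_poly Q" "\<And>t. f (cell t) = poly Q t" using coord_ring_cell[OF cr] by blast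
  have x: "f g = entry g 1 1 ^ k * poly P (entry g 1 2 / entry g 1 1)" if "entry g 1 1 \<noteq> 0" for g
  proof -
    let ?b = "sl2_of (entry g 1 1) 0 (entry g 2 1) (1 / entry g 1 1)"
    have b: "entry ?b 1 1 = entry g 1 1" "entry ?b 1 2 = 0"
      "entry ?b 2 1 = entry g 2 1" "entry ?b 2 2 = 1 / entry g 1 1"
      using that by (subst entry_sl2_of; simp)+
    have "entry g 2 2 = (1 + entry g 1 2 * entry g 2 1) / entry g 1 1"
      using entry_det[of g] that by (simp add: field_simps)
    then have "g = ?b * upper (entry g 1 2 / entry g 1 1)"
      using that by (intro sl2_eqI) (simp_all add: entry_times b field_simps)
    then show ?thesis using borel[OF b(2)] P b(1) by metis
  qed
  have y: "f g = entry g 1 2 ^ k * poly Q (entry g 1 1 / entry g 1 2)" if "entry g 1 2 \<noteq> 0" for g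
  proof -
    let ?b = "sl2_of (entry g 1 2) 0 (entry g 2 2) (1 / entry g 1 2)"
    have b: "entry ?b 1 1 = entry g 1 2" "entry ?b 1 2 = 0"
      "entry ?b 2 1 = entry g 2 2" "entry ?b 2 2 = 1 / entry g 1 2"
      using that by (subst entry_sl2_of; simp)+
    have "entry g 2 1 = (entry g 1 1 * entry g 2 2 - 1) / entry g 1 2"
      using entry_det[of g] that by (simp add: field_simps)
    then have "g = ?b * cell (entry g 1 1 / entry g 1 2)"
      using that by (intro sl2_eqI) (simp_all add: entry_times b field_simps)
    then show ?thesis using borel[OF b(2)] Q b(1) by metis
  qed
  define n where "n = degree P"
  \<comment> \<open>The relation on the overlap, multiplied by t^n to make both sides
    polynomial.\<close>
  have PQ: "monom 1 n * Q = monom 1 k * reflect_poly P"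
  proof (rule poly_eq_if_eq_off_0)
    fix t :: "'k alg_closure" assume "t \<noteq> 0"
    then have "poly Q t = t ^ k * poly P (1 / t)" using x[of "cell t"] Q(2) by simp
    then show "poly (monom 1 n * Q) t = poly (monom 1 k * reflect_poly P) t"
      using \<open>t \<noteq> 0\<close> by (simp add: poly_monom poly_reflect_poly_nz n_def divide_inverse)
  qed
  have coeff_Q: "coeff Q m = (if k \<le> m + n then coeff (reflect_poly P) (m + n - k) else 0)" for m
    using arg_cong[OF PQ, of "\<lambda>R. coeff R (m + n)"] by (simp add: coeff_monom_mult)
  have degQ: "degree Q \<le> k"
  proof (rule degree_le, intro allI impI)
    fix m assume "k < m"
    then have "m + n - k > degree (reflect_poly P)"
      using degree_reflect_poly_le[of P] unfolding n_def by linarith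
    then show "coeff Q m = 0" by (simp add: coeff_Q coeff_eq_0)
  qed
  \<comment> \<open>Used at y = 0, the one point of the projective line outside the chart of
    Q.\<close>
  have Qk: "coeff Q k = poly P 0"
    by (simp add: coeff_Q n_def coeff_reflect_poly poly_0_coeff_0)
  \<comment> \<open>The coefficients of Q come from K because the curve \<open>cell\<close> is
    defined over K.\<close>
  define q where "q i = of_ac (coeff Q i)" for i
  have q: "to_ac (q i) = coeff Q i" for i
    using Q(1) by (simp add: q_def rational_poly_def to_ac_of_ac)
  have "f g = (\<Sum>i\<le>k. to_ac (q i) * xy k i g)" for g
  proof (cases "entry g 1 2 = 0")
    case False
    let ?x = "entry g 1 1" and ?y = "entry g 1 2"
    have "f g = ?y ^ k * (\<Sum>i\<le>k. coeff Q i * (?x / ?y) ^ i)"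
      unfolding y[OF False] poly_altdef using degQ
      by (intro arg_cong[of _ _ "\<lambda>s. ?y ^ k * s"] sum.mono_neutral_left) (auto simp: coeff_eq_0)
    also have "\<dots> = (\<Sum>i\<le>k. coeff Q i * (?x ^ i * ?y ^ (k - i)))"
      unfolding sum_distrib_left using False
      by (intro sum.cong) (auto simp: power_diff power_divide field_simps)
    finally show ?thesis by (simp add: q xy_def)
  next
    case True
    then have "entry g 1 1 \<noteq> 0" using entry_det[of g] by auto
    then have "f g = coeff Q k * entry g 1 1 ^ k" using x[of g] True Qk by simp
    also have "\<dots> = (\<Sum>i\<le>k. if i = k then coeff Q k * entry g 1 1 ^ k else 0)" by simp
    also have "\<dots> = (\<Sum>i\<le>k. coeff Q i * xy k i g)"
      using True by (intro sum.cong) (auto simp: xy_def)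
    finally show ?thesis by (simp add: q)
  qed
  then show "f \<in> K.span (xy k ` {..k})" by (auto simp: span_xy)
qed

section \<open>Submodules of the induced modules\<close>

lemma xy_upper:
  assumes "i \<le> k"
  shows "xy k i (g * upper t) =
    (\<Sum>j\<le>k. (if i \<le> j then of_nat ((k - i) choose (j - i)) * t ^ (j - i) else 0) * xy k j g)"
proof -
  let ?x = "entry g 1 1" and ?y = "entry g 1 2"
  have "xy k i (g * upper t) = ?x ^ i * (?x * t + ?y) ^ (k - i)"
    by (simp add: xy_def entry_times)
  also have "\<dots> = (\<Sum>j\<le>k-i. of_nat ((k - i) choose j) * t ^ j * (?x ^ (i + j) * ?y ^ (k - (i + j))))"
    unfolding binomial_ring sum_distrib_left
    by (intro sum.cong) (simp_all add: power_mult_distrib power_add mult_ac)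
  also have "\<dots> = (\<Sum>j=i..k. of_nat ((k - i) choose (j - i)) * t ^ (j - i) * xy k j g)"
    using assms by (intro sum.reindex_bij_witness[of _ "\<lambda>j. j - i" "\<lambda>j. i + j"]) (auto simp: xy_def)
  also have "\<dots> = (\<Sum>j\<le>k. (if i \<le> j then of_nat ((k - i) choose (j - i)) * t ^ (j - i) else 0) * xy k j g)"
    by (intro sum.mono_neutral_cong_left) auto
  finally show ?thesis .
qed

lemma xy_lower:
  assumes "i \<le> k"
  shows "xy k i (g * lower t) = (\<Sum>j\<le>k. of_nat (i choose j) * t ^ (i - j) * xy k j g)"
proof -
  let ?x = "entry g 1 1" and ?y = "entry g 1 2"
  have "xy k i (g * lower t) = (?x + ?y * t) ^ i * ?y ^ (k - i)"
    by (simp add: xy_def entry_times)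
  also have "\<dots> = (\<Sum>j\<le>i. of_nat (i choose j) * t ^ (i - j) * xy k j g)"
    unfolding binomial_ring sum_distrib_right
  proof (intro sum.cong refl)
    fix j assume "j \<in> {..i}"
    then have "?y ^ (k - j) = ?y ^ (i - j) * ?y ^ (k - i)" using assms by (simp flip: power_add)
    then show "of_nat (i choose j) * ?x ^ j * (?y * t) ^ (i - j) * ?y ^ (k - i)
        = of_nat (i choose j) * t ^ (i - j) * xy k j g"
      by (simp add: xy_def power_mult_distrib mult_ac)
  qed
  also have "\<dots> = (\<Sum>j\<le>k. of_nat (i choose j) * t ^ (i - j) * xy k j g)"
    using assms by (intro sum.mono_neutral_left) (auto simp: binomial_eq_0)
  finally show ?thesis .
qed

text \<open>The monomial has weight 2i - k; multiplication by t^k avoids negative exponents.\<close>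

lemma xy_torus:
  assumes "i \<le> k" "t \<noteq> 0"
  shows "t ^ k * xy k i (g * torus t) = t ^ (2 * i) * xy k i g"
proof -
  have "t ^ k = t ^ i * t ^ (k - i)" using assms(1) by (simp flip: power_add)
  then show ?thesis using assms(2)
    by (simp add: xy_def entry_times power_mult_distrib power_divide mult_2 power_add)
qed

text \<open>The coefficient of x^j y^(k-j) in the translate of x^i y^(k-i) by h. It is written out
  as a double binomial sum to make its membership in the coordinate ring over K evident.\<close>

definition matrix_coeff :: "nat \<Rightarrow> nat \<Rightarrow> nat \<Rightarrow> ('k::field) regfun" where
  "matrix_coeff k i j h = (\<Sum>r\<le>i. \<Sum>s\<le>k-i. if r + s = j then
     of_nat (i choose r) * of_nat ((k - i) choose s) * entry h 1 1 ^ r * entry h 2 1 ^ (i - r)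
       * entry h 1 2 ^ s * entry h 2 2 ^ (k - i - s) else 0)"

lemma matrix_coeff_coord_ring: "matrix_coeff k i j \<in> coord_ring"
proof -
  have *: "(\<lambda>h. if Q then f h else 0) \<in> coord_ring" if "f \<in> coord_ring" for Q f
    using that by (cases Q) (auto simp: coord_ring_0)
  show ?thesis unfolding matrix_coeff_def
    by (intro coord_ring_sum * coord_ring.mult coord_ring_power coord_ring.entry coord_ring_of_nat)
qed

lemma xy_mult:
  assumes "i \<le> k"
  shows "xy k i (g * h) = (\<Sum>j\<le>k. matrix_coeff k i j h * xy k j g)"
proof -
  let ?x = "entry g 1 1" and ?y = "entry g 1 2"
  let ?a = "entry h 1 1" and ?b = "entry h 1 2" and ?c = "entry h 2 1" and ?d = "entry h 2 2"
  define C where "C r s = of_nat (i choose r) * of_nat ((k - i) choose s) * ?a ^ r * ?c ^ (i - r)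
       * ?b ^ s * ?d ^ (k - i - s)" for r s
  have "xy k i (g * h) = (?x * ?a + ?y * ?c) ^ i * (?x * ?b + ?y * ?d) ^ (k - i)"
    by (simp add: xy_def entry_times)
  also have "\<dots> = (\<Sum>r\<le>i. \<Sum>s\<le>k-i. C r s * xy k (r + s) g)"
    unfolding binomial_ring sum_product
  proof (intro sum.cong refl)
    fix r s assume "r \<in> {..i}" "s \<in> {..k-i}"
    then have "?y ^ (k - (r + s)) = ?y ^ (i - r) * ?y ^ (k - i - s)"
      using assms by (simp flip: power_add)
    then show "of_nat (i choose r) * (?x * ?a) ^ r * (?y * ?c) ^ (i - r) *
        (of_nat ((k - i) choose s) * (?x * ?b) ^ s * (?y * ?d) ^ (k - i - s)) = C r s * xy k (r + s) g"
      by (simp add: C_def xy_def power_mult_distrib power_add mult_ac)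
  qed
  also have "\<dots> = (\<Sum>r\<le>i. \<Sum>s\<le>k-i. \<Sum>j\<le>k. if j = r + s then C r s * xy k j g else 0)"
    using assms by (intro sum.cong) auto
  also have "\<dots> = (\<Sum>r\<le>i. \<Sum>j\<le>k. \<Sum>s\<le>k-i. if j = r + s then C r s * xy k j g else 0)"
    by (intro sum.cong refl sum.swap)
  also have "\<dots> = (\<Sum>j\<le>k. \<Sum>r\<le>i. \<Sum>s\<le>k-i. if j = r + s then C r s * xy k j g else 0)"
    by (rule sum.swap)
  also have "\<dots> = (\<Sum>j\<le>k. matrix_coeff k i j h * xy k j g)"
    unfolding matrix_coeff_def sum_distrib_right by (intro sum.cong refl) (auto simp: C_def)
  finally show ?thesis .
qed

lemma matrix_coeff_unique:
  assumes "i \<le> k" "I \<subseteq> {..k}" "\<And>g. xy k i (g * h) = (\<Sum>j\<in>I. c j * xy k j g)" "j \<le> k"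
  shows "matrix_coeff k i j h = (if j \<in> I then c j else 0)"
proof -
  have "(\<Sum>j\<le>k. (matrix_coeff k i j h - (if j \<in> I then c j else 0)) * xy k j g) = 0" for g
  proof -
    have "(\<Sum>j\<in>I. c j * xy k j g) = (\<Sum>j\<le>k. (if j \<in> I then c j else 0) * xy k j g)"
      using assms(2) by (intro sum.mono_neutral_cong_left) auto
    then show ?thesis using assms(3)[of g] xy_mult[OF assms(1), of g h]
      by (simp add: left_diff_distrib sum_subtractf)
  qed
  from xy_independent[OF _ this, of j] assms(4) show ?thesis by simp
qed

section \<open>Closed sets of exponents span submodules\<close>

definition closed_weights :: "nat \<Rightarrow> nat \<Rightarrow> nat set \<Rightarrow> bool" where
  "closed_weights p k I \<longleftrightarrow> I \<subseteq> {..k} \<and> (\<forall>i\<in>I.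
     (\<forall>j. \<not> p dvd (i choose j) \<longrightarrow> j \<in> I) \<and>
     (\<forall>j\<ge>i. \<not> p dvd ((k - i) choose (j - i)) \<longrightarrow> j \<in> I))"

lemma closed_weights_subset: "closed_weights p k I \<Longrightarrow> I \<subseteq> {..k}"
  and closed_weights_lower: "closed_weights p k I \<Longrightarrow> i \<in> I \<Longrightarrow> \<not> p dvd (i choose j) \<Longrightarrow> j \<in> I"
  and closed_weights_upper: "closed_weights p k I \<Longrightarrow> i \<in> I \<Longrightarrow> i \<le> j \<Longrightarrow>
    \<not> p dvd ((k - i) choose (j - i)) \<Longrightarrow> j \<in> I"
  unfolding closed_weights_def by blast+

lemma closed_weights_le: "closed_weights p k I \<Longrightarrow> i \<in> I \<Longrightarrow> i \<le> k"
  using closed_weights_subset by blast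

lemma closed_weights_finite: "closed_weights p k I \<Longrightarrow> finite I"
  by (rule finite_subset[OF closed_weights_subset]) auto

lemma of_nat_alg_closure_eq_0_iff:
  "(of_nat n :: 'k::field alg_closure) = 0 \<longleftrightarrow> CHAR('k) dvd n"
  by (simp add: of_nat_eq_0_iff_char_dvd)

text \<open>Stability under translation is inherited by products, so \<open>sl2_generated\<close>
  serves as an induction rule. For the unipotent generators, the terms that lead out of I have
  coefficients divisible by the characteristic.\<close>

lemma closed_weights_stable:
  assumes "closed_weights CHAR('k::field) k I" "i \<in> I"
  shows "\<exists>c. \<forall>g. xy k i (g * h) = (\<Sum>j\<in>I. c j * xy k j (g :: 'k alg_closure sl2))"
  using assms(2)
proof (induction h arbitrary: i rule: sl2_generated)
  case (1 t)
  have "i \<le> k" using 1 assms(1) closed_weights_le by blast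
  have "\<forall>g. xy k i (g * upper t) =
     (\<Sum>j\<in>I. (if i \<le> j then of_nat ((k - i) choose (j - i)) * t ^ (j - i) else 0) * xy k j g)"
    unfolding xy_upper[OF \<open>i \<le> k\<close>]
    using closed_weights_subset[OF assms(1)] closed_weights_upper[OF assms(1) 1]
    by (intro allI sum.mono_neutral_right) (auto simp: of_nat_alg_closure_eq_0_iff)
  then show ?case by - (rule exI)
next
  case (2 t)
  have "i \<le> k" using 2 assms(1) closed_weights_le by blast
  have "\<forall>g. xy k i (g * lower t) = (\<Sum>j\<in>I. of_nat (i choose j) * t ^ (i - j) * xy k j g)"
    unfolding xy_lower[OF \<open>i \<le> k\<close>]
    using closed_weights_subset[OF assms(1)] closed_weights_lower[OF assms(1) 2]
    by (intro allI sum.mono_neutral_right) (auto simp: of_nat_alg_closure_eq_0_iff)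
  then show ?case by - (rule exI)
next
  case (3 t)
  have "i \<le> k" using 3 assms(1) closed_weights_le by blast
  have "\<forall>g. xy k i (g * torus t) = (\<Sum>j\<in>I. (if j = i then t ^ (2 * i) / t ^ k else 0) * xy k j g)"
  proof
    fix g
    have "xy k i (g * torus t) = t ^ (2 * i) / t ^ k * xy k i g"
      using xy_torus[OF \<open>i \<le> k\<close> \<open>t \<noteq> 0\<close>, of g] \<open>t \<noteq> 0\<close> by (simp add: field_simps)
    also have "\<dots> = (\<Sum>j\<in>I. if j = i then t ^ (2 * i) / t ^ k * xy k i g else 0)"
      using 3 closed_weights_finite[OF assms(1)] by simp
    also have "\<dots> = (\<Sum>j\<in>I. (if j = i then t ^ (2 * i) / t ^ k else 0) * xy k j g)"
      by (intro sum.cong) auto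
    finally show "xy k i (g * torus t) = (\<Sum>j\<in>I. (if j = i then t ^ (2 * i) / t ^ k else 0) * xy k j g)" .
  qed
  then show ?case by - (rule exI)
next
  case (4 h h')
  obtain c where c: "\<And>g. xy k i (g * h') = (\<Sum>j\<in>I. c j * xy k j (g :: 'k alg_closure sl2))"
    using 4 by blast
  have "\<forall>j\<in>I. \<exists>d. \<forall>g. xy k j (g * h) = (\<Sum>l\<in>I. d l * xy k l (g :: 'k alg_closure sl2))"
    using 4 by blast
  then obtain d where d: "\<And>j g. j \<in> I \<Longrightarrow> xy k j (g * h) = (\<Sum>l\<in>I. d j l * xy k l (g :: 'k alg_closure sl2))"
    by metis
  have "\<forall>g. xy k i (g * (h * h')) = (\<Sum>l\<in>I. (\<Sum>j\<in>I. c j * d j l) * xy k l g)"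
  proof
    fix g
    have "xy k i (g * (h * h')) = (\<Sum>j\<in>I. c j * xy k j (g * h))"
      unfolding sl2_mult_assoc[symmetric] c ..
    also have "\<dots> = (\<Sum>j\<in>I. \<Sum>l\<in>I. c j * d j l * xy k l g)"
      by (intro sum.cong refl) (simp add: d sum_distrib_left mult.assoc)
    also have "\<dots> = (\<Sum>l\<in>I. (\<Sum>j\<in>I. c j * d j l) * xy k l g)"
      unfolding sum_distrib_right by (rule sum.swap)
    finally show "xy k i (g * (h * h')) = (\<Sum>l\<in>I. (\<Sum>j\<in>I. c j * d j l) * xy k l g)" .
  qed
  then show ?case by - (rule exI)
qed

lemma matrix_coeff_closed:
  assumes "closed_weights CHAR('k::field) k I" "i \<in> I" "j \<le> k" "j \<notin> I"
  shows "matrix_coeff k i j (h :: 'k alg_closure sl2) = 0"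
proof -
  obtain c where "\<And>g. xy k i (g * h) = (\<Sum>j\<in>I. c j * xy k j g)"
    using closed_weights_stable[OF assms(1,2)] by blast
  then show ?thesis
    using matrix_coeff_unique[of i k I h c j] assms closed_weights_subset[OF assms(1)] by auto
qed

lemma comult_xy:
  assumes "closed_weights CHAR('k::field) k I" "i \<in> I"
  shows "comult (xy k i) = (\<Sum>j\<in>I. tens (xy k j) (matrix_coeff k i j :: 'k regfun))"
proof
  fix gh :: "'k alg_closure sl2 \<times> 'k alg_closure sl2"
  obtain g h where gh: "gh = (g, h)" by (cases gh)
  have I: "I \<subseteq> {..k}" using assms(1) by (rule closed_weights_subset)
  then have "xy k i (g * h) = (\<Sum>j\<le>k. matrix_coeff k i j h * xy k j g)"
    using assms by (intro xy_mult) auto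
  also have "\<dots> = (\<Sum>j\<in>I. matrix_coeff k i j h * xy k j g)"
    using I matrix_coeff_closed[OF assms] by (intro sum.mono_neutral_right) auto
  finally show "comult (xy k i) gh = (\<Sum>j\<in>I. tens (xy k j) (matrix_coeff k i j)) gh"
    by (simp add: gh comult_def tens_def sum_fun_apply mult.commute)
qed

lemma subspace_coord_ring: "K.subspace (coord_ring :: ('k::field) regfun set)"
proof (rule K.subspaceI)
  show "f + g \<in> coord_ring" if "f \<in> coord_ring" "g \<in> coord_ring" for f g :: "'k regfun"
    using coord_ring.add[OF that] by (simp add: plus_fun_def)
qed (simp_all add: zero_fun_def coord_ring_0 kscale_coord_ring)

lemma comult_add: "comult (f + g) = comult f + comult g"
  and comult_kscale: "comult (kscale c f) = kscale c (comult f)"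
  and comult_0: "comult 0 = 0"
  unfolding comult_def kscale_def by (rule ext; auto)+

lemma submodule_span_xy:
  assumes "closed_weights CHAR('k::field) k I"
  shows "sl2_submodule (K.span (xy k ` I) :: 'k regfun set)"
proof -
  let ?V = "K.span (xy k ` I) :: 'k regfun set"
  let ?T = "K.span {tens v c |v c. v \<in> ?V \<and> c \<in> coord_ring}"
  have "comult f \<in> ?T" if "f \<in> ?V" for f
    using that
  proof (induction rule: K.span_induct)
    case (step f)
    then obtain i where "i \<in> I" "f = xy k i" by auto
    then show ?case
      unfolding \<open>f = xy k i\<close> comult_xy[OF assms \<open>i \<in> I\<close>]
      by (intro K.span_sum K.span_base) (use K.span_base matrix_coeff_coord_ring in blast)
  next
    case base
    show ?case unfolding K.subspace_def
      by (auto simp: comult_add comult_kscale comult_0 K.span_zero intro: K.span_add K.span_scale)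
  qed
  moreover have "?V \<subseteq> coord_ring"
    by (rule K.span_minimal) (auto simp: subspace_coord_ring xy_coord_ring)
  ultimately show ?thesis by (simp add: sl2_submodule_def)
qed

text \<open>On a curve defined over K, an element of V \<otimes> K[SL(2)] becomes, up to a power of
  t, a polynomial in t with coefficients in V. Applied to \<open>comult f\<close>, this places the
  coefficients of any expansion of f(g \<gamma>(t)) in V, although single points over the closure
  need not preserve V.\<close>

lemma submodule_curve:
  fixes V :: "('k::field) regfun set"
  assumes V: "sl2_submodule V" and "f \<in> V"
    and curve: "\<And>i j. \<exists>P. rational_poly P \<and> (\<forall>t\<in>-{0}. t ^ e * entry (\<gamma> t) i j = poly P t)"
    and R: "\<And>g t. t \<noteq> 0 \<Longrightarrow> t ^ N * f (g * \<gamma> t) = poly (R g) t"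
  shows "(\<lambda>g. coeff (R g) m) \<in> V"
proof -
  have sub: "K.subspace V" using V by (simp add: sl2_submodule_def)
  have V0: "(\<lambda>g. 0) \<in> V" using K.subspace_0[OF sub] by (simp add: zero_fun_def)
  have shift: "(\<lambda>g. coeff (monom 1 n * Q g) m) \<in> V" if "\<And>m. (\<lambda>g. coeff (Q g) m) \<in> V" for n m Q
    using that V0 by (cases "m < n") (simp_all add: coeff_monom_mult)
  \<comment> \<open>The exponent n clears denominators. It depends on F, so the summands of a sum
    are brought to a common exponent by \<open>shift\<close>.\<close>
  define expands where "expands F n Q \<longleftrightarrow> (\<forall>m. (\<lambda>g. coeff (Q g) m) \<in> V) \<and>
    (\<forall>g t. t \<noteq> 0 \<longrightarrow> t ^ n * F (g, \<gamma> t) = poly (Q g) t)"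
    for F :: "'k regfun2" and n and Q :: "'k alg_closure sl2 \<Rightarrow> 'k alg_closure poly"
  define good where "good F \<longleftrightarrow> (\<exists>n Q. expands F n Q)" for F
  have goodI: "good F" if "\<And>m. (\<lambda>g. coeff (Q g) m) \<in> V"
    "\<And>g t. t \<noteq> 0 \<Longrightarrow> t ^ n * F (g, \<gamma> t) = poly (Q g) t" for F n Q
  proof -
    have "expands F n Q" using that by (simp add: expands_def)
    then show ?thesis unfolding good_def by blast
  qed
  have goodE: thesis if good: "good F" and rep: "\<And>n Q. (\<And>m. (\<lambda>g. coeff (Q g) m) \<in> V) \<Longrightarrow>
    (\<And>g t. t \<noteq> 0 \<Longrightarrow> t ^ n * F (g, \<gamma> t) = poly (Q g) t) \<Longrightarrow> thesis" for F thesis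
  proof -
    obtain n Q where "expands F n Q" using good unfolding good_def by blast
    then show thesis using rep[of Q n] by (simp add: expands_def)
  qed
  have "good F" if "F \<in> K.span {tens v c |v c. v \<in> V \<and> c \<in> coord_ring}" for F
    using that
  proof (induction rule: K.span_induct)
    case (step F)
    then obtain v c where F: "F = tens v c" "v \<in> V" "c \<in> coord_ring" by blast
    obtain n P where P: "rational_poly P" "\<forall>t\<in>-{0}. t ^ (e * n) * c (\<gamma> t) = poly P t"
      using coord_ring_curve[OF F(3) curve] by blast
    have "(\<lambda>g. coeff (smult (v g) P) m) \<in> V" for m
    proof -
      obtain x where "coeff P m = to_ac x" using P(1) by (auto simp: rational_poly_def)
      then have "(\<lambda>g. coeff (smult (v g) P) m) = kscale x v" by (simp add: kscale_def mult.commute)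
      then show ?thesis using K.subspace_scale[OF sub F(2)] by simp
    qed
    moreover have "t ^ (e * n) * F (g, \<gamma> t) = poly (smult (v g) P) t" if "t \<noteq> 0" for g t
      using P(2) that by (auto simp: F tens_def mult_ac)
    ultimately show ?case by (rule goodI)
  next
    case base
    have "good 0" by (rule goodI[of "\<lambda>_. 0"]) (simp_all add: V0)
    moreover have "good (F + F')" if "good F" "good F'" for F F'
    proof -
      from that obtain n Q n' Q' where
        Q: "\<And>m. (\<lambda>g. coeff (Q g) m) \<in> V" "\<And>g t. t \<noteq> 0 \<Longrightarrow> t ^ n * F (g, \<gamma> t) = poly (Q g) t" and
        Q': "\<And>m. (\<lambda>g. coeff (Q' g) m) \<in> V" "\<And>g t. t \<noteq> 0 \<Longrightarrow> t ^ n' * F' (g, \<gamma> t) = poly (Q' g) t"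
        by (elim goodE) blast
      have "(\<lambda>g. coeff (monom 1 n' * Q g + monom 1 n * Q' g) m) \<in> V" for m
        using K.subspace_add[OF sub shift[of Q, OF Q(1)] shift[of Q', OF Q'(1)], of n' m n m]
        by (simp add: plus_fun_def)
      moreover have "t ^ (n + n') * (F + F') (g, \<gamma> t) = poly (monom 1 n' * Q g + monom 1 n * Q' g) t"
        if "t \<noteq> 0" for g t
      proof -
        have "t ^ (n + n') * (F + F') (g, \<gamma> t) =
            t ^ n' * (t ^ n * F (g, \<gamma> t)) + t ^ n * (t ^ n' * F' (g, \<gamma> t))"
          by (simp add: power_add algebra_simps)
        then show ?thesis unfolding Q(2)[OF that] Q'(2)[OF that] by (simp add: poly_monom)
      qed
      ultimately show ?thesis by (rule goodI)
    qed
    moreover have "good (kscale x F)" if "good F" for x F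
    proof -
      from that obtain n Q where
        Q: "\<And>m. (\<lambda>g. coeff (Q g) m) \<in> V" "\<And>g t. t \<noteq> 0 \<Longrightarrow> t ^ n * F (g, \<gamma> t) = poly (Q g) t"
        by (elim goodE) blast
      have "(\<lambda>g. coeff (smult (to_ac x) (Q g)) m) \<in> V" for m
        using K.subspace_scale[OF sub Q(1), of x m] by (simp add: kscale_def)
      moreover have "t ^ n * kscale x F (g, \<gamma> t) = poly (smult (to_ac x) (Q g)) t" if "t \<noteq> 0" for g t
        using Q(2)[OF that, of g, symmetric] by (simp add: kscale_def)
      ultimately show ?thesis by (rule goodI)
    qed
    ultimately show ?case unfolding K.subspace_def by auto
  qed
  moreover have "comult f \<in> K.span {tens v c |v c. v \<in> V \<and> c \<in> coord_ring}"
    using V \<open>f \<in> V\<close> by (simp add: sl2_submodule_def)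
  ultimately have "good (comult f)" by blast
  then obtain n Q where
    Q: "\<And>m. (\<lambda>g. coeff (Q g) m) \<in> V" "\<And>g t. t \<noteq> 0 \<Longrightarrow> t ^ n * f (g * \<gamma> t) = poly (Q g) t"
    by (rule goodE) (rule that, assumption, simp add: comult_def)
  \<comment> \<open>The given expansion R and the expansion Q from the comodule condition clear
    different powers of t; after cross multiplication they agree.\<close>
  have "monom 1 n * R g = monom 1 N * Q g" for g
  proof (rule poly_eq_if_eq_off_0)
    fix t :: "'k alg_closure" assume t: "t \<noteq> 0"
    have "t ^ n * (t ^ N * f (g * \<gamma> t)) = t ^ N * (t ^ n * f (g * \<gamma> t))" by simp
    then show "poly (monom 1 n * R g) t = poly (monom 1 N * Q g) t"
      unfolding R[OF t] Q(2)[OF t] by (simp add: poly_monom)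
  qed
  then have "coeff (R g) m = coeff (monom 1 N * Q g) (m + n)" for g
  proof -
    have "coeff (R g) m = coeff (monom 1 n * R g) (m + n)" by (simp add: coeff_monom_mult)
    then show ?thesis by (simp only: \<open>monom 1 n * R g = monom 1 N * Q g\<close>)
  qed
  then show ?thesis using shift[of Q, OF Q(1), of N "m + n"] by simp
qed

section \<open>Every submodule is spanned by a closed set of monomials\<close>

definition weights :: "nat \<Rightarrow> ('k::field) regfun set \<Rightarrow> nat set" where
  "weights k V = {i. i \<le> k \<and> xy k i \<in> V}"

lemma kscale_mem_iff:
  assumes "K.subspace V" "c \<noteq> 0"
  shows "kscale c f \<in> V \<longleftrightarrow> f \<in> V"
proof
  assume "kscale c f \<in> V"
  then have "kscale (inverse c) (kscale c f) \<in> V" using K.subspace_scale[OF assms(1)] by blast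
  then show "f \<in> V" using assms(2) by (simp add: K.scale_scale)
qed (rule K.subspace_scale[OF assms(1)])

text \<open>Under the torus the monomials acquire the distinct powers t^(2i), so the coefficient of
  one power isolates one term of f.\<close>

lemma submodule_weight_component:
  fixes V :: "('k::field) regfun set"
  assumes V: "sl2_submodule V" and f: "(\<lambda>g. \<Sum>i\<le>k. to_ac (q i) * xy k i g) \<in> V"
    and "i \<le> k" "q i \<noteq> 0"
  shows "xy k i \<in> V"
proof -
  let ?f = "\<lambda>g. \<Sum>i\<le>k. to_ac (q i) * xy k i g"
  have "t ^ k * ?f (g * torus t) = poly (\<Sum>i\<le>k. monom (to_ac (q i) * xy k i g) (2 * i)) t"
    if "t \<noteq> 0" for g t
    using xy_torus[of _ k t g, OF _ that]
    by (auto simp: poly_sum poly_monom sum_distrib_left mult.left_commute intro!: sum.cong)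
  from submodule_curve[OF V f rational_curve_torus this, of "2 * i"]
  have "kscale (q i) (xy k i) \<in> V"
    using \<open>i \<le> k\<close> by (simp add: coeff_sum kscale_def)
  then show ?thesis using kscale_mem_iff[of V "q i"] V \<open>q i \<noteq> 0\<close> by (simp add: sl2_submodule_def)
qed

lemma submodule_eq_span_weights:
  fixes V :: "('k::field) regfun set"
  assumes "sl2_submodule V" "V \<subseteq> H0 k"
  shows "V = K.span (xy k ` weights k V)"
proof (intro equalityI subsetI)
  have sub: "K.subspace V" using assms by (simp add: sl2_submodule_def)
  show "f \<in> V" if "f \<in> K.span (xy k ` weights k V)" for f
    using that K.span_minimal[of "xy k ` weights k V" V] sub by (auto simp: weights_def)
  fix f assume "f \<in> V"
  then have "f \<in> K.span (xy k ` {..k})" using assms H0_eq_span by blast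
  then obtain q where f: "f = (\<lambda>g. \<Sum>i\<le>k. to_ac (q i) * xy k i g)" by (auto simp: span_xy)
  have "q i = 0" if "i \<le> k" "i \<notin> weights k V" for i
    using submodule_weight_component[OF assms(1), of q k i] that \<open>f \<in> V\<close> f by (auto simp: weights_def)
  then have "f = (\<lambda>g. \<Sum>i\<in>weights k V. to_ac (q i) * xy k i g)"
    unfolding f by (intro ext sum.mono_neutral_right) (auto simp: weights_def)
  moreover have "finite (weights k V)" by (simp add: weights_def)
  ultimately show "f \<in> K.span (xy k ` weights k V)" using span_xy by blast
qed

text \<open>Along \<open>lower\<close> the coefficient of t^(i-j), and along \<open>upper\<close>
  that of t^(j-i), is a binomial coefficient times x^j y^(k-j). If the number is invertible in K,
  the monomial itself lies in V.\<close>

lemma weights_closed: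
  fixes V :: "('k::field) regfun set"
  assumes V: "sl2_submodule V"
  shows "closed_weights CHAR('k) k (weights k V)"
  unfolding closed_weights_def
proof (intro conjI ballI allI impI)
  show "weights k V \<subseteq> {..k}" by (auto simp: weights_def)
  have sub: "K.subspace V" using assms by (simp add: sl2_submodule_def)
  fix i assume "i \<in> weights k V"
  then have i: "i \<le> k" "xy k i \<in> V" by (auto simp: weights_def)
  have nz: "xy k j \<in> V" if "kscale (of_nat n) (xy k j) \<in> V" "\<not> CHAR('k) dvd n" for j n
    using that kscale_mem_iff[OF sub, of "of_nat n"] by (simp add: of_nat_eq_0_iff_char_dvd)
  show "j \<in> weights k V" if "\<not> CHAR('k) dvd (i choose j)" for j
  proof -
    have "j \<le> i" using that by (rule contrapos_np) (simp add: binomial_eq_0)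
    \<comment> \<open>The factor \<open>t ^ 0\<close> matches the form of
      \<open>submodule_curve\<close>, as there is no denominator to clear. The test
      \<open>l \<le> i\<close> guards against the truncated difference i - l.\<close>
    have "t ^ 0 * xy k i (g * lower t) =
      poly (\<Sum>l\<le>k. if l \<le> i then monom (of_nat (i choose l) * xy k l g) (i - l) else 0) t" for g t
      unfolding xy_lower[OF i(1)]
      by (auto simp: poly_sum poly_monom binomial_eq_0 intro!: sum.cong)
    from submodule_curve[OF V i(2) rational_curve_lower[of _ 0] this, of "i - j"]
    have "(\<lambda>g. \<Sum>l\<le>k. coeff (if l \<le> i then monom (of_nat (i choose l) * xy k l g) (i - l) else 0) (i - j)) \<in> V"
      by (simp add: coeff_sum)
    also have "(\<lambda>g. \<Sum>l\<le>k. coeff (if l \<le> i then monom (of_nat (i choose l) * xy k l g) (i - l) else 0) (i - j))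
       = (\<lambda>g. \<Sum>l\<le>k. if l = j then of_nat (i choose j) * xy k j g else 0)"
      using \<open>j \<le> i\<close> by (intro ext sum.cong) auto
    also have "\<dots> = kscale (of_nat (i choose j)) (xy k j)"
      using \<open>j \<le> i\<close> i(1) by (simp add: kscale_def)
    finally have "xy k j \<in> V" using that nz by blast
    then show ?thesis using \<open>j \<le> i\<close> i(1) by (simp add: weights_def)
  qed
  show "j \<in> weights k V" if "i \<le> j" "\<not> CHAR('k) dvd ((k - i) choose (j - i))" for j
  proof -
    have "j - i \<le> k - i" using that(2) by (rule contrapos_np) (simp add: binomial_eq_0)
    then have "j \<le> k" using i by simp
    have "t ^ 0 * xy k i (g * upper t) =
      poly (\<Sum>l\<le>k. if i \<le> l then monom (of_nat ((k - i) choose (l - i)) * xy k l g) (l - i) else 0) t" for g t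
      unfolding xy_upper[OF i(1)]
      by (auto simp: poly_sum poly_monom intro!: sum.cong)
    from submodule_curve[OF V i(2) rational_curve_upper[of _ 0] this, of "j - i"]
    have "(\<lambda>g. \<Sum>l\<le>k. coeff (if i \<le> l then monom (of_nat ((k - i) choose (l - i)) * xy k l g) (l - i) else 0) (j - i)) \<in> V"
      by (simp add: coeff_sum)
    also have "(\<lambda>g. \<Sum>l\<le>k. coeff (if i \<le> l then monom (of_nat ((k - i) choose (l - i)) * xy k l g) (l - i) else 0) (j - i))
       = (\<lambda>g. \<Sum>l\<le>k. if l = j then of_nat ((k - i) choose (j - i)) * xy k j g else 0)"
      using \<open>i \<le> j\<close> by (intro ext sum.cong) auto
    also have "\<dots> = kscale (of_nat ((k - i) choose (j - i))) (xy k j)"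
      using \<open>j \<le> k\<close> by (simp add: kscale_def)
    finally have "xy k j \<in> V" using that nz by blast
    then show ?thesis using \<open>j \<le> k\<close> by (simp add: weights_def)
  qed
qed

lemma xy_mem_span_iff:
  assumes "I \<subseteq> {..k}" "i \<le> k"
  shows "xy k i \<in> K.span (xy k ` I :: 'k::field regfun set) \<longleftrightarrow> i \<in> I"
proof
  assume "xy k i \<in> K.span (xy k ` I :: 'k regfun set)"
  moreover have fin: "finite I" using assms finite_subset by blast
  ultimately obtain q where q: "xy k i = (\<lambda>g. \<Sum>i\<in>I. to_ac (q i :: 'k) * xy k i g)"
    using span_xy by blast
  show "i \<in> I"
  proof (rule ccontr)
    assume "i \<notin> I"
    have "(\<Sum>j\<in>insert i I. (if j = i then - 1 else to_ac (q j)) * xy k j g) = 0" for g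
    proof -
      have "(\<Sum>j\<in>I. (if j = i then - 1 else to_ac (q j)) * xy k j g) = (\<Sum>j\<in>I. to_ac (q j) * xy k j g)"
        using \<open>i \<notin> I\<close> by (intro sum.cong) auto
      then show ?thesis using fin \<open>i \<notin> I\<close> fun_cong[OF q, of g] by simp
    qed
    from xy_independent[OF _ this, of i] fin show False by simp
  qed
qed (simp add: K.span_base)

lemma weights_span:
  assumes "I \<subseteq> {..k}"
  shows "weights k (K.span (xy k ` I) :: 'k::field regfun set) = I"
  using assms xy_mem_span_iff[OF assms, where ?'k = 'k] by (auto simp: weights_def)

lemma span_xy_subset_H0:
  assumes "I \<subseteq> {..k}"
  shows "K.span (xy k ` I) \<subseteq> H0 k"
  unfolding H0_eq_span using assms by (intro K.span_mono) auto

section \<open>Simple modules\<close>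

lemma prime_not_dvd_mult: "prime p \<Longrightarrow> \<not> p dvd a * b \<longleftrightarrow> \<not> p dvd a \<and> \<not> p dvd b" for p :: nat
  by (simp add: prime_dvd_mult_iff)

text \<open>For prime p these are, by Lucas' theorem, the numbers whose base p digits do not exceed
  those of r. With i standing for the weight 2i - r, they are the weights of L(r) known from
  Steinberg's tensor product theorem.\<close>

definition simple_weights :: "nat \<Rightarrow> nat \<Rightarrow> nat set" where
  "simple_weights p r = {i. \<not> p dvd (r choose i)}"

lemma simple_weights_le: "i \<in> simple_weights p r \<Longrightarrow> i \<le> r"
  unfolding simple_weights_def by (rule ccontr) (simp add: binomial_eq_0)

text \<open>Both kinds of step rest on the identity (r choose i)(i choose j) = (r choose j)(r-j
  choose i-j), read once in each direction: if one side is prime to p, so is every factor of the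
  other.\<close>

lemma closed_simple_weights:
  assumes "prime p"
  shows "closed_weights p r (simple_weights p r)"
  unfolding closed_weights_def
proof (intro conjI ballI allI impI subsetI)
  fix i j assume i: "i \<in> simple_weights p r"
  have "i \<le> r" using simple_weights_le[OF i] .
  show "i \<in> {..r}" using \<open>i \<le> r\<close> by simp
  show "j \<in> simple_weights p r" if j: "\<not> p dvd (i choose j)"
  proof -
    have "j \<le> i" using j by (rule contrapos_np) (simp add: binomial_eq_0)
    have "\<not> p dvd (r choose i) * (i choose j)"
      using i j assms by (simp add: simple_weights_def prime_not_dvd_mult)
    then show ?thesis unfolding choose_mult[OF \<open>j \<le> i\<close> \<open>i \<le> r\<close>]
      using assms by (simp add: simple_weights_def prime_not_dvd_mult)
  qed
  show "j \<in> simple_weights p r" if j: "i \<le> j" "\<not> p dvd ((r - i) choose (j - i))"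
  proof -
    have "j - i \<le> r - i" using j(2) by (rule contrapos_np) (simp add: binomial_eq_0)
    then have "j \<le> r" using \<open>i \<le> r\<close> j by simp
    have "\<not> p dvd (r choose i) * ((r - i) choose (j - i))"
      using i j assms by (simp add: simple_weights_def prime_not_dvd_mult)
    then show ?thesis unfolding choose_mult[OF \<open>i \<le> j\<close> \<open>j \<le> r\<close>, symmetric]
      using assms by (simp add: simple_weights_def prime_not_dvd_mult)
  qed
qed

text \<open>The upper step from i to r has the coefficient (r-i choose r-i) = 1. With the lower
  steps from r, this makes \<open>simple_weights p r\<close> the least nonempty closed set.\<close>

lemma top_in_closed:
  assumes "prime p" "closed_weights p r I" "I \<noteq> {}"
  shows "r \<in> I"
proof -
  obtain i where i: "i \<in> I" using assms by blast
  show ?thesis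
    by (rule closed_weights_upper[OF assms(2) i closed_weights_le[OF assms(2) i]])
       (use assms(1) not_prime_unit in auto)
qed

lemma simple_weights_subset_closed:
  assumes "prime p" "closed_weights p r I" "I \<noteq> {}"
  shows "simple_weights p r \<subseteq> I"
  unfolding simple_weights_def using closed_weights_lower[OF assms(2) top_in_closed[OF assms]] by blast

lemma xy_neq_0: "xy k i \<noteq> (0 :: 'k::field regfun)"
proof
  assume "xy k i = (0 :: 'k regfun)"
  then have "xy k i (cell 1 :: 'k alg_closure sl2) = 0" by simp
  then show False by simp
qed

text \<open>This span lies in every nonzero submodule of \<open>H0 r\<close>, so it is the only
  simple submodule and equals the socle.\<close>

lemma Lsimple_eq_span:
  assumes p: "prime (CHAR('k::field))"
  shows "(Lsimple r :: 'k regfun set) = K.span (xy r ` simple_weights CHAR('k) r)"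
proof -
  let ?B = "simple_weights CHAR('k) r"
  let ?L = "K.span (xy r ` ?B) :: 'k regfun set"
  have B: "closed_weights CHAR('k) r ?B" using closed_simple_weights[OF p] .
  have sub: "sl2_submodule ?L" using submodule_span_xy[OF B] .
  have LH: "?L \<subseteq> H0 r" using span_xy_subset_H0[OF closed_weights_subset[OF B]] .
  have "r \<in> ?B" using p not_prime_unit by (auto simp: simple_weights_def)
  then have "xy r r \<in> ?L" by (intro K.span_base) simp
  then have nz: "?L \<noteq> {0}" using xy_neq_0 by blast
  have contains: "?L \<subseteq> U" if "sl2_submodule U" "U \<subseteq> H0 r" "U \<noteq> {0}" for U :: "'k regfun set"
  proof -
    have U: "U = K.span (xy r ` weights r U)" using submodule_eq_span_weights[OF that(1,2)] .
    have "weights r U \<noteq> {}"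
    proof
      assume "weights r U = {}"
      then show False using U that(3) by simp
    qed
    then have "?B \<subseteq> weights r U"
      using simple_weights_subset_closed[OF p weights_closed[OF that(1)]] by blast
    then have "?L \<subseteq> K.span (xy r ` weights r U)" by (intro K.span_mono image_mono)
    then show ?thesis using U by simp
  qed
  have "sl2_simple ?L" unfolding sl2_simple_def
    using sub nz contains LH by (metis order_trans subset_antisym)
  moreover have "S = ?L" if "sl2_simple S" "S \<subseteq> H0 r" for S
    using contains[of S] sub nz that unfolding sl2_simple_def by blast
  ultimately have "{S. sl2_simple S \<and> S \<subseteq> H0 r} = {?L}" using LH by blast
  then show ?thesis by (simp add: Lsimple_def socle_def K.span_span)
qed

lemma Lsimple_subset_H0: "prime CHAR('k::field) \<Longrightarrow> (Lsimple r :: 'k regfun set) \<subseteq> H0 r"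
  by (simp add: Lsimple_eq_span span_xy_subset_H0 closed_weights_subset[OF closed_simple_weights])

section \<open>Closed sets of weights and carries\<close>

lemma carry_le_lower:
  assumes "prime CHAR('k::field)" "\<not> CHAR('k) dvd (i choose j)" "carry CHAR('k) k j n"
  shows "carry CHAR('k) k i n"
  using assms(2) unfolding not_dvd_choose_iff_digits[OF assms(1)]
  by (intro carry_mono[OF _ assms(3)]) simp

text \<open>Exchanging x and y, that is, i and k - i, turns upper steps into lower ones and
  preserves the carries.\<close>

lemma carry_le_upper:
  assumes p: "prime CHAR('k::field)" and "i \<le> j" "i \<le> k" "\<not> CHAR('k) dvd ((k - i) choose (j - i))"
    and "carry CHAR('k) k j n"
  shows "carry CHAR('k) k i n"
proof -
  have "j - i \<le> k - i" using assms(4) by (rule contrapos_np) (simp add: binomial_eq_0)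
  then have "j \<le> k" using \<open>i \<le> k\<close> \<open>i \<le> j\<close> by simp
  have "(k - i) choose (j - i) = (k - i) choose (k - j)"
    using binomial_symmetric[of "j - i" "k - i"] \<open>j \<le> k\<close> \<open>i \<le> j\<close> by simp
  then have "carry CHAR('k) k (k - j) n \<Longrightarrow> carry CHAR('k) k (k - i) n"
    using carry_le_lower[OF p, of "k - i" "k - j"] assms(4) by simp
  moreover have "CHAR('k) > 0" using p prime_gt_0_nat by blast
  ultimately show ?thesis using assms(5) \<open>j \<le> k\<close> \<open>i \<le> k\<close> by (simp add: carry_sym)
qed

lemma carry_connected:
  assumes p: "prime CHAR('k::field)" and "i \<le> k" and j: "j \<in> carry_class CHAR('k) k i"
  obtains m where "m \<le> i" "m \<le> j" "\<not> CHAR('k) dvd (i choose m)" "\<not> CHAR('k) dvd ((k - m) choose (j - m))"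
proof -
  have "j \<le> k" and same: "carry CHAR('k) k i n = carry CHAR('k) k j n" for n
    using j by (auto simp: carry_class_def)
  obtain m where m: "m \<le> i" "m \<le> j" "\<And>l. digit CHAR('k) m l = min (digit CHAR('k) i l) (digit CHAR('k) j l)"
    "\<And>l. digit CHAR('k) (k - j) l \<le> digit CHAR('k) (k - m) l"
    using same_carry_connected[OF prime_gt_1_nat[OF p] \<open>i \<le> k\<close> \<open>j \<le> k\<close> same] by blast
  have "\<not> CHAR('k) dvd (i choose m)" "\<not> CHAR('k) dvd ((k - m) choose (k - j))"
    using m(3,4) p by (simp_all add: not_dvd_choose_iff_digits)
  moreover have "(k - m) choose (k - j) = (k - m) choose (j - m)"
    using binomial_symmetric[of "j - m" "k - m"] \<open>j \<le> k\<close> m by simp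
  ultimately show thesis using that[of m] m(1,2) by simp
qed

lemma closed_weights_saturated:
  assumes p: "prime CHAR('k::field)" and I: "closed_weights CHAR('k) k I" and "i \<in> I"
  shows "carry_class CHAR('k) k i \<subseteq> I"
proof
  fix j assume j: "j \<in> carry_class CHAR('k) k i"
  obtain m where m: "m \<le> j" "\<not> CHAR('k) dvd (i choose m)" "\<not> CHAR('k) dvd ((k - m) choose (j - m))"
    using carry_connected[OF p closed_weights_le[OF I \<open>i \<in> I\<close>] j] by metis
  then show "j \<in> I"
    using closed_weights_lower[OF I \<open>i \<in> I\<close>] closed_weights_upper[OF I] by blast
qed

lemma closed_weights_empty: "closed_weights p k {}"
  by (simp add: closed_weights_def)

lemma closed_weights_Un:
  assumes "closed_weights p k I" "closed_weights p k J"
  shows "closed_weights p k (I \<union> J)"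
  unfolding closed_weights_def
proof (intro conjI ballI allI impI)
  show "I \<union> J \<subseteq> {..k}" using assms[THEN closed_weights_subset] by blast
  fix i j assume i: "i \<in> I \<union> J"
  show "j \<in> I \<union> J" if "\<not> p dvd (i choose j)"
    using i assms[THEN closed_weights_lower, OF _ that] by blast
  show "j \<in> I \<union> J" if "i \<le> j" "\<not> p dvd ((k - i) choose (j - i))"
    using i assms[THEN closed_weights_upper, OF _ that] by blast
qed

text \<open>Steps can only lose carries, so bounding the carries from above by those of i preserves
  closedness.\<close>

lemma closed_weights_carry_le:
  assumes p: "prime CHAR('k::field)" and I: "closed_weights CHAR('k) k I"
  shows "closed_weights CHAR('k) k {j \<in> I. \<forall>n. carry CHAR('k) k j n \<longrightarrow> carry CHAR('k) k i n}"
  unfolding closed_weights_def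
proof (intro conjI ballI allI impI)
  show "{j \<in> I. \<forall>n. carry CHAR('k) k j n \<longrightarrow> carry CHAR('k) k i n} \<subseteq> {..k}"
    using closed_weights_subset[OF I] by blast
  fix j l assume "j \<in> {j \<in> I. \<forall>n. carry CHAR('k) k j n \<longrightarrow> carry CHAR('k) k i n}"
  then have j: "j \<in> I" "\<And>n. carry CHAR('k) k j n \<Longrightarrow> carry CHAR('k) k i n" by auto
  show "l \<in> {j \<in> I. \<forall>n. carry CHAR('k) k j n \<longrightarrow> carry CHAR('k) k i n}"
    if "\<not> CHAR('k) dvd (j choose l)"
    using closed_weights_lower[OF I j(1) that] carry_le_lower[OF p that] j(2) by blast
  show "l \<in> {j \<in> I. \<forall>n. carry CHAR('k) k j n \<longrightarrow> carry CHAR('k) k i n}"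
    if "j \<le> l" "\<not> CHAR('k) dvd ((k - j) choose (l - j))"
    using closed_weights_upper[OF I j(1) that] carry_le_upper[OF p that(1) closed_weights_le[OF I j(1)] that(2)]
      j(2) by blast
qed

text \<open>Let i in the layer have the fewest carries. Adding to I the elements of I' whose carries
  are among those of i gives a closed set strictly larger than I, hence all of I'; by the choice of
  i, all carries in the layer then coincide. The other inclusion holds because closed sets are
  unions of classes.\<close>

lemma closed_weights_step:
  assumes p: "prime CHAR('k::field)"
    and I: "closed_weights CHAR('k) k I" and I': "closed_weights CHAR('k) k I'" and "I \<subset> I'"
    and step: "\<And>J. closed_weights CHAR('k) k J \<Longrightarrow> I \<subseteq> J \<Longrightarrow> J \<subseteq> I' \<Longrightarrow> J = I \<or> J = I'"
  obtains i where "i \<le> k" "I' - I = carry_class CHAR('k) k i"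
proof -
  let ?p = "CHAR('k)"
  define C where "C i = {n. carry ?p k i n}" for i
  have p1: "?p > 1" using p prime_gt_1_nat by blast
  have fin: "finite (C i)" if "i \<le> k" for i
  proof (rule finite_subset)
    show "C i \<subseteq> {..<k + 1}"
      using not_carry[OF power_gt_expt[of ?p "k + 1"] that] p1 unfolding C_def by (auto simp: not_less[symmetric])
  qed simp
  obtain i where i: "i \<in> I' - I" and min: "\<And>j. j \<in> I' - I \<Longrightarrow> card (C i) \<le> card (C j)"
    using \<open>I \<subset> I'\<close> ex_has_least_nat[of "\<lambda>i. i \<in> I' - I" _ "\<lambda>i. card (C i)"] by blast
  have le: "j \<le> k" if "j \<in> I'" for j using closed_weights_le[OF I' that] .
  let ?J = "I \<union> {j \<in> I'. \<forall>n. carry ?p k j n \<longrightarrow> carry ?p k i n}"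
  have "closed_weights ?p k ?J" using closed_weights_Un[OF I closed_weights_carry_le[OF p I']] .
  then have "?J = I'" using step[of ?J] i \<open>I \<subset> I'\<close> by blast
  have "I' - I = carry_class ?p k i"
  proof (intro equalityI subsetI)
    fix j assume j: "j \<in> I' - I"
    then have "C j \<subseteq> C i" using \<open>?J = I'\<close> unfolding C_def by blast
    then have "C j = C i" using min[OF j] fin[OF le] i by (intro card_seteq) auto
    then show "j \<in> carry_class ?p k i" using le j by (auto simp: carry_class_def C_def)
  next
    fix j assume j: "j \<in> carry_class ?p k i"
    then have "j \<in> I'" using closed_weights_saturated[OF p I'] i by blast
    moreover have "j \<notin> I"
    proof
      assume "j \<in> I"
      have "i \<in> carry_class ?p k j" using j le i by (auto simp: carry_class_def)
      then show False using closed_weights_saturated[OF p I \<open>j \<in> I\<close>] i by blast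
    qed
    ultimately show "j \<in> I' - I" by blast
  qed
  then show thesis using that le i by blast
qed

section \<open>Weight vectors\<close>

text \<open>The monomials x^s y^(r-s) have distinct weights 2s - r, so an element of weight 2i - k
  is a multiple of one of them. The equation 2s - r = 2i - k is written without subtraction and
  claimed only for nonzero c, since the zero vector has every weight.\<close>

lemma weight_vector:
  fixes \<theta> :: "'k::field regfun"
  assumes "\<theta> \<in> H0 r" and weight: "\<And>h t. t \<noteq> 0 \<Longrightarrow> t ^ k * \<theta> (h * torus t) = t ^ (2 * i) * \<theta> h"
  obtains c s where "s \<le> r" "\<theta> = kscale c (xy r s)" "c \<noteq> 0 \<Longrightarrow> k + 2 * s = 2 * i + r"
proof -
  obtain q where \<theta>: "\<theta> = (\<lambda>g. \<Sum>s\<le>r. to_ac (q s) * xy r s g)"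
    using assms(1) by (auto simp: H0_eq_span span_xy)
  have wt: "k + 2 * s = 2 * i + r" if "s \<le> r" "q s \<noteq> 0" for s
  proof -
    have eq: "to_ac (q s) * t ^ (k + 2 * s) = to_ac (q s) * t ^ (2 * i + r)" if "t \<noteq> 0" for t
    proof -
      have "(\<Sum>s\<le>r. (to_ac (q s) * t ^ (k + 2 * s) - to_ac (q s) * t ^ (2 * i + r)) * xy r s h) = 0" for h
      proof -
        have "t ^ r * (t ^ k * \<theta> (h * torus t)) = (\<Sum>s\<le>r. to_ac (q s) * t ^ k * (t ^ r * xy r s (h * torus t)))"
          by (simp add: \<theta> sum_distrib_left mult_ac)
        also have "\<dots> = (\<Sum>s\<le>r. to_ac (q s) * t ^ (k + 2 * s) * xy r s h)"
          using that by (intro sum.cong) (simp_all add: xy_torus power_add)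
        finally have "(\<Sum>s\<le>r. to_ac (q s) * t ^ (k + 2 * s) * xy r s h) = t ^ r * (t ^ (2 * i) * \<theta> h)"
          using weight[OF that] by simp
        also have "\<dots> = (\<Sum>s\<le>r. to_ac (q s) * t ^ (2 * i + r) * xy r s h)"
          by (simp add: \<theta> sum_distrib_left power_add mult_ac)
        finally show ?thesis by (simp add: left_diff_distrib sum_subtractf)
      qed
      from xy_independent[OF _ this, of s] \<open>s \<le> r\<close> show ?thesis by simp
    qed
    have "monom 1 (k + 2 * s) = (monom 1 (2 * i + r) :: 'k alg_closure poly)"
      by (rule poly_eq_if_eq_off_0) (use eq \<open>q s \<noteq> 0\<close> in \<open>simp add: poly_monom\<close>)
    then show ?thesis by (simp add: monom_eq_iff')
  qed
  show thesis
  proof (cases "\<exists>s\<le>r. q s \<noteq> 0")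
    case True
    then obtain s where s: "s \<le> r" "q s \<noteq> 0" by blast
    have "q s' = 0" if "s' \<le> r" "s' \<noteq> s" for s' using wt[OF s] wt[of s'] that by auto
    then have "\<theta> = (\<lambda>g. \<Sum>s'\<le>r. if s' = s then to_ac (q s) * xy r s g else 0)"
      unfolding \<theta> by (intro ext sum.cong) auto
    also have "\<dots> = kscale (q s) (xy r s)" using s by (simp add: kscale_def)
    finally show thesis using that s wt by blast
  next
    case False
    then have "\<theta> = kscale 0 (xy r 0)" by (simp add: \<theta> kscale_def)
    then show thesis using that[of 0 0] by simp
  qed
qed

section \<open>Coefficients on the big cell\<close>

text \<open>The functional must accept translates f(g h) by points over the closure, which may leave
  the K-span of the monomials. On the curve \<open>cell\<close> these are still polynomial, and the
  polynomial chosen by \<open>SOME\<close> is then unique because the field is infinite.\<close>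

definition cell_coeff :: "nat \<Rightarrow> ('k::field) regfun \<Rightarrow> 'k alg_closure" where
  "cell_coeff j F = coeff (SOME P. \<forall>t. F (cell t) = poly P t) j"

lemma cell_coeff_sum:
  assumes "\<And>g. F g = (\<Sum>i\<le>k. a i * xy k i g)" "j \<le> k"
  shows "cell_coeff j F = a j"
proof -
  let ?P = "\<Sum>i\<le>k. monom (a i) i"
  have P: "\<forall>t. F (cell t) = poly ?P t" by (simp add: assms poly_sum_monom)
  then have S: "\<forall>t. F (cell t) = poly (SOME P. \<forall>t. F (cell t) = poly P t) t" by (rule someI)
  have "(SOME P. \<forall>t. F (cell t) = poly P t) = ?P"
  proof (rule poly_eq_if_eq_off_0)
    fix t
    show "poly (SOME P. \<forall>t. F (cell t) = poly P t) t = poly ?P t"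
      using spec[OF S, of t] spec[OF P, of t] by (rule trans[OF sym])
  qed
  then show ?thesis using assms(2) coeff_sum_monom[of "{..k}" a j] by (simp add: cell_coeff_def)
qed

lemma H0_translate:
  fixes f :: "'k::field regfun"
  assumes "f \<in> H0 k"
  shows "\<exists>a. \<forall>g. f (g * h) = (\<Sum>i\<le>k. a i * xy k i g)"
proof -
  obtain q where f: "f = (\<lambda>g. \<Sum>i\<le>k. to_ac (q i) * xy k i g)"
    using assms by (auto simp: H0_eq_span span_xy)
  have "\<forall>g. f (g * h) = (\<Sum>j\<le>k. (\<Sum>i\<le>k. to_ac (q i) * matrix_coeff k i j h) * xy k j g)"
  proof
    fix g
    have "f (g * h) = (\<Sum>i\<le>k. \<Sum>j\<le>k. to_ac (q i) * matrix_coeff k i j h * xy k j g)"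
      unfolding f by (intro sum.cong) (simp_all add: xy_mult sum_distrib_left mult.assoc)
    also have "\<dots> = (\<Sum>j\<le>k. (\<Sum>i\<le>k. to_ac (q i) * matrix_coeff k i j h) * xy k j g)"
      unfolding sum_distrib_right by (rule sum.swap)
    finally show "f (g * h) = (\<Sum>j\<le>k. (\<Sum>i\<le>k. to_ac (q i) * matrix_coeff k i j h) * xy k j g)" .
  qed
  then show ?thesis by - (rule exI)
qed

text \<open>
  \<open>frobenius j\<close> corresponds, under Frobenius reciprocity, to the functional that takes the \<open>j\<close>-th
  coefficient.
\<close>

definition frobenius :: "nat \<Rightarrow> ('k::field) regfun \<Rightarrow> 'k regfun" where
  "frobenius j f = (\<lambda>h. cell_coeff j (\<lambda>g. f (g * h)))"

text \<open>Linearity of the functional over the closure; the scalars will be values at a second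
  point. Lists appear because \<open>quotient_iso\<close> presents tensors as lists of
  pairs.\<close>

lemma frobenius_sum_list:
  assumes "\<And>v c. (v, c) \<in> set ts \<Longrightarrow> v \<in> H0 k" "j \<le> k"
    and "\<And>g. F g = (\<Sum>(v, c)\<leftarrow>ts. v (g * h) * c)"
  shows "cell_coeff j F = (\<Sum>(v, c)\<leftarrow>ts. frobenius j v h * c)"
proof -
  have "\<exists>a. (\<forall>g. (\<Sum>(v, c)\<leftarrow>ts. v (g * h) * c) = (\<Sum>i\<le>k. a i * xy k i g)) \<and>
     a j = (\<Sum>(v, c)\<leftarrow>ts. frobenius j v h * c)"
    using assms(1)
  proof (induction ts)
    case Nil
    show ?case by (intro exI[of _ "\<lambda>_. 0"]) simp
  next
    case (Cons x ts)
    obtain v c where x: "x = (v, c)" by (cases x)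
    obtain a where a: "\<forall>g. (\<Sum>(v, c)\<leftarrow>ts. v (g * h) * c) = (\<Sum>i\<le>k. a i * xy k i g)"
      "a j = (\<Sum>(v, c)\<leftarrow>ts. frobenius j v h * c)"
      using Cons by fastforce
    obtain b where b: "\<forall>g. v (g * h) = (\<Sum>i\<le>k. b i * xy k i g)"
      using H0_translate[of v k h] Cons.prems x by auto
    have "frobenius j v h = b j"
      unfolding frobenius_def using b \<open>j \<le> k\<close> by (intro cell_coeff_sum) auto
    then show ?case
      by (intro exI[of _ "\<lambda>i. b i * c + a i"])
         (use a b in \<open>simp add: x distrib_left distrib_right sum.distrib sum_distrib_left sum_distrib_right mult_ac\<close>)
  qed
  then obtain a where a: "\<And>g. (\<Sum>(v, c)\<leftarrow>ts. v (g * h) * c) = (\<Sum>i\<le>k. a i * xy k i g)"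
    "a j = (\<Sum>(v, c)\<leftarrow>ts. frobenius j v h * c)" by blast
  have "cell_coeff j F = a j" using a(1) assms(2,3) by (intro cell_coeff_sum) simp_all
  then show ?thesis using a(2) by simp
qed

lemma frobenius_sum:
  assumes "I \<subseteq> {..k}" "j \<le> k"
  shows "frobenius j (\<lambda>g. \<Sum>i\<in>I. c i * xy k i g) = (\<lambda>h. \<Sum>i\<in>I. c i * matrix_coeff k i j h)"
  unfolding frobenius_def
proof
  fix h
  have fin: "finite I" using assms finite_subset by blast
  have "(\<Sum>i\<in>I. c i * xy k i (g * h)) = (\<Sum>l\<le>k. (\<Sum>i\<in>I. c i * matrix_coeff k i l h) * xy k l g)" for g
  proof -
    have "(\<Sum>i\<in>I. c i * xy k i (g * h)) = (\<Sum>i\<in>I. \<Sum>l\<le>k. c i * matrix_coeff k i l h * xy k l g)"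
      using assms by (intro sum.cong) (auto simp: xy_mult sum_distrib_left mult.assoc)
    also have "\<dots> = (\<Sum>l\<le>k. (\<Sum>i\<in>I. c i * matrix_coeff k i l h) * xy k l g)"
      unfolding sum_distrib_right by (rule sum.swap)
    finally show ?thesis .
  qed
  then show "cell_coeff j (\<lambda>g. \<Sum>i\<in>I. c i * xy k i (g * h)) = (\<Sum>i\<in>I. c i * matrix_coeff k i j h)"
    using assms(2) by (intro cell_coeff_sum)
qed

text \<open>Reading off a coefficient in g commutes with right translation: \<open>comult f\<close>
  is evaluated at (g h, h'), so the functional acts on the factors v, and c(h') is a scalar.\<close>

lemma frobenius_comult:
  assumes f: "comult f = (\<Sum>(v, c)\<leftarrow>ts. tens v c)"
    and ts: "\<And>v c. (v, c) \<in> set ts \<Longrightarrow> v \<in> H0 k" and "j \<le> k"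
  shows "comult (frobenius j f) = (\<Sum>(v, c)\<leftarrow>ts. tens (frobenius j v) c)"
proof
  fix hh :: "'a alg_closure sl2 \<times> 'a alg_closure sl2"
  obtain h h' where hh: "hh = (h, h')" by (cases hh)
  have eval: "(\<Sum>(v, c)\<leftarrow>ts. tens (\<phi> v) c) (g, h') = (\<Sum>(v, c)\<leftarrow>map (\<lambda>(v, c). (v, c h')) ts. \<phi> v g * c)"
    for \<phi> :: "'a regfun \<Rightarrow> 'a regfun" and g
    by (induction ts) (auto simp: tens_def)
  have "f (g * (h * h')) = (\<Sum>(v, c)\<leftarrow>map (\<lambda>(v, c). (v, c h')) ts. v (g * h) * c)" for g
  proof -
    have "f (g * (h * h')) = comult f (g * h, h')" by (simp add: comult_def sl2_mult_assoc)
    also have "\<dots> = (\<Sum>(v, c)\<leftarrow>map (\<lambda>(v, c). (v, c h')) ts. v (g * h) * c)"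
      unfolding f using eval[of "\<lambda>v. v" "g * h"] by simp
    finally show ?thesis .
  qed
  then have "cell_coeff j (\<lambda>g. f (g * (h * h'))) =
      (\<Sum>(v, c)\<leftarrow>map (\<lambda>(v, c). (v, c h')) ts. frobenius j v h * c)"
    using ts \<open>j \<le> k\<close> by (intro frobenius_sum_list[where k = k]) auto
  then show "comult (frobenius j f) hh = (\<Sum>(v, c)\<leftarrow>ts. tens (frobenius j v) c) hh"
    unfolding hh eval by (simp add: comult_def frobenius_def)
qed

text \<open>Translation by b h is translation by h followed by translation by b, whence the order of
  the factors.\<close>

lemma matrix_coeff_mult:
  assumes "i \<le> k" "j \<le> k"
  shows "matrix_coeff k i j (b * h) = (\<Sum>l\<le>k. matrix_coeff k i l h * matrix_coeff k l j b)"
proof -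
  have "xy k i (g * (b * h)) = (\<Sum>j\<le>k. (\<Sum>l\<le>k. matrix_coeff k i l h * matrix_coeff k l j b) * xy k j g)" for g
  proof -
    have "xy k i (g * (b * h)) = (\<Sum>l\<le>k. matrix_coeff k i l h * xy k l (g * b))"
      unfolding sl2_mult_assoc[symmetric] using assms(1) by (rule xy_mult)
    also have "\<dots> = (\<Sum>l\<le>k. \<Sum>j\<le>k. matrix_coeff k i l h * matrix_coeff k l j b * xy k j g)"
      by (intro sum.cong) (simp_all add: xy_mult sum_distrib_left mult.assoc)
    also have "\<dots> = (\<Sum>j\<le>k. (\<Sum>l\<le>k. matrix_coeff k i l h * matrix_coeff k l j b) * xy k j g)"
      unfolding sum_distrib_right by (rule sum.swap)
    finally show ?thesis .
  qed
  from matrix_coeff_unique[OF assms(1) _ this assms(2)] assms(2) show ?thesis by simp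
qed

lemma matrix_coeff_borel:
  assumes "entry b 1 2 = 0" "i \<le> k" "j \<le> k"
  shows "matrix_coeff k i j b = of_nat (i choose j) * entry b 1 1 ^ j * entry b 2 1 ^ (i - j) * entry b 2 2 ^ (k - i)"
proof -
  let ?a = "entry b 1 1" and ?c = "entry b 2 1" and ?d = "entry b 2 2"
  have "xy k i (g * b) = (\<Sum>j\<le>k. (of_nat (i choose j) * ?a ^ j * ?c ^ (i - j) * ?d ^ (k - i)) * xy k j g)" for g
  proof -
    let ?x = "entry g 1 1" and ?y = "entry g 1 2"
    have "xy k i (g * b) = (?x * ?a + ?y * ?c) ^ i * (?y * ?d) ^ (k - i)"
      using assms(1) by (simp add: xy_def entry_times)
    also have "\<dots> = (\<Sum>j\<le>i. of_nat (i choose j) * ?a ^ j * ?c ^ (i - j) * ?d ^ (k - i) * xy k j g)"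
      unfolding binomial_ring sum_distrib_right
    proof (intro sum.cong refl)
      fix j assume "j \<in> {..i}"
      then have "?y ^ (k - j) = ?y ^ (i - j) * ?y ^ (k - i)" using assms by (simp flip: power_add)
      then show "of_nat (i choose j) * (?x * ?a) ^ j * (?y * ?c) ^ (i - j) * (?y * ?d) ^ (k - i)
          = of_nat (i choose j) * ?a ^ j * ?c ^ (i - j) * ?d ^ (k - i) * xy k j g"
        by (simp add: xy_def power_mult_distrib mult_ac)
    qed
    also have "\<dots> = (\<Sum>j\<le>k. of_nat (i choose j) * ?a ^ j * ?c ^ (i - j) * ?d ^ (k - i) * xy k j g)"
      using assms by (intro sum.mono_neutral_left) (auto simp: binomial_eq_0)
    finally show ?thesis .
  qed
  from matrix_coeff_unique[OF assms(2) _ this assms(3)] assms(3) show ?thesis by simp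
qed

lemma matrix_coeff_lower:
  assumes "i \<le> k" "j \<le> k"
  shows "matrix_coeff k i j (lower t) = of_nat (i choose j) * t ^ (i - j)"
  using matrix_coeff_borel[of "lower t" i k j] assms by simp

lemma matrix_coeff_upper:
  assumes "i \<le> k" "j \<le> k"
  shows "matrix_coeff k i j (upper t) = (if i \<le> j then of_nat ((k - i) choose (j - i)) * t ^ (j - i) else 0)"
  using matrix_coeff_unique[OF assms(1) _ xy_upper[OF assms(1)] assms(2), of t] assms(2) by simp

lemma matrix_coeff_torus:
  assumes "i \<le> k" "j \<le> k" "t \<noteq> 0"
  shows "t ^ k * matrix_coeff k i j (torus t) = (if j = i then t ^ (2 * i) else 0)"
proof (cases "j = i")
  case True
  have "t ^ k = t ^ i * t ^ (k - i)" using assms(1) by (simp flip: power_add)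
  then show ?thesis
    using assms True by (simp add: matrix_coeff_borel power_divide mult_2 power_add)
next
  case False
  then show ?thesis using assms
    by (cases "i < j") (simp_all add: matrix_coeff_borel binomial_eq_0 power_0_left)
qed

lemma matrix_coeff_weight:
  assumes "i \<le> k" "j \<le> k" "t \<noteq> 0"
  shows "t ^ k * matrix_coeff k i j (h * torus t) = t ^ (2 * i) * matrix_coeff k i j h"
proof -
  have "t ^ k * matrix_coeff k i j (h * torus t)
    = (\<Sum>l\<le>k. (t ^ k * matrix_coeff k i l (torus t)) * matrix_coeff k l j h)"
    unfolding matrix_coeff_mult[OF assms(1,2)] by (simp add: sum_distrib_left mult.assoc)
  also have "\<dots> = (\<Sum>l\<le>k. if l = i then t ^ (2 * i) * matrix_coeff k i j h else 0)"
    using assms by (intro sum.cong) (auto simp: matrix_coeff_torus)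
  also have "\<dots> = t ^ (2 * i) * matrix_coeff k i j h" using assms(1) by simp
  finally show ?thesis .
qed

section \<open>The layers of a composition series\<close>

lemma coset_eq_iff:
  assumes "K.subspace W"
  shows "coset W f = coset W g \<longleftrightarrow> f - g \<in> W"
proof
  assume "coset W f = coset W g"
  moreover have "f \<in> coset W f" using K.subspace_0[OF assms] by (force simp: coset_def)
  ultimately obtain w where "w \<in> W" "f = g + w" unfolding coset_def by auto
  then show "f - g \<in> W" by simp
next
  assume fg: "f - g \<in> W"
  have "f + w \<in> coset W g" if "w \<in> W" for w
    using K.subspace_add[OF assms fg that] unfolding coset_def
    by (intro CollectI exI[of _ "f - g + w"]) simp
  moreover have "g + w \<in> coset W f" if "w \<in> W" for w
    using K.subspace_diff[OF assms that fg] unfolding coset_def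
    by (intro CollectI exI[of _ "w - (f - g)"]) simp
  ultimately show "coset W f = coset W g" unfolding coset_def by blast
qed

section \<open>One layer and the map given by its greatest exponent\<close>

context
  fixes k i0 t r :: nat and I I' C :: "nat set"
  assumes prime: "prime CHAR('k::field)"
    and I: "closed_weights CHAR('k) k I" and I': "closed_weights CHAR('k) k I'" and sub: "I \<subseteq> I'"
    and i0: "i0 \<le> k" and C: "C = carry_class CHAR('k) k i0" and layer: "I' - I = C"
    and t: "t = Max C" and r: "r = 2 * t - k"
begin

lemma layer_top: "t \<in> C" "t \<le> k" "k \<le> 2 * t"
  using Max_carry_class_greatest[OF prime_gt_1_nat[OF prime] i0] by (auto simp: t C carry_class_def)

lemma layer_le: "i \<in> C \<Longrightarrow> i \<le> t"
  unfolding t C by (rule Max_ge[OF finite_carry_class])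

text \<open>The class is symmetric under i -> k - i, so its least element is k - t.\<close>

lemma layer_ge:
  assumes "i \<in> C"
  shows "k \<le> i + t"
proof -
  have "i \<le> k" using assms by (simp add: C carry_class_def)
  then have "k - i \<in> C" using assms carry_sym[of "CHAR('k)" i k] prime_gt_0_nat[OF prime]
    by (simp add: C carry_class_def)
  then show ?thesis using layer_le[of "k - i"] by simp
qed

lemma layer_not_I: "t \<in> I'" "t \<notin> I"
  using layer_top(1) layer by auto

lemma coeff_eq_0_I: "i \<in> I \<Longrightarrow> matrix_coeff k i t (h :: 'k alg_closure sl2) = 0"
  using matrix_coeff_closed[OF I] layer_top(2) layer_not_I(2) by blast

lemma sum_layer:
  fixes F :: "nat \<Rightarrow> 'b::comm_monoid_add"
  assumes "\<And>i. i \<in> I \<Longrightarrow> F i = 0"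
  shows "sum F I' = sum F C"
  unfolding layer[symmetric]
  by (rule sum.mono_neutral_right) (use assms closed_weights_finite[OF I'] in auto)

text \<open>In the product formula for b h with b in the Borel subgroup, an intermediate l outside
  I' contributes nothing since I' is closed, an l in I since I is closed and misses t, and an l < t
  of the layer since b only lowers exponents. What remains is l = t with the factor b11^t b22^(k-t)
  = b11^r.\<close>

lemma coeff_H0:
  assumes "i \<in> I'"
  shows "(matrix_coeff k i t :: 'k regfun) \<in> H0 r"
proof -
  have ik: "i \<le> k" using closed_weights_le[OF I' assms] .
  have "matrix_coeff k i t (b * h) = entry b 1 1 ^ r * matrix_coeff k i t h"
    if b: "entry b 1 2 = 0" for b h :: "'k alg_closure sl2"
  proof -
    have summand: "matrix_coeff k i l h * matrix_coeff k l t b =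
      (if l = t then entry b 1 1 ^ r * matrix_coeff k i t h else 0)" if "l \<le> k" for l
    proof -
      consider "l = t" | "l \<noteq> t" "l \<notin> I'" | "l \<in> I" "l \<noteq> t" | "l \<in> C" "l \<noteq> t"
        using layer by blast
      then show ?thesis
      proof cases
        case 1
        have "entry b 1 1 * entry b 2 2 = 1" using entry_det[of b] b by simp
        then have "(entry b 1 1 * entry b 2 2) ^ (k - t) = 1" by simp
        moreover have "entry b 1 1 ^ t = entry b 1 1 ^ r * entry b 1 1 ^ (k - t)"
          using layer_top r by (simp flip: power_add)
        ultimately have "entry b 1 1 ^ t * entry b 2 2 ^ (k - t) = entry b 1 1 ^ r"
          by (simp add: power_mult_distrib mult.assoc)
        then show ?thesis using 1 b layer_top(2) by (simp add: matrix_coeff_borel)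
      next
        case 2
        then show ?thesis using matrix_coeff_closed[OF I' assms \<open>l \<le> k\<close>] by simp
      next
        case 3
        then show ?thesis using coeff_eq_0_I by simp
      next
        case 4
        then have "l < t" using layer_le[of l] by simp
        then show ?thesis using b that layer_top(2) by (simp add: matrix_coeff_borel binomial_eq_0)
      qed
    qed
    have "matrix_coeff k i t (b * h) = (\<Sum>l\<le>k. if l = t then entry b 1 1 ^ r * matrix_coeff k i t h else 0)"
      unfolding matrix_coeff_mult[OF ik layer_top(2)] by (rule sum.cong) (use summand in auto)
    then show ?thesis using layer_top(2) by simp
  qed
  then show ?thesis unfolding H0_def using matrix_coeff_coord_ring by auto
qed

text \<open>
  On the product of \<open>lower c\<close> and \<open>upper 1\<close> the matrix coefficient is a polynomial in \<open>c\<close>, to which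
  the intermediate weights contribute different powers of \<open>c\<close>.
\<close>

lemma coeff_neq_0:
  assumes "i \<in> C"
  shows "matrix_coeff k i t \<noteq> (0 :: 'k regfun)"
proof
  assume "matrix_coeff k i t = (0 :: 'k regfun)"
  then have zero: "matrix_coeff k i t h = 0" for h :: "'k alg_closure sl2" by simp
  have ik: "i \<le> k" using assms by (simp add: C carry_class_def)
  have "t \<in> carry_class CHAR('k) k i" using assms layer_top(1) by (simp add: C carry_class_def)
  \<comment> \<open>The path from i down to m and up to t gives the coefficient of c^(i-m), a
    product of two binomial coefficients prime to the characteristic.\<close>
  then obtain m where m: "m \<le> i" "m \<le> t" "\<not> CHAR('k) dvd (i choose m)" "\<not> CHAR('k) dvd ((k - m) choose (t - m))"
    using carry_connected[OF prime ik] by blast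
  define a where "a l = of_nat (i choose l) * (if l \<le> t then of_nat ((k - l) choose (t - l)) else 0 :: 'k alg_closure)" for l
  let ?P = "\<Sum>l\<le>k. monom (a l) (i - l)"
  have "poly ?P c = 0" for c
  proof -
    have "matrix_coeff k i t (upper 1 * lower c) = (\<Sum>l\<le>k. a l * c ^ (i - l))"
      unfolding matrix_coeff_mult[OF ik layer_top(2)] using ik layer_top(2)
      by (intro sum.cong) (auto simp: matrix_coeff_lower matrix_coeff_upper a_def)
    then show ?thesis using zero by (simp add: poly_sum poly_monom)
  qed
  then have "?P = 0" by (intro poly_eq_if_eq_off_0) simp
  then have "(\<Sum>l\<le>k. if i - l = i - m then a l else 0) = 0"
  proof -
    have "coeff ?P (i - m) = 0" by (simp only: \<open>?P = 0\<close> coeff_0)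
    then show ?thesis by (simp add: coeff_sum)
  qed
  moreover have "(\<Sum>l\<le>k. if i - l = i - m then a l else 0) = (\<Sum>l\<le>k. if l = m then a m else 0)"
  proof (intro sum.cong refl)
    \<comment> \<open>For l > i the difference i - l is truncated, but then (i choose l) =
      0.\<close>
    fix l show "(if i - l = i - m then a l else 0) = (if l = m then a m else 0)"
      using m(1) by (cases "l \<le> i") (auto simp: a_def binomial_eq_0)
  qed
  ultimately have "a m = 0" using m(1) ik by simp
  then show False using m by (simp add: a_def of_nat_alg_closure_eq_0_iff)
qed

text \<open>Weights leave only one monomial: 2s - r = 2i - k with r = 2t - k gives s = i + t - k, a
  true difference by \<open>layer_ge\<close>.\<close>

lemma layer_coeff_exists:
  assumes "i \<in> C"
  shows "\<exists>c. c \<noteq> 0 \<and> matrix_coeff k i t = (kscale c (xy r (i + t - k)) :: 'k regfun)"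
proof -
  have ik: "i \<le> k" and "i \<in> I'" using assms layer by (auto simp: C carry_class_def)
  obtain c s where cs: "s \<le> r" "matrix_coeff k i t = (kscale c (xy r s) :: 'k regfun)"
    "c \<noteq> 0 \<Longrightarrow> k + 2 * s = 2 * i + r"
    using weight_vector[OF coeff_H0[OF \<open>i \<in> I'\<close>] matrix_coeff_weight[OF ik layer_top(2)]] by metis
  have "c \<noteq> 0"
  proof
    assume "c = 0"
    then show False using cs(2) coeff_neq_0[OF assms] by simp
  qed
  moreover from this have "s = i + t - k" using cs(3) r layer_top(3) layer_ge[OF assms] by simp
  ultimately show ?thesis using cs by blast
qed

definition layer_coeff :: "nat \<Rightarrow> 'k" where
  "layer_coeff i = (SOME c. c \<noteq> 0 \<and> matrix_coeff k i t = (kscale c (xy r (i + t - k)) :: 'k regfun))"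

lemma layer_coeff:
  assumes "i \<in> C"
  shows "layer_coeff i \<noteq> 0"
    and "matrix_coeff k i t h = to_ac (layer_coeff i) * xy r (i + t - k) (h :: 'k alg_closure sl2)"
proof -
  have *: "layer_coeff i \<noteq> 0 \<and> matrix_coeff k i t = (kscale (layer_coeff i) (xy r (i + t - k)) :: 'k regfun)"
    unfolding layer_coeff_def by (rule someI_ex[OF layer_coeff_exists[OF assms]])
  then show "layer_coeff i \<noteq> 0" ..
  show "matrix_coeff k i t h = to_ac (layer_coeff i) * xy r (i + t - k) h"
    using conjunct2[OF *] by (simp add: kscale_def)
qed

definition layer_weights :: "nat set" where
  "layer_weights = (\<lambda>i. i + t - k) ` C"

lemma layer_weights_le: "layer_weights \<subseteq> {..r}"
  unfolding layer_weights_def r using layer_le by fastforce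

lemma finite_layer_weights: "finite layer_weights"
  unfolding layer_weights_def by (intro finite_imageI) (simp add: C finite_carry_class)

lemma sum_layer_weights:
  "(\<Sum>i\<in>C. F i (i + t - k)) = (\<Sum>s\<in>layer_weights. F (s + k - t) s)"
  unfolding layer_weights_def
proof (subst sum.reindex)
  show "inj_on (\<lambda>i. i + t - k) C"
  proof (rule inj_onI)
    fix i j assume "i \<in> C" "j \<in> C" "i + t - k = j + t - k"
    then show "i = j" using layer_ge[of i] layer_ge[of j] by simp
  qed
  show "(\<Sum>i\<in>C. F i (i + t - k)) = sum ((\<lambda>s. F (s + k - t) s) \<circ> (\<lambda>i. i + t - k)) C"
    by (rule sum.cong) (use layer_ge in auto)
qed

text \<open>\<open>matrix_coeff k t t\<close> is a nonzero multiple of x^r. Its translate by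
  \<open>lower 1\<close> is expanded in two ways: in \<open>H0 r\<close> with coefficients (r choose
  s), and through the layer with coefficients (t choose l) times nonzero scalars. As t dominates its
  class digitwise, the latter are all nonzero, so (r choose s) is nonzero in K exactly on the
  shifted class.\<close>

lemma layer_weights_eq: "layer_weights = simple_weights CHAR('k) r"
proof -
  let ?\<kappa> = "\<lambda>i. to_ac (layer_coeff i)"
  define c where "c s = (if s \<in> layer_weights then of_nat (t choose (s + k - t)) * ?\<kappa> (s + k - t) else 0)" for s
  have "?\<kappa> t * of_nat (r choose s) = c s" if "s \<le> r" for s
  proof -
    have "(\<Sum>s\<le>r. (?\<kappa> t * of_nat (r choose s) - c s) * xy r s h) = 0" for h
    proof -
      have "(\<Sum>l\<le>k. matrix_coeff k t l (lower 1) * matrix_coeff k l t h)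
          = (\<Sum>l\<le>k. of_nat (t choose l) * matrix_coeff k l t h)"
        using layer_top(2) by (intro sum.cong) (simp_all add: matrix_coeff_lower)
      \<comment> \<open>Lower steps from t stay in the closed set I', so (t choose l) vanishes in K
        for all other l.\<close>
      also have "\<dots> = (\<Sum>l\<in>I'. of_nat (t choose l) * matrix_coeff k l t h)"
        using closed_weights_subset[OF I'] closed_weights_lower[OF I' layer_not_I(1)]
        by (intro sum.mono_neutral_right) (auto simp: of_nat_alg_closure_eq_0_iff)
      also have "\<dots> = (\<Sum>l\<in>C. of_nat (t choose l) * matrix_coeff k l t h)"
        by (rule sum_layer) (simp add: coeff_eq_0_I)
      also have "\<dots> = (\<Sum>l\<in>C. of_nat (t choose l) * ?\<kappa> l * xy r (l + t - k) h)"
        by (intro sum.cong) (simp_all add: layer_coeff(2))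
      also have "\<dots> = (\<Sum>s\<in>layer_weights. of_nat (t choose (s + k - t)) * ?\<kappa> (s + k - t) * xy r s h)"
        by (rule sum_layer_weights)
      also have "\<dots> = (\<Sum>s\<le>r. c s * xy r s h)"
        using layer_weights_le by (intro sum.mono_neutral_cong_left) (auto simp: c_def)
      finally have "matrix_coeff k t t (h * lower 1) = (\<Sum>s\<le>r. c s * xy r s h)"
        unfolding matrix_coeff_mult[OF layer_top(2) layer_top(2)] .
      moreover have "matrix_coeff k t t (h * lower 1) = ?\<kappa> t * xy r r (h * lower 1)"
        using layer_coeff(2)[OF layer_top(1), of "h * lower 1"] r by (simp add: mult_2)
      ultimately show ?thesis
        by (simp add: xy_lower left_diff_distrib sum_subtractf sum_distrib_left mult.assoc)
    qed
    from xy_independent[OF _ this, of s] that show ?thesis by simp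
  qed note rel = this
  have \<kappa>: "?\<kappa> i \<noteq> 0" if "i \<in> C" for i using layer_coeff(1)[OF that] by simp
  have "s \<in> layer_weights \<longleftrightarrow> \<not> CHAR('k) dvd (r choose s)" for s
  proof (cases "s \<le> r")
    case True
    show ?thesis
    proof (cases "s \<in> layer_weights")
      case True
      then obtain i where i: "i \<in> C" "s = i + t - k" by (auto simp: layer_weights_def)
      have "s + k - t = i" using i layer_ge[of i] by simp
      moreover have "\<not> CHAR('k) dvd (t choose i)"
        unfolding not_dvd_choose_iff_digits[OF prime]
        using Max_carry_class_greatest(3)[OF prime_gt_1_nat[OF prime] i0] i(1) by (simp add: t C)
      ultimately have "c s \<noteq> 0"
        using True \<kappa>[OF i(1)] by (simp add: c_def of_nat_alg_closure_eq_0_iff)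
      then show ?thesis using True rel[OF \<open>s \<le> r\<close>, symmetric]
        by (simp add: of_nat_alg_closure_eq_0_iff)
    next
      case False
      then have "?\<kappa> t * of_nat (r choose s) = 0" using rel[OF \<open>s \<le> r\<close>] by (simp add: c_def)
      then show ?thesis using False \<kappa>[OF layer_top(1)] by (simp add: of_nat_alg_closure_eq_0_iff)
    qed
  next
    case False
    then show ?thesis using layer_weights_le by (auto simp: binomial_eq_0)
  qed
  then show ?thesis by (auto simp: simple_weights_def)
qed

abbreviation "Vtop \<equiv> K.span (xy k ` I') :: 'k regfun set"
abbreviation "Vbot \<equiv> K.span (xy k ` I) :: 'k regfun set"

lemma frobenius_layer:
  "frobenius t (\<lambda>g. \<Sum>i\<in>I'. to_ac (q i) * xy k i g) =
    (\<lambda>h. \<Sum>s\<in>layer_weights. to_ac (q (s + k - t) * layer_coeff (s + k - t)) * xy r s (h :: 'k alg_closure sl2))"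
proof -
  have "(\<Sum>i\<in>I'. to_ac (q i) * matrix_coeff k i t h) =
     (\<Sum>s\<in>layer_weights. to_ac (q (s + k - t) * layer_coeff (s + k - t)) * xy r s h)" for h
  proof -
    have "(\<Sum>i\<in>I'. to_ac (q i) * matrix_coeff k i t h) = (\<Sum>i\<in>C. to_ac (q i) * matrix_coeff k i t h)"
      by (rule sum_layer) (simp add: coeff_eq_0_I)
    also have "\<dots> = (\<Sum>i\<in>C. to_ac (q i * layer_coeff i) * xy r (i + t - k) h)"
      by (intro sum.cong) (simp_all add: layer_coeff(2) mult.assoc)
    also have "\<dots> = (\<Sum>s\<in>layer_weights. to_ac (q (s + k - t) * layer_coeff (s + k - t)) * xy r s h)"
      by (rule sum_layer_weights)
    finally show ?thesis .
  qed
  then show ?thesis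
    unfolding frobenius_sum[OF closed_weights_subset[OF I'] layer_top(2)] by simp
qed

lemma Vtop_iff: "f \<in> Vtop \<longleftrightarrow> (\<exists>q. f = (\<lambda>g. \<Sum>i\<in>I'. to_ac (q i) * xy k i g))"
  by (rule span_xy[OF closed_weights_finite[OF I']])

lemma frobenius_add:
  assumes "f \<in> Vtop" "f' \<in> Vtop"
  shows "frobenius t (f + f') = frobenius t f + frobenius t f'"
proof -
  obtain q where f: "f = (\<lambda>g. \<Sum>i\<in>I'. to_ac (q i) * xy k i g)" using assms Vtop_iff by blast
  obtain q' where f': "f' = (\<lambda>g. \<Sum>i\<in>I'. to_ac (q' i) * xy k i g)" using assms Vtop_iff by blast
  have "f + f' = (\<lambda>g. \<Sum>i\<in>I'. to_ac (q i + q' i) * xy k i g)"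
    by (simp add: f f' fun_eq_iff distrib_right sum.distrib)
  then show ?thesis
    unfolding f f' by (simp only: frobenius_layer) (simp add: fun_eq_iff distrib_right sum.distrib)
qed

lemma frobenius_kscale:
  assumes "f \<in> Vtop"
  shows "frobenius t (kscale c f) = kscale c (frobenius t f)"
proof -
  obtain q where f: "f = (\<lambda>g. \<Sum>i\<in>I'. to_ac (q i) * xy k i g)" using assms Vtop_iff by blast
  have "kscale c f = (\<lambda>g. \<Sum>i\<in>I'. to_ac (c * q i) * xy k i g)"
    by (simp add: f fun_eq_iff kscale_def sum_distrib_left mult.assoc)
  then show ?thesis
    unfolding f by (simp only: frobenius_layer) (simp add: fun_eq_iff kscale_def sum_distrib_left mult.assoc)
qed

text \<open>Monomials from I go to 0, and those from the layer go to nonzero multiples of distinct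
  monomials.\<close>

lemma frobenius_eq_0_iff:
  assumes "f \<in> Vtop"
  shows "frobenius t f = 0 \<longleftrightarrow> f \<in> Vbot"
proof
  obtain q where f: "f = (\<lambda>g. \<Sum>i\<in>I'. to_ac (q i) * xy k i g)" using assms Vtop_iff by blast
  assume "frobenius t f = 0"
  then have "(\<Sum>s\<in>layer_weights. to_ac (q (s + k - t) * layer_coeff (s + k - t)) * xy r s h) = 0"
    for h :: "'k alg_closure sl2"
    unfolding f frobenius_layer by (simp add: fun_eq_iff)
  from xy_independent[OF finite_layer_weights this]
  have *: "q (s + k - t) * layer_coeff (s + k - t) = 0" if "s \<in> layer_weights" for s
    using that by (metis to_ac_eq_0_iff)
  have "q i = 0" if "i \<in> I'" "i \<notin> I" for i
  proof -
    have i: "i \<in> C" using that layer by blast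
    then have "i + t - k \<in> layer_weights" by (auto simp: layer_weights_def)
    from *[OF this] show ?thesis using layer_ge[OF i] layer_coeff(1)[OF i] by simp
  qed
  then have "f = (\<lambda>g. \<Sum>i\<in>I. to_ac (q i) * xy k i g)"
    unfolding f using sub closed_weights_finite[OF I'] by (intro ext sum.mono_neutral_right) auto
  then show "f \<in> Vbot" using span_xy[OF closed_weights_finite[OF I]] by blast
next
  assume "f \<in> Vbot"
  then obtain q where f: "f = (\<lambda>g. \<Sum>i\<in>I. to_ac (q i) * xy k i g)"
    using span_xy[OF closed_weights_finite[OF I]] by blast
  show "frobenius t f = 0"
    unfolding f frobenius_sum[OF closed_weights_subset[OF I] layer_top(2)] by (simp add: coeff_eq_0_I fun_eq_iff)
qed

lemma frobenius_image: "frobenius t ` Vtop = Lsimple r"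
  unfolding Lsimple_eq_span[OF prime] layer_weights_eq[symmetric]
proof (intro equalityI subsetI)
  fix \<theta> :: "'k regfun" assume "\<theta> \<in> frobenius t ` Vtop"
  then obtain f where f: "f \<in> Vtop" "\<theta> = frobenius t f" by blast
  then obtain q where "f = (\<lambda>g. \<Sum>i\<in>I'. to_ac (q i) * xy k i g)" using Vtop_iff by blast
  then have "\<theta> = frobenius t (\<lambda>g. \<Sum>i\<in>I'. to_ac (q i) * xy k i g)" using f by simp
  then show "\<theta> \<in> K.span (xy r ` layer_weights)"
    unfolding frobenius_layer span_xy[OF finite_layer_weights] by - (rule exI)
next
  fix \<theta> :: "'k regfun" assume "\<theta> \<in> K.span (xy r ` layer_weights)"
  then obtain c where \<theta>: "\<theta> = (\<lambda>h. \<Sum>s\<in>layer_weights. to_ac (c s) * xy r s h)"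
    using span_xy[OF finite_layer_weights] by blast
  define q where "q i = c (i + t - k) / layer_coeff i" for i
  have "q (s + k - t) * layer_coeff (s + k - t) = c s" if s: "s \<in> layer_weights" for s
  proof -
    obtain i where i: "i \<in> C" "s = i + t - k" using s by (auto simp: layer_weights_def)
    then have "s + k - t = i" using layer_ge[of i] by simp
    then show ?thesis using i layer_coeff(1)[OF i(1)] by (simp add: q_def)
  qed
  then have "\<theta> = frobenius t (\<lambda>g. \<Sum>i\<in>I'. to_ac (q i) * xy k i g)"
    unfolding frobenius_layer \<theta> by (intro ext sum.cong) (simp_all only:)
  moreover have "(\<lambda>g. \<Sum>i\<in>I'. to_ac (q i) * xy k i g) \<in> Vtop" using Vtop_iff by blast
  ultimately show "\<theta> \<in> frobenius t ` Vtop" by blast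
qed

lemma quotient_iso_layer: "quotient_iso Vtop Vbot (Lsimple r :: 'k regfun set)"
proof -
  have subW: "K.subspace Vbot" and subV: "K.subspace Vtop" by (rule K.subspace_span)+
  \<comment> \<open>By \<open>eq_iff\<close> below, the value does not depend on the representative
    that \<open>SOME\<close> picks.\<close>
  define \<psi> where "\<psi> A = frobenius t (SOME f. f \<in> Vtop \<and> coset Vbot f = A)" for A
  have eq_iff: "frobenius t f = frobenius t f' \<longleftrightarrow> coset Vbot f = coset Vbot f'"
    if "f \<in> Vtop" "f' \<in> Vtop" for f f'
  proof -
    have d: "f - f' \<in> Vtop" using K.subspace_diff[OF subV that] .
    have "frobenius t f = frobenius t (f - f') + frobenius t f'"
      using frobenius_add[OF d that(2)] by simp
    then show ?thesis using frobenius_eq_0_iff[OF d] coset_eq_iff[OF subW, of f f'] by auto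
  qed
  have \<psi>: "\<psi> (coset Vbot f) = frobenius t f" if "f \<in> Vtop" for f
  proof -
    have "\<exists>f'. f' \<in> Vtop \<and> coset Vbot f' = coset Vbot f" using that by blast
    from someI_ex[OF this] show ?thesis unfolding \<psi>_def using eq_iff that by blast
  qed
  have "inj_on \<psi> (coset Vbot ` Vtop)"
    by (rule inj_onI) (use \<psi> eq_iff in auto)
  moreover have "\<psi> ` coset Vbot ` Vtop = Lsimple r"
    unfolding frobenius_image[symmetric] image_image by (rule image_cong[OF refl \<psi>])
  ultimately have "bij_betw \<psi> (coset Vbot ` Vtop) (Lsimple r)" by (simp add: bij_betw_def)
  moreover have "\<psi> (coset Vbot (f + g)) = \<psi> (coset Vbot f) + \<psi> (coset Vbot g)" if "f \<in> Vtop" "g \<in> Vtop" for f g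
    using that K.subspace_add[OF subV that] by (simp add: \<psi> frobenius_add)
  moreover have "\<psi> (coset Vbot (kscale c f)) = kscale c (\<psi> (coset Vbot f))" if "f \<in> Vtop" for c f
    using that K.subspace_scale[OF subV that] by (simp add: \<psi> frobenius_kscale)
  moreover have "comult (\<psi> (coset Vbot f)) = (\<Sum>(v, c)\<leftarrow>ts. tens (\<psi> (coset Vbot v)) c)"
    if "f \<in> Vtop" "set ts \<subseteq> Vtop \<times> coord_ring" "comult f = (\<Sum>(v, c)\<leftarrow>ts. tens v c)" for f ts
  proof -
    have "v \<in> H0 k" if "(v, c) \<in> set ts" for v c
      using that \<open>set ts \<subseteq> _\<close> span_xy_subset_H0[OF closed_weights_subset[OF I']] by blast
    from frobenius_comult[OF that(3) this layer_top(2)]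
    have "comult (\<psi> (coset Vbot f)) = (\<Sum>(v, c)\<leftarrow>ts. tens (frobenius t v) c)"
      using \<psi>[OF that(1)] by simp
    also have "\<dots> = (\<Sum>(v, c)\<leftarrow>ts. tens (\<psi> (coset Vbot v)) c)"
      using that(2) by (intro arg_cong[of _ _ sum_list] map_cong) (auto simp: \<psi>)
    finally show ?thesis .
  qed
  ultimately show ?thesis unfolding quotient_iso_def by blast
qed

end

text \<open>Any isomorphism sends the monomials of the layer to weight vectors in
  \<open>H0 r\<close>, whose weights 2s - r are at most r, and the highest weight vector x^r must
  come from one of them. Hence r = 2i - k for the greatest i in the layer.\<close>

lemma quotient_iso_weight:
  assumes prime: "prime CHAR('k::field)"
    and I: "closed_weights CHAR('k) k I" and I': "closed_weights CHAR('k) k I'" and "I \<subseteq> I'"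
    and iso: "quotient_iso (K.span (xy k ` I')) (K.span (xy k ` I)) (Lsimple r :: 'k regfun set)"
  shows "r + k = 2 * Max (I' - I)"
proof -
  let ?V = "K.span (xy k ` I') :: 'k regfun set" and ?W = "K.span (xy k ` I) :: 'k regfun set"
  have subW: "K.subspace ?W" and subV: "K.subspace ?V" by (rule K.subspace_span)+
  have fin: "finite I'" using closed_weights_finite[OF I'] .
  have le: "i \<le> k" if "i \<in> I'" for i using closed_weights_le[OF I' that] .
  have xyV: "xy k i \<in> ?V" if "i \<in> I'" for i using that by (intro K.span_base) simp
  obtain \<psi> where bij: "bij_betw \<psi> (coset ?W ` ?V) (Lsimple r)"
    and add: "\<And>f g. f \<in> ?V \<Longrightarrow> g \<in> ?V \<Longrightarrow> \<psi> (coset ?W (f + g)) = \<psi> (coset ?W f) + \<psi> (coset ?W g)"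
    and scale: "\<And>c f. f \<in> ?V \<Longrightarrow> \<psi> (coset ?W (kscale c f)) = kscale c (\<psi> (coset ?W f))"
    and equiv: "\<And>f ts. f \<in> ?V \<Longrightarrow> set ts \<subseteq> ?V \<times> coord_ring \<Longrightarrow> comult f = (\<Sum>(v, c)\<leftarrow>ts. tens v c) \<Longrightarrow>
        comult (\<psi> (coset ?W f)) = (\<Sum>(v, c)\<leftarrow>ts. tens (\<psi> (coset ?W v)) c)"
    using iso unfolding quotient_iso_def by blast
  define \<theta> where "\<theta> i = \<psi> (coset ?W (xy k i))" for i
  have zero: "\<psi> (coset ?W 0) = 0"
    using scale[OF K.subspace_0[OF subV], of 0] by simp
  have \<theta>_mem: "\<theta> i \<in> Lsimple r" if "i \<in> I'" for i
    using bij xyV[OF that] unfolding \<theta>_def bij_betw_def by blast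
  have \<theta>_0: "\<theta> i = 0 \<longleftrightarrow> i \<in> I" if "i \<in> I'" for i
  proof -
    have "\<theta> i = 0 \<longleftrightarrow> coset ?W (xy k i) = coset ?W 0"
      using bij xyV[OF that] K.subspace_0[OF subV] zero unfolding \<theta>_def bij_betw_def
      by (metis image_eqI inj_onD)
    also have "\<dots> \<longleftrightarrow> xy k i \<in> ?W" using coset_eq_iff[OF subW, of "xy k i" 0] by simp
    also have "\<dots> \<longleftrightarrow> i \<in> I" using xy_mem_span_iff[OF closed_weights_subset[OF I] le[OF that]] .
    finally show ?thesis .
  qed
  have weight: "t ^ k * \<theta> i (h * torus t) = t ^ (2 * i) * \<theta> i h" if "i \<in> I'" "t \<noteq> 0" for i h t
  proof -
    \<comment> \<open>\<open>quotient_iso\<close> speaks of lists of tensors, so the sum over I' in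
      \<open>comult_xy\<close> is enumerated.\<close>
    obtain js where js: "distinct js" "set js = I'" using finite_distinct_list[OF fin] by blast
    let ?ts = "map (\<lambda>j. (xy k j, matrix_coeff k i j :: 'k regfun)) js"
    have "comult (xy k i :: 'k regfun) = (\<Sum>(v, c)\<leftarrow>?ts. tens v c)"
      unfolding comult_xy[OF I' \<open>i \<in> I'\<close>] using js by (simp add: sum.distinct_set_conv_list o_def flip: js(2))
    moreover have "set ?ts \<subseteq> ?V \<times> coord_ring" using js xyV matrix_coeff_coord_ring by auto
    ultimately have "comult (\<theta> i) = (\<Sum>(v, c)\<leftarrow>?ts. tens (\<psi> (coset ?W v)) c)"
      unfolding \<theta>_def using equiv[OF xyV[OF \<open>i \<in> I'\<close>]] by blast
    also have "\<dots> = (\<Sum>j\<in>I'. tens (\<theta> j) (matrix_coeff k i j))"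
      using js by (simp add: sum.distinct_set_conv_list o_def \<theta>_def flip: js(2))
    finally have "comult (\<theta> i) (h, torus t) = (\<Sum>j\<in>I'. tens (\<theta> j) (matrix_coeff k i j)) (h, torus t)" by simp
    then have "\<theta> i (h * torus t) = (\<Sum>j\<in>I'. \<theta> j h * matrix_coeff k i j (torus t))"
      by (simp add: comult_def tens_def sum_fun_apply)
    then have "t ^ k * \<theta> i (h * torus t) = (\<Sum>j\<in>I'. \<theta> j h * (t ^ k * matrix_coeff k i j (torus t)))"
      by (simp add: sum_distrib_left mult.left_commute)
    also have "\<dots> = (\<Sum>j\<in>I'. if j = i then t ^ (2 * i) * \<theta> i h else 0)"
      using le that by (intro sum.cong) (auto simp: matrix_coeff_torus)
    also have "\<dots> = t ^ (2 * i) * \<theta> i h" using fin \<open>i \<in> I'\<close> by simp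
    finally show ?thesis .
  qed
  have "\<exists>c s. s \<le> r \<and> \<theta> i = kscale c (xy r s) \<and> (c \<noteq> 0 \<longrightarrow> k + 2 * s = 2 * i + r)" if "i \<in> I'" for i
  proof -
    have "\<theta> i \<in> H0 r" using \<theta>_mem[OF that] Lsimple_subset_H0[OF prime] by blast
    from weight_vector[OF this weight[OF that]] show ?thesis by metis
  qed
  then obtain c s where cs: "\<And>i. i \<in> I' \<Longrightarrow> s i \<le> r" "\<And>i. i \<in> I' \<Longrightarrow> \<theta> i = kscale (c i) (xy r (s i))"
    "\<And>i. i \<in> I' \<Longrightarrow> c i \<noteq> 0 \<Longrightarrow> k + 2 * s i = 2 * i + r"
    by metis
  have c_0: "c i \<noteq> 0 \<longleftrightarrow> i \<notin> I" if "i \<in> I'" for i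
    using cs(2)[OF that] \<theta>_0[OF that] xy_neq_0[of r "s i"] by (metis K.scale_eq_0_iff)
  have upper: "2 * i \<le> r + k" if "i \<in> I' - I" for i
    using cs(1,3)[of i] c_0[of i] that by fastforce
  have "xy r r \<in> (Lsimple r :: 'k regfun set)"
    unfolding Lsimple_eq_span[OF prime] using prime not_prime_unit
    by (intro K.span_base) (auto simp: simple_weights_def)
  then have "xy r r \<in> \<psi> ` coset ?W ` ?V" using bij by (simp add: bij_betw_def)
  then obtain f where f: "f \<in> ?V" "\<psi> (coset ?W f) = xy r r" by fastforce
  then obtain q where "f = (\<lambda>g. \<Sum>i\<in>I'. to_ac (q i) * xy k i g)" using span_xy[OF fin] by blast
  then have fq: "f = (\<Sum>i\<in>I'. kscale (q i) (xy k i))" by (simp add: fun_eq_iff kscale_def sum_fun_apply)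
  \<comment> \<open>Additivity of \<psi> is known only on the larger module, so membership of the
    partial sums is carried along.\<close>
  have part: "(\<Sum>i\<in>J. kscale (q i) (xy k i)) \<in> ?V \<and>
      \<psi> (coset ?W (\<Sum>i\<in>J. kscale (q i) (xy k i))) = (\<Sum>i\<in>J. kscale (q i) (\<theta> i))" if "finite J" "J \<subseteq> I'" for J
    using that
  proof (induction J)
    case empty
    show ?case unfolding sum.empty using zero K.subspace_0[OF subV] by blast
  next
    case (insert j J)
    have j: "kscale (q j) (xy k j) \<in> ?V" using insert.prems by (intro K.subspace_scale[OF subV] xyV) simp
    have J: "(\<Sum>i\<in>J. kscale (q i) (xy k i)) \<in> ?V"
      "\<psi> (coset ?W (\<Sum>i\<in>J. kscale (q i) (xy k i))) = (\<Sum>i\<in>J. kscale (q i) (\<theta> i))"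
      using insert by simp_all
    have scj: "\<psi> (coset ?W (kscale (q j) (xy k j))) = kscale (q j) (\<theta> j)"
      unfolding \<theta>_def using insert.prems by (intro scale xyV) simp
    show ?case
      unfolding sum.insert[OF insert.hyps(1,2)] add[OF j J(1)] J(2) scj
      using K.subspace_add[OF subV j J(1)] by blast
  qed
  from part[OF fin] f(2) fq have eq: "xy r r = (\<Sum>i\<in>I'. kscale (q i) (\<theta> i))" by simp
  have "\<exists>i\<in>I'. c i \<noteq> 0 \<and> s i = r"
  proof (rule ccontr)
    assume no: "\<not> ?thesis"
    have "xy r r (h :: 'k alg_closure sl2) = (\<Sum>i\<in>I'. to_ac (q i * c i) * xy r (s i) h)" for h
      unfolding eq using cs(2) by (simp add: sum_fun_apply kscale_def mult.assoc)
    note xyr = this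
    \<comment> \<open>On \<open>cell\<close> the expansion of x^r becomes an identity of powers of
      t. If no s_i with c_i nonzero equals r, the right side has no term t^r.\<close>
    have "monom 1 r = (\<Sum>i\<in>I'. monom (to_ac (q i * c i)) (s i))"
    proof (rule poly_eq_if_eq_off_0)
      fix t :: "'k alg_closure"
      show "poly (monom 1 r) t = poly (\<Sum>i\<in>I'. monom (to_ac (q i * c i)) (s i)) t"
        using xyr[of "cell t"] by (simp add: poly_monom poly_sum)
    qed
    then have "coeff (monom 1 r) r = coeff (\<Sum>i\<in>I'. monom (to_ac (q i * c i)) (s i)) r" by simp
    moreover have "coeff (\<Sum>i\<in>I'. monom (to_ac (q i * c i)) (s i)) r = 0"
      unfolding coeff_sum using no by (intro sum.neutral) auto
    ultimately show False by simp
  qed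
  then obtain i where i: "i \<in> I'" "c i \<noteq> 0" "s i = r" by blast
  then have "i \<in> I' - I" "r + k = 2 * i" using c_0[OF i(1)] cs(3)[OF i(1,2)] by auto
  moreover from this have "Max (I' - I) = i"
    using upper fin by (intro Max_eqI) fastforce+
  ultimately show ?thesis by simp
qed

section \<open>Composition series\<close>

lemma span_xy_mono_iff:
  assumes "I \<subseteq> {..k}" "J \<subseteq> {..k}"
  shows "K.span (xy k ` I) \<subseteq> (K.span (xy k ` J) :: 'k::field regfun set) \<longleftrightarrow> I \<subseteq> J"
proof
  assume sub: "K.span (xy k ` I) \<subseteq> (K.span (xy k ` J) :: 'k regfun set)"
  show "I \<subseteq> J"
  proof
    fix i assume "i \<in> I"
    then have "xy k i \<in> (K.span (xy k ` J) :: 'k regfun set)"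
      using sub K.span_base[of "xy k i" "xy k ` I"] by blast
    then show "i \<in> J" using xy_mem_span_iff[OF assms(2)] assms(1) \<open>i \<in> I\<close> by blast
  qed
qed (intro K.span_mono image_mono)

lemma submodule_between:
  fixes U :: "'k::field regfun set"
  assumes "sl2_submodule U" "U \<subseteq> K.span (xy k ` I')" "I' \<subseteq> {..k}"
  shows "U = K.span (xy k ` weights k U)" "closed_weights CHAR('k) k (weights k U)" "weights k U \<subseteq> I'"
proof -
  show U: "U = K.span (xy k ` weights k U)"
    using submodule_eq_span_weights[OF assms(1)] assms(2) span_xy_subset_H0[OF assms(3)] by blast
  show "closed_weights CHAR('k) k (weights k U)" using weights_closed[OF assms(1)] .
  then show "weights k U \<subseteq> I'"
    using span_xy_mono_iff[OF closed_weights_subset assms(3)] U assms(2) by metis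
qed

lemma composition_series_snoc:
  assumes Vs: "composition_series W Vs" and "W \<subset> V" "sl2_submodule V"
    and between: "\<And>U. sl2_submodule U \<Longrightarrow> W \<subseteq> U \<Longrightarrow> U \<subseteq> V \<Longrightarrow> U = W \<or> U = V"
  shows "composition_series V (Vs @ [V])"
proof -
  let ?step = "\<lambda>A B. A \<subset> B \<and> (\<forall>U. sl2_submodule U \<and> A \<subseteq> U \<and> U \<subseteq> B \<longrightarrow> U = A \<or> U = B)"
  have ne: "Vs \<noteq> []" and last: "last Vs = W"
    and step: "\<And>i. Suc i < length Vs \<Longrightarrow> ?step (Vs ! i) (Vs ! Suc i)"
    using Vs unfolding composition_series_def by blast+
  have "?step ((Vs @ [V]) ! i) ((Vs @ [V]) ! Suc i)" if "Suc i < length (Vs @ [V])" for i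
  proof (cases "Suc i < length Vs")
    case True
    then show ?thesis using step[of i] by (simp add: nth_append)
  next
    case False
    then have i: "Suc i = length Vs" using that by simp
    then have "Vs ! i = W" using last ne by (simp add: last_conv_nth flip: i)
    then have "(Vs @ [V]) ! i = W" "(Vs @ [V]) ! Suc i = V" using i by (auto simp: nth_append)
    then show ?thesis using \<open>W \<subset> V\<close> between by simp
  qed
  then show ?thesis using Vs \<open>sl2_submodule V\<close> unfolding composition_series_def by simp
qed

text \<open>A proper closed subset of greatest cardinality gives a maximal submodule, because every
  submodule in between is spanned by a closed set of monomials.\<close>

lemma composition_series_exists:
  "closed_weights CHAR('k::field) k I \<Longrightarrow>
    \<exists>Vs. composition_series (K.span (xy k ` I) :: 'k regfun set) Vs"
proof (induction "card I" arbitrary: I rule: less_induct)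
  case less
  note I = less.prems
  have fin: "finite I" using closed_weights_finite[OF I] .
  show ?case
  proof (cases "I = {}")
    case True
    have "sl2_submodule ({0} :: 'k regfun set)"
      using submodule_span_xy[OF I] True by simp
    then show ?thesis using True by (intro exI[of _ "[{0}]"]) (simp add: composition_series_def)
  next
    case False
    let ?P = "\<lambda>J. closed_weights CHAR('k) k J \<and> J \<subset> I"
    have "?P {}" using False closed_weights_empty by blast
    moreover have "card J < card I" if "?P J" for J using that fin by (intro psubset_card_mono) auto
    ultimately have "\<exists>J. ?P J \<and> (\<forall>J'. ?P J' \<longrightarrow> card J' \<le> card J)"
      by (intro ex_has_greatest_nat[of ?P "{}" card "card I"]) simp_all
    then obtain J where J: "closed_weights CHAR('k) k J" "J \<subset> I"
      and max: "\<And>J'. ?P J' \<Longrightarrow> card J' \<le> card J" by blast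
    let ?V = "K.span (xy k ` I) :: 'k regfun set" and ?W = "K.span (xy k ` J) :: 'k regfun set"
    have "card J < card I" using J(2) fin by (intro psubset_card_mono)
    then obtain Vs where Vs: "composition_series ?W Vs" using less.hyps J(1) by blast
    have "?W \<subset> ?V"
      using span_xy_mono_iff[OF closed_weights_subset[OF J(1)] closed_weights_subset[OF I]]
        span_xy_mono_iff[OF closed_weights_subset[OF I] closed_weights_subset[OF J(1)]] J(2) by blast
    moreover have "U = ?W \<or> U = ?V" if U: "sl2_submodule U" "?W \<subseteq> U" "U \<subseteq> ?V" for U
    proof -
      note bw = submodule_between[OF U(1,3) closed_weights_subset[OF I]]
      have "J \<subseteq> weights k U"
        using span_xy_mono_iff[OF closed_weights_subset[OF J(1)] closed_weights_subset[OF bw(2)]] bw(1) U(2)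
        by metis
      moreover have "weights k U = J" if "weights k U \<noteq> I"
        using max[of "weights k U"] that bw(2,3) \<open>J \<subseteq> weights k U\<close> fin finite_subset
        by (metis card_seteq psubsetI)
      ultimately show ?thesis using bw(1) by metis
    qed
    moreover have "sl2_submodule ?V" using submodule_span_xy[OF I] .
    ultimately show ?thesis using composition_series_snoc[OF Vs] by blast
  qed
qed

lemma composition_series_weights:
  fixes Vs :: "'k::field regfun set list"
  assumes prime: "prime CHAR('k)" and series: "composition_series (H0 k) Vs"
  defines "W n \<equiv> weights k (Vs ! n)"
  shows "n < length Vs \<Longrightarrow> closed_weights CHAR('k) k (W n)"
    and "n < length Vs \<Longrightarrow> Vs ! n = K.span (xy k ` W n)"
    and "m \<le> n \<Longrightarrow> n < length Vs \<Longrightarrow> W m \<subseteq> W n"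
    and "W 0 = {}" and "W (length Vs - 1) = {..k}"
    and "Suc n < length Vs \<Longrightarrow> \<exists>i\<le>k. W (Suc n) - W n = carry_class CHAR('k) k i"
proof -
  have ne: "Vs \<noteq> []" and hd: "hd Vs = {0}" and last: "last Vs = H0 k"
    and sub: "\<And>V. V \<in> set Vs \<Longrightarrow> sl2_submodule V"
    and less: "\<And>i. Suc i < length Vs \<Longrightarrow> Vs ! i \<subset> Vs ! Suc i"
    and step: "\<And>i U. Suc i < length Vs \<Longrightarrow> sl2_submodule U \<Longrightarrow> Vs ! i \<subseteq> U \<Longrightarrow> U \<subseteq> Vs ! Suc i \<Longrightarrow>
      U = Vs ! i \<or> U = Vs ! Suc i"
    using series unfolding composition_series_def by blast+
  have mono: "Vs ! m \<subseteq> Vs ! n" if "m \<le> n" "n < length Vs" for m n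
    using that
  proof (induction n rule: dec_induct)
    case (step n)
    then show ?case using less[of n] by auto
  qed simp
  have H0: "Vs ! n \<subseteq> H0 k" if "n < length Vs" for n
    using mono[of n "length Vs - 1"] that last ne by (simp add: last_conv_nth)
  show closed: "closed_weights CHAR('k) k (W n)" if "n < length Vs" for n
    unfolding W_def using that sub by (intro weights_closed) simp
  show eq: "Vs ! n = K.span (xy k ` W n)" if "n < length Vs" for n
    unfolding W_def using that sub H0 by (intro submodule_eq_span_weights) simp_all
  show Wmono: "W m \<subseteq> W n" if "m \<le> n" "n < length Vs" for m n
    using mono[OF that] by (auto simp: W_def weights_def)
  show "W 0 = {}" using hd ne xy_neq_0 by (auto simp: W_def weights_def hd_conv_nth)
  have "xy k i \<in> (H0 k :: 'k regfun set)" if "i \<le> k" for i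
    unfolding H0_eq_span using that by (intro K.span_base) simp
  then show "W (length Vs - 1) = {..k}"
    using last ne by (auto simp: W_def weights_def last_conv_nth)
  show "\<exists>i\<le>k. W (Suc n) - W n = carry_class CHAR('k) k i" if n: "Suc n < length Vs"
  proof -
    have n': "n < length Vs" using n by simp
    have "W n \<subset> W (Suc n)"
      using Wmono[of n "Suc n"] n less[OF n] eq[OF n] eq[OF n'] by auto
    moreover have "J = W n \<or> J = W (Suc n)"
      if J: "closed_weights CHAR('k) k J" "W n \<subseteq> J" "J \<subseteq> W (Suc n)" for J
    proof -
      have "K.span (xy k ` J) = Vs ! n \<or> K.span (xy k ` J) = Vs ! Suc n"
        unfolding eq[OF n] eq[OF n'] using J(2,3)
        by (intro step[OF n, unfolded eq[OF n] eq[OF n']] submodule_span_xy[OF J(1)] K.span_mono image_mono)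
      then show ?thesis
        using weights_span[OF closed_weights_subset[OF J(1)], where ?'k = 'k] unfolding W_def by metis
    qed
    ultimately show ?thesis using closed_weights_step[OF prime closed[OF n'] closed[OF n]] by metis
  qed
qed

text \<open>Differences of successive weight sets are disjoint and cover all exponents. Each
  contains its maximum, so the maxima, and with them the highest weights, are distinct; and each
  carry class is one of the differences.\<close>

lemma composition_factor_weights:
  fixes Vs :: "'k::field regfun set list"
  assumes prime: "prime CHAR('k)" and series: "composition_series (H0 k) Vs"
  shows "\<exists>ls. factor_weights Vs ls"
    and "factor_weights Vs ls \<Longrightarrow> distinct ls"
    and "factor_weights Vs ls \<Longrightarrow>
      int ` set ls = (\<lambda>i. 2 * int (Max (carry_class CHAR('k) k i)) - int k) ` {..k}"
proof -
  define W where "W n = weights k (Vs ! n)" for n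
  note cs = composition_series_weights[OF prime series, folded W_def]
  have ne: "Vs \<noteq> []" using series by (simp add: composition_series_def)
  have iso: "quotient_iso (Vs ! Suc n) (Vs ! n) (Lsimple (2 * Max (W (Suc n) - W n) - k))" if n: "Suc n < length Vs" for n
  proof -
    have n': "n < length Vs" using n by simp
    obtain i where "i \<le> k" "W (Suc n) - W n = carry_class CHAR('k) k i" using cs(6)[OF n] by blast
    then show ?thesis
      unfolding cs(2)[OF n] cs(2)[OF n']
      using quotient_iso_layer[OF prime cs(1)[OF n'] cs(1)[OF n] cs(3)[OF _ n] _ refl _ refl refl] by simp
  qed
  let ?ls = "map (\<lambda>n. 2 * Max (W (Suc n) - W n) - k) [0..<length Vs - 1]"
  have "factor_weights Vs ?ls" unfolding factor_weights_def using iso ne by auto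
  then show "\<exists>ls. factor_weights Vs ls" by blast
  assume fw: "factor_weights Vs ls"
  then have len: "length Vs = Suc (length ls)" by (simp add: factor_weights_def)
  have nth: "ls ! n + k = 2 * Max (W (Suc n) - W n)" if n: "n < length ls" for n
  proof -
    have n1: "Suc n < length Vs" "n < length Vs" using n len by auto
    have "quotient_iso (Vs ! Suc n) (Vs ! n) (Lsimple (ls ! n))" using fw n by (simp add: factor_weights_def)
    then show ?thesis unfolding cs(2)[OF n1(1)] cs(2)[OF n1(2)]
      using quotient_iso_weight[OF prime cs(1)[OF n1(2)] cs(1)[OF n1(1)]] cs(3)[OF _ n1(1), of n] by simp
  qed
  have layer: "\<exists>i\<le>k. W (Suc n) - W n = carry_class CHAR('k) k i" if "n < length ls" for n
    using cs(6)[of n] that len by simp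
  have Max_in: "Max (W (Suc n) - W n) \<in> W (Suc n) - W n" if "n < length ls" for n
  proof -
    obtain i where "i \<le> k" "W (Suc n) - W n = carry_class CHAR('k) k i" using layer[OF \<open>n < length ls\<close>] by blast
    moreover have "i \<in> carry_class CHAR('k) k i" using \<open>i \<le> k\<close> by (simp add: carry_class_def)
    ultimately show ?thesis using Max_in[OF finite_carry_class, of "CHAR('k)" k i] by auto
  qed
  have neq: "ls ! m \<noteq> ls ! n" if "m < n" "n < length ls" for m n
  proof
    assume "ls ! m = ls ! n"
    then have "Max (W (Suc m) - W m) = Max (W (Suc n) - W n)" using nth[of m] nth[of n] that by simp
    moreover have "W (Suc m) \<subseteq> W n" using cs(3)[of "Suc m" n] that len by simp
    ultimately show False using Max_in[of m] Max_in[of n] that by auto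
  qed
  show "distinct ls" unfolding distinct_conv_nth using neq by (metis nat_neq_iff)
  show "int ` set ls = (\<lambda>i. 2 * int (Max (carry_class CHAR('k) k i)) - int k) ` {..k}"
  proof (intro equalityI subsetI)
    fix x assume "x \<in> int ` set ls"
    then obtain n where n: "n < length ls" "x = int (ls ! n)" by (auto simp: in_set_conv_nth)
    obtain i where i: "i \<le> k" "W (Suc n) - W n = carry_class CHAR('k) k i" using layer[OF n(1)] by blast
    then have "x = 2 * int (Max (carry_class CHAR('k) k i)) - int k" using nth[OF n(1)] n(2) by simp
    then show "x \<in> (\<lambda>i. 2 * int (Max (carry_class CHAR('k) k i)) - int k) ` {..k}" using i(1) by blast
  next
    fix x assume "x \<in> (\<lambda>i. 2 * int (Max (carry_class CHAR('k) k i)) - int k) ` {..k}"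
    then obtain i where i: "i \<le> k" "x = 2 * int (Max (carry_class CHAR('k) k i)) - int k" by blast
    have "i \<in> W (length ls)" using cs(5) i(1) len by simp
    \<comment> \<open>The least index is positive because \<open>W 0\<close> is empty; the layer
      that ends there contains i and is therefore its carry class.\<close>
    then have least: "i \<in> W (LEAST n. i \<in> W n)" "(LEAST n. i \<in> W n) \<le> length ls"
      by (auto intro: LeastI Least_le)
    have "(LEAST n. i \<in> W n) \<noteq> 0" using least(1) cs(4) by (metis empty_iff)
    then obtain n where n: "(LEAST n. i \<in> W n) = Suc n" by (metis not0_implies_Suc)
    then have in_layer: "i \<in> W (Suc n) - W n" using least(1) not_less_Least[of n "\<lambda>n. i \<in> W n"] by simp
    have nl: "n < length ls" using least(2) n by simp
    obtain j where j: "j \<le> k" "W (Suc n) - W n = carry_class CHAR('k) k j" using layer[OF nl] by blast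
    have "carry_class CHAR('k) k i = carry_class CHAR('k) k j"
      using in_layer unfolding j(2) by (auto simp: carry_class_def)
    then have "x = int (ls ! n)" using nth[OF nl] i(2) j(2) by simp
    then show "x \<in> int ` set ls" using nl by auto
  qed
qed

theorem proposition6p2:
  fixes p k u :: nat and a :: "nat \<Rightarrow> nat"
  assumes "CHAR('k::field) = p" and "p > 0"
    and "k + 1 = (\<Sum>i\<le>u. a i * p ^ i)" and "\<forall>i\<le>u. a i < p"
  shows "(\<exists>Vs. composition_series (H0 k :: 'k regfun set) Vs) \<and>
    (\<forall>Vs. composition_series (H0 k :: 'k regfun set) Vs \<longrightarrow>
      (\<exists>ls. factor_weights Vs ls) \<and>
      (\<forall>ls. factor_weights Vs ls \<longrightarrow>
        ((\<forall>i\<le>u. a i \<noteq> 0 \<and> a i \<noteq> p - 1) \<longrightarrow>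
          int ` set ls = {ell p a k w |w. w \<in> Wu u \<and> ell p a k w \<ge> 0}) \<and>
        distinct ls \<and>
        int ` set ls = {ell p a k w |w. w \<in> Wu u \<and> ell p a k w \<ge> 0 \<and>
          (\<forall>i\<le>u. a i = p - 1 \<longrightarrow> w i \<noteq> GT) \<and>
          (\<forall>i\<le>u. a i = 0 \<longrightarrow> w i \<noteq> LT)}))"
proof -
  have p: "CHAR('k) = p" using assms(1) .
  have prime: "prime CHAR('k)" using assms(1,2) by (intro prime_CHAR_semidom) simp
  have "closed_weights CHAR('k) k {..k}"
    unfolding closed_weights_def
  proof (intro conjI ballI allI impI)
    fix i j assume i: "i \<in> {..k}"
    show "j \<in> {..k}" if "\<not> CHAR('k) dvd (i choose j)"
      using that i by (cases "j \<le> i") (auto simp: binomial_eq_0)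
    show "j \<in> {..k}" if "i \<le> j" "\<not> CHAR('k) dvd ((k - i) choose (j - i))"
      using that i by (cases "j - i \<le> k - i") (auto simp: binomial_eq_0)
  qed simp
  then have ex: "\<exists>Vs. composition_series (H0 k :: 'k regfun set) Vs"
    unfolding H0_eq_span by (rule composition_series_exists)
  note ell_eq = admissible_ell_eq[OF prime_gt_1_nat[OF prime, unfolded p] assms(3,4)]
  show ?thesis
  proof (intro conjI allI impI)
    show "\<exists>Vs. composition_series (H0 k :: 'k regfun set) Vs" by (rule ex)
    fix Vs assume "composition_series (H0 k :: 'k regfun set) Vs"
    note factors = composition_factor_weights[OF prime this, unfolded p]
    show "\<exists>ls. factor_weights Vs ls" by (rule factors(1))
    fix ls assume ls: "factor_weights Vs ls"
    show "distinct ls" by (rule factors(2)[OF ls])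
    show all: "int ` set ls = {ell p a k w |w. w \<in> Wu u \<and> ell p a k w \<ge> 0 \<and>
          (\<forall>i\<le>u. a i = p - 1 \<longrightarrow> w i \<noteq> GT) \<and> (\<forall>i\<le>u. a i = 0 \<longrightarrow> w i \<noteq> LT)}"
      unfolding ell_eq by (rule factors(3)[OF ls])
    \<comment> \<open>When no digit is 0 or p - 1, both filters are vacuous.\<close>
    show "int ` set ls = {ell p a k w |w. w \<in> Wu u \<and> ell p a k w \<ge> 0}"
      if "\<forall>i\<le>u. a i \<noteq> 0 \<and> a i \<noteq> p - 1"
      unfolding all using that by blast
  qed
qed

end
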